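(* Let $[a,b]\subset\mathbb{R}$ be a compact interval, let $n\geq 0$, $r\geq 1$, $m\geq 1$ be integers, and let $\varepsilon_0>0$. For every $\varepsilon\in[0,\varepsilon_0)$ let matrix-valued functions $K_{r-j}(\cdot,\varepsilon)\in(C^{(n)})^{m\times m}$, $j\in\{1,\ldots,r\}$, and a continuous linear operator $B(\varepsilon):(C^{(n+r)})^m\to\mathbb{C}^{rm}$ be arbitrarily given, and consider the boundary-value problem $$L(\varepsilon)z(t,\varepsilon)\equiv z^{(r)}(t,\varepsilon)+\sum_{j=1}^{r}K_{r-j}(t,\varepsilon)z^{(r-j)}(t,\varepsilon)=f(t,\varepsilon),\quad a\leq t\leq b,\qquad B(\varepsilon)z(\cdot,\varepsilon)=q(\varepsilon),$$ with unknown $z(\cdot,\varepsilon)\in(C^{(n+r)})^m$ and right-hand sides $f(\cdot,\varepsilon)\in(C^{(n)})^m$, $q(\varepsilon)\in\mathbb{C}^{rm}$. Then the solution to this problem is continuous in the parameter $\varepsilon$ at $\varepsilon=0$ (in the sense defined in the context) if and only if the following three conditions all hold: (0) the limiting homogeneous problem $L(0)z=0$ on $[a,b]$, $B(0)z=0$ has only the trivial solution $z\in(C^{(n+r)})^m$; (I) $K_{r-j}(\cdot,\varepsilon)\to K_{r-j}(\cdot,0)$ in $(C^{(n)})^{m\times m}$ as $\varepsilon\to0+$ for each $j\in\{1,\ldots,r\}$; (II) $B(\varepsilon)z\to B(0)z$ in $\mathbb{C}^{rm}$ as $\varepsilon\to0+$ for every $z\in(C^{(n+r)})^m$.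
   Context: For an integer $l\geq0$, $C^{(l)}=C^{(l)}([a,b],\mathbb{C})$ is the Banach space of $l$ times continuously differentiable functions $x:[a,b]\to\mathbb{C}$ with norm $\|x\|_{(l)}=\sum_{j=0}^{l}\max\{|x^{(j)}(t)|:t\in[a,b]\}$; $(C^{(l)})^{m}=C^{(l)}([a,b],\mathbb{C}^m)$ and $(C^{(l)})^{m\times m}=C^{(l)}([a,b],\mathbb{C}^{m\times m})$ are the Banach spaces of vector-valued and matrix-valued functions with components in $C^{(l)}$, with norm equal to the sum of the $\|\cdot\|_{(l)}$-norms of all components. Derivatives of $z(\cdot,\varepsilon)$ are with respect to $t$. Vectors are columns. Definition. The solution to the boundary-value problem is said to be continuous in the parameter $\varepsilon$ at $\varepsilon=0$ if the following two conditions are fulfilled: $(\ast)$ there exists a positive number $\varepsilon_1<\varepsilon_0$ such that for arbitrary $\varepsilon\in[0,\varepsilon_1)$, $f(\cdot,\varepsilon)\in(C^{(n)})^m$ and $q(\varepsilon)\in\mathbb{C}^{rm}$ the problem has a unique solution $z(\cdot,\varepsilon)\in(C^{(n+r)})^m$; $(\ast\ast)$ for all families of right-hand sides, if $f(\cdot,\varepsilon)\to f(\cdot,0)$ in $(C^{(n)})^m$ and $q(\varepsilon)\to q(0)$ in $\mathbb{C}^{rm}$ as $\varepsilon\to0+$, then the corresponding solutions satisfy $z(\cdot,\varepsilon)\to z(\cdot,0)$ in $(C^{(n+r)})^m$ as $\varepsilon\to0+$. *)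

theory Defs
  imports "HOL-Analysis.Analysis"
begin

text \<open>
  A function on the compact interval \<open>{a..b}\<close> is encoded as a function on the whole line that is
  0 off \<open>{a..b}\<close>. Thus \<open>C_space a b l\<close> is in bijection with the space $C^{(l)}([a,b],C)$,
  the linear structure is pointwise, and equality of members is equality of functions on
  \<open>{a..b}\<close>. Derivatives are taken within \<open>{a..b}\<close>, i.e. they are one-sided at the end points;
  the values of \<open>deriv_on\<close> off \<open>{a..b}\<close> are irrelevant and never used. All this presupposes
  \<open>a < b\<close>.
\<close>

primrec deriv_on :: "real \<Rightarrow> real \<Rightarrow> nat \<Rightarrow> (real \<Rightarrow> 'a::real_normed_vector) \<Rightarrow> real \<Rightarrow> 'a" where
  "deriv_on a b 0 x = x"
| "deriv_on a b (Suc k) x = (\<lambda>t. vector_derivative (deriv_on a b k x) (at t within {a..b}))"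

definition C_space :: "real \<Rightarrow> real \<Rightarrow> nat \<Rightarrow> (real \<Rightarrow> complex) set" where
  "C_space a b l = {x.
     (\<forall>t. t \<notin> {a..b} \<longrightarrow> x t = 0) \<and>
     (\<forall>k<l. \<forall>t\<in>{a..b}. deriv_on a b k x differentiable (at t within {a..b})) \<and>
     (\<forall>k\<le>l. continuous_on {a..b} (deriv_on a b k x))}"

text \<open>The supremum below is a maximum for members of \<open>C_space a b l\<close>.\<close>

definition C_norm :: "real \<Rightarrow> real \<Rightarrow> nat \<Rightarrow> (real \<Rightarrow> complex) \<Rightarrow> real" where
  "C_norm a b l x = (\<Sum>j\<le>l. SUP t\<in>{a..b}. cmod (deriv_on a b j x t))"

definition Cvec_space :: "real \<Rightarrow> real \<Rightarrow> nat \<Rightarrow> (real \<Rightarrow> complex ^ 'm) set" where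
  "Cvec_space a b l = {x. \<forall>i. (\<lambda>t. x t $ i) \<in> C_space a b l}"

definition Cvec_norm :: "real \<Rightarrow> real \<Rightarrow> nat \<Rightarrow> (real \<Rightarrow> complex ^ 'm) \<Rightarrow> real" where
  "Cvec_norm a b l x = (\<Sum>i\<in>UNIV. C_norm a b l (\<lambda>t. x t $ i))"

definition Cmat_space :: "real \<Rightarrow> real \<Rightarrow> nat \<Rightarrow> (real \<Rightarrow> complex ^ 'm ^ 'm) set" where
  "Cmat_space a b l = {X. \<forall>i k. (\<lambda>t. X t $ i $ k) \<in> C_space a b l}"

definition Cmat_norm :: "real \<Rightarrow> real \<Rightarrow> nat \<Rightarrow> (real \<Rightarrow> complex ^ 'm ^ 'm) \<Rightarrow> real" where
  "Cmat_norm a b l X = (\<Sum>i\<in>UNIV. \<Sum>k\<in>UNIV. C_norm a b l (\<lambda>t. X t $ i $ k))"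

text \<open>Convergence as the parameter tends to 0 from the right, to the value at the parameter 0.\<close>

definition Cvec_tends :: "real \<Rightarrow> real \<Rightarrow> nat \<Rightarrow> (real \<Rightarrow> real \<Rightarrow> complex ^ 'm) \<Rightarrow> bool" where
  "Cvec_tends a b l x \<longleftrightarrow>
     ((\<lambda>\<epsilon>. Cvec_norm a b l (\<lambda>t. x \<epsilon> t - x 0 t)) \<longlongrightarrow> 0) (at_right 0)"

definition Cmat_tends :: "real \<Rightarrow> real \<Rightarrow> nat \<Rightarrow> (real \<Rightarrow> real \<Rightarrow> complex ^ 'm ^ 'm) \<Rightarrow> bool" where
  "Cmat_tends a b l X \<longleftrightarrow>
     ((\<lambda>\<epsilon>. Cmat_norm a b l (\<lambda>t. X \<epsilon> t - X 0 t)) \<longlongrightarrow> 0) (at_right 0)"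

text \<open>Only the restriction of the operator to \<open>Cvec_space a b l\<close> matters.\<close>

definition continuous_linear_op ::
    "real \<Rightarrow> real \<Rightarrow> nat \<Rightarrow> ((real \<Rightarrow> complex ^ 'm) \<Rightarrow> complex ^ 'k) \<Rightarrow> bool" where
  "continuous_linear_op a b l T \<longleftrightarrow>
     (\<forall>x\<in>Cvec_space a b l. \<forall>y\<in>Cvec_space a b l. T (\<lambda>t. x t + y t) = T x + T y) \<and>
     (\<forall>c. \<forall>x\<in>Cvec_space a b l. T (\<lambda>t. c *s x t) = c *s T x) \<and>
     (\<forall>x\<in>Cvec_space a b l. \<forall>e>0. \<exists>d>0. \<forall>y\<in>Cvec_space a b l.
        Cvec_norm a b l (\<lambda>t. y t - x t) < d \<longrightarrow> norm (T y - T x) < e)"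

text \<open>
  \<open>K i \<epsilon> t\<close> is the coefficient of the \<open>i\<close>-th derivative, \<open>i < r\<close>, at the parameter \<open>\<epsilon>\<close> and
  the point \<open>t\<close>.
\<close>

definition L_op ::
    "real \<Rightarrow> real \<Rightarrow> nat \<Rightarrow> (nat \<Rightarrow> real \<Rightarrow> real \<Rightarrow> complex ^ 'm ^ 'm) \<Rightarrow> real \<Rightarrow>
     (real \<Rightarrow> complex ^ 'm) \<Rightarrow> real \<Rightarrow> complex ^ 'm" where
  "L_op a b r K \<epsilon> z t =
     deriv_on a b r z t + (\<Sum>j=1..r. K (r - j) \<epsilon> t *v deriv_on a b (r - j) z t)"

definition is_solution ::
    "real \<Rightarrow> real \<Rightarrow> nat \<Rightarrow> nat \<Rightarrow> (nat \<Rightarrow> real \<Rightarrow> real \<Rightarrow> complex ^ 'm ^ 'm) \<Rightarrow>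
     (real \<Rightarrow> (real \<Rightarrow> complex ^ 'm) \<Rightarrow> complex ^ 'k) \<Rightarrow> real \<Rightarrow>
     (real \<Rightarrow> complex ^ 'm) \<Rightarrow> complex ^ 'k \<Rightarrow> (real \<Rightarrow> complex ^ 'm) \<Rightarrow> bool" where
  "is_solution a b n r K B \<epsilon> f q z \<longleftrightarrow>
     z \<in> Cvec_space a b (n + r) \<and> (\<forall>t\<in>{a..b}. L_op a b r K \<epsilon> z t = f t) \<and> B \<epsilon> z = q"

text \<open>
  The threshold \<open>\<epsilon>1\<close> is shared by both conditions: the solutions in the second condition are
  those which the first one provides for \<open>\<epsilon> \<in> {0..<\<epsilon>1}\<close>.
\<close>

definition solution_continuous_at_0 ::
    "real \<Rightarrow> real \<Rightarrow> nat \<Rightarrow> nat \<Rightarrow> real \<Rightarrow> (nat \<Rightarrow> real \<Rightarrow> real \<Rightarrow> complex ^ 'm ^ 'm) \<Rightarrow>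
     (real \<Rightarrow> (real \<Rightarrow> complex ^ 'm) \<Rightarrow> complex ^ 'k) \<Rightarrow> bool" where
  "solution_continuous_at_0 a b n r \<epsilon>0 K B \<longleftrightarrow>
     (\<exists>\<epsilon>1. 0 < \<epsilon>1 \<and> \<epsilon>1 < \<epsilon>0 \<and>
        (\<forall>\<epsilon>\<in>{0..<\<epsilon>1}. \<forall>f\<in>Cvec_space a b n. \<forall>q. \<exists>!z. is_solution a b n r K B \<epsilon> f q z) \<and>
        (\<forall>f q z.
           (\<forall>\<epsilon>\<in>{0..<\<epsilon>0}. f \<epsilon> \<in> Cvec_space a b n) \<longrightarrow>
           Cvec_tends a b n f \<longrightarrow>
           (q \<longlongrightarrow> q 0) (at_right 0) \<longrightarrow>
           (\<forall>\<epsilon>\<in>{0..<\<epsilon>1}. is_solution a b n r K B \<epsilon> (f \<epsilon>) (q \<epsilon>) (z \<epsilon>)) \<longrightarrow>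
           Cvec_tends a b (n + r) z))"

end

theory Submission
  imports Defs
begin

text \<open>
  The boundary-value problem splits into an initial-value problem, which depends continuously on
  the coefficients, and a square linear system for the initial data. Stacking the derivatives of
  order below \<open>r\<close> into one vector, the jet, turns the differential equation into a linear first
  order system. Its solutions exist, are unique, and, whenever the coefficients and the right-hand
  sides converge with \<open>n\<close> derivatives and the initial jets converge, they converge with
  \<open>n + r\<close> derivatives (\<open>initial_value_problem\<close>, \<open>homogeneous_solution_vanishing\<close>,
  \<open>solution_limit\<close>).

  For sufficiency, the solution for given data is the solution with zero initial jet plus a
  combination of a fundamental system normalized at the left end point. The coefficients of the
  combination solve a square system whose matrix consists of the boundary values of the fundamental
  system. That matrix is invertible at the parameter 0, because the limit problem has trivial
  kernel, and it is continuous at 0. The latter uses that a pointwise convergent family of continuous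
  operators also converges along convergent arguments (\<open>op_family_tendsto\<close>), a consequence of
  the Banach--Steinhaus principle. Invertibility therefore persists for small parameters, and by
  Cramer's rule the coefficients converge.

  For necessity, the solutions \<open>Y \<epsilon> l\<close> of the homogeneous equation whose boundary values are
  the unit vectors converge by assumption. Their jets form an invertible matrix at every point of the
  segment, so the equation, read as a linear system for the coefficient functions, recovers them by
  Cramer's rule as convergent quotients of convergent functions. Finally, let \<open>w \<epsilon>\<close> solve the
  perturbed problem with the right-hand side \<open>L(\<epsilon>) z\<close> and the boundary value \<open>B(0) z\<close>. Then
  \<open>w \<epsilon>\<close> tends to \<open>z\<close>, and \<open>z - w \<epsilon>\<close> is the combination of the \<open>Y \<epsilon> l\<close> with
  coefficient vector \<open>B(\<epsilon>) z - B(0) z\<close>. Inverting the jet matrix at one point shows that this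
  vector tends to 0.
\<close>

section \<open>Differentiability classes on a segment and convergence in them\<close>


lemma sum_axis: "(\<Sum>s\<in>UNIV. axis s (v $ s)) = (v :: 'a::real_normed_vector ^ 'n)"
  by (simp add: vec_eq_iff axis_def)

lemma bounded_linear_axis: "bounded_linear (axis s :: 'a::real_normed_vector \<Rightarrow> 'a ^ 'n)"
proof (rule bounded_linear_intro[where K = 1])
  have "norm (axis s v :: 'a ^ 'n) \<le> (\<Sum>i\<in>UNIV. norm (axis s v $ i))" for v :: 'a
    unfolding norm_vec_def by (rule L2_set_le_sum) simp
  then show "norm (axis s v :: 'a ^ 'n) \<le> norm v * 1" for v :: 'a
    by (simp add: axis_def if_distrib cong: if_cong)
qed (auto simp: vec_eq_iff axis_def)

lemma has_vector_derivative_vec_iff: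
  fixes x :: "real \<Rightarrow> 'a::real_normed_vector ^ 'n"
  shows "(x has_vector_derivative d) F \<longleftrightarrow> (\<forall>s. ((\<lambda>t. x t $ s) has_vector_derivative d $ s) F)"
proof
  assume "(x has_vector_derivative d) F"
  then show "\<forall>s. ((\<lambda>t. x t $ s) has_vector_derivative d $ s) F"
    using bounded_linear.has_vector_derivative[OF bounded_linear_vec_nth] by blast
next
  assume "\<forall>s. ((\<lambda>t. x t $ s) has_vector_derivative d $ s) F"
  then have "((\<lambda>t. \<Sum>s\<in>UNIV. axis s (x t $ s)) has_vector_derivative (\<Sum>s\<in>UNIV. axis s (d $ s))) F"
    by (intro has_vector_derivative_sum bounded_linear.has_vector_derivative[OF bounded_linear_axis]) auto
  then show "(x has_vector_derivative d) F" unfolding sum_axis .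
qed

locale segment =
  fixes a b :: real
  assumes a_less_b: "a < b"
begin

lemma vector_derivative_segment:
  assumes "t \<in> {a..b}" "(x has_vector_derivative y) (at t within {a..b})"
  shows "vector_derivative x (at t within {a..b}) = y"
  using vector_derivative_within_cbox[of a b t x y] assms a_less_b by simp

lemma deriv_on_add: "deriv_on a b (k + j) x = deriv_on a b k (deriv_on a b j x)"
  by (induction k) auto

lemma deriv_on_Suc': "deriv_on a b (Suc k) x = deriv_on a b k (deriv_on a b 1 x)"
  using deriv_on_add[of k 1 x] by simp

lemma deriv_on_cong:
  assumes "\<And>t. t \<in> {a..b} \<Longrightarrow> x t = y t" "t \<in> {a..b}"
  shows "deriv_on a b k x t = deriv_on a b k y t"
  using assms(2)
proof (induction k arbitrary: t)
  case 0
  then show ?case using assms(1) by simp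
next
  case (Suc k)
  have "(deriv_on a b k x has_vector_derivative d) (at t within {a..b}) \<longleftrightarrow>
        (deriv_on a b k y has_vector_derivative d) (at t within {a..b})" for d
    using Suc.IH Suc.prems by (metis has_vector_derivative_transform)
  then show ?case by (simp add: vector_derivative_def)
qed

lemma deriv_on_1:
  assumes "t \<in> {a..b}" "(x has_vector_derivative y) (at t within {a..b})"
  shows "deriv_on a b 1 x t = y"
  using vector_derivative_segment assms by simp

definition Ck :: "nat \<Rightarrow> (real \<Rightarrow> 'a::real_normed_vector) \<Rightarrow> bool" where
  "Ck l x \<longleftrightarrow>
     (\<forall>k<l. \<forall>t\<in>{a..b}. deriv_on a b k x differentiable (at t within {a..b})) \<and>
     (\<forall>k\<le>l. continuous_on {a..b} (deriv_on a b k x))"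

text \<open>
  Convergence in the space of \<open>l\<close> times continuously differentiable functions, along an
  arbitrary filter. Uniform limits of the derivatives, unlike norms, satisfy the simple recursion
  \<open>Ck_lim_Suc\<close>, so that stability under products, quotients and integration follows by induction
  on \<open>l\<close>; the norms of the problem enter only through \<open>Cvec_norm_tendsto_0_iff\<close> and its
  relatives.
\<close>

definition Ck_lim ::
    "'i filter \<Rightarrow> nat \<Rightarrow> ('i \<Rightarrow> real \<Rightarrow> 'a::real_normed_vector) \<Rightarrow> (real \<Rightarrow> 'a) \<Rightarrow> bool" where
  "Ck_lim F l X x \<longleftrightarrow> (\<forall>\<^sub>F i in F. Ck l (X i)) \<and> Ck l x \<and>
     (\<forall>j\<le>l. uniform_limit {a..b} (\<lambda>i. deriv_on a b j (X i)) (deriv_on a b j x) F)"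

lemma C_space_iff: "x \<in> C_space a b l \<longleftrightarrow> (\<forall>t. t \<notin> {a..b} \<longrightarrow> x t = 0) \<and> Ck l x"
  by (auto simp: C_space_def Ck_def)

lemma Ck_0: "Ck 0 x \<longleftrightarrow> continuous_on {a..b} x"
  by (simp add: Ck_def)

lemma Ck_mono: "Ck l x \<Longrightarrow> k \<le> l \<Longrightarrow> Ck k x"
  by (auto simp: Ck_def)

lemma Ck_imp_continuous: "Ck l x \<Longrightarrow> continuous_on {a..b} x"
  using Ck_mono[of l x 0] by (simp add: Ck_0)

lemma Ck_imp_bounded: "Ck l x \<Longrightarrow> bounded (x ` {a..b})"
  using Ck_imp_continuous by (blast intro: compact_continuous_image compact_imp_bounded compact_Icc)

lemma Ck_Suc:
  "Ck (Suc l) x \<longleftrightarrow>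
     (\<forall>t\<in>{a..b}. (x has_vector_derivative deriv_on a b 1 x t) (at t within {a..b})) \<and>
     Ck l (deriv_on a b 1 x)"
proof -
  have 1: "(\<forall>t\<in>{a..b}. (x has_vector_derivative deriv_on a b 1 x t) (at t within {a..b})) \<longleftrightarrow>
        (\<forall>t\<in>{a..b}. x differentiable (at t within {a..b}))"
    by (auto simp: vector_derivative_works)
  have 2: "(\<forall>t\<in>{a..b}. x differentiable (at t within {a..b})) \<Longrightarrow> continuous_on {a..b} x"
    by (simp add: differentiable_imp_continuous_on differentiable_on_def)
  have split: "(\<forall>k<Suc l. P k) \<longleftrightarrow> P 0 \<and> (\<forall>k<l. P (Suc k))"
    "(\<forall>k\<le>Suc l. P k) \<longleftrightarrow> P 0 \<and> (\<forall>k\<le>l. P (Suc k))" for P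
    using All_less_Suc2[of l P] All_less_Suc2[of "Suc l" P] by (simp_all add: less_Suc_eq_le)
  show ?thesis
    unfolding Ck_def split 1 deriv_on_Suc'
    using 2 by auto
qed

lemma Ck_cong:
  assumes "\<And>t. t \<in> {a..b} \<Longrightarrow> x t = y t"
  shows "Ck l x \<longleftrightarrow> Ck l y"
  using assms
proof (induction l arbitrary: x y)
  case 0
  then show ?case unfolding Ck_0 by (intro continuous_on_cong) auto
next
  case (Suc l)
  have D: "deriv_on a b 1 x t = deriv_on a b 1 y t" if "t \<in> {a..b}" for t
    by (rule deriv_on_cong[OF Suc.prems that])
  have "(x has_vector_derivative d) (at t within {a..b}) \<longleftrightarrow>
        (y has_vector_derivative d) (at t within {a..b})" if "t \<in> {a..b}" for t d
    using Suc.prems that by (metis has_vector_derivative_transform)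
  then show ?case
    using Suc.IH[OF D] D by (simp add: Ck_Suc del: deriv_on.simps)
qed

lemma Ck_SucI:
  assumes "\<And>t. t \<in> {a..b} \<Longrightarrow> (x has_vector_derivative y t) (at t within {a..b})" "Ck l y"
  shows "Ck (Suc l) x"
proof -
  have D: "deriv_on a b 1 x t = y t" if "t \<in> {a..b}" for t
    using deriv_on_1[OF that assms(1)[OF that]] .
  show ?thesis
    using Ck_cong[OF D] assms D unfolding Ck_Suc by auto
qed

lemma Ck_SucE:
  assumes "Ck (Suc l) x"
  shows "t \<in> {a..b} \<Longrightarrow> (x has_vector_derivative deriv_on a b 1 x t) (at t within {a..b})"
    and "Ck l (deriv_on a b 1 x)"
  using assms by (auto simp: Ck_Suc)

lemma Ck_lim_cong:
  assumes "\<forall>\<^sub>F i in F. \<forall>t\<in>{a..b}. X i t = Y i t" "\<And>t. t \<in> {a..b} \<Longrightarrow> x t = y t"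
  shows "Ck_lim F l X x \<longleftrightarrow> Ck_lim F l Y y"
proof -
  have imp: "Ck_lim F l Y y"
    if X: "Ck_lim F l X x" and e: "\<forall>\<^sub>F i in F. \<forall>t\<in>{a..b}. X i t = Y i t"
      "\<And>t. t \<in> {a..b} \<Longrightarrow> x t = y t" for X Y :: "'a \<Rightarrow> real \<Rightarrow> 'b" and x y
  proof -
    have "\<forall>\<^sub>F i in F. Ck l (X i)" "Ck l x" using X by (auto simp: Ck_lim_def)
    have "\<forall>\<^sub>F i in F. Ck l (Y i)"
      using \<open>\<forall>\<^sub>F i in F. Ck l (X i)\<close> e(1) by eventually_elim (meson Ck_cong)
    moreover have "Ck l y"
      using \<open>Ck l x\<close> Ck_cong[of x y l] e(2) by blast
    moreover have "uniform_limit {a..b} (\<lambda>i. deriv_on a b j (Y i)) (deriv_on a b j y) F"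
      if "j \<le> l" for j
    proof -
      have 1: "\<forall>\<^sub>F i in F. \<forall>t\<in>{a..b}. deriv_on a b j (X i) t = deriv_on a b j (Y i) t"
        using e(1) by eventually_elim (intro ballI deriv_on_cong; blast)
      have 2: "deriv_on a b j x t = deriv_on a b j y t" if "t \<in> {a..b}" for t
        using that by (intro deriv_on_cong e(2))
      have "uniform_limit {a..b} (\<lambda>i. deriv_on a b j (X i)) (deriv_on a b j x) F"
        using X that by (simp add: Ck_lim_def)
      then show ?thesis
        using uniform_limit_cong[OF 1 2] by simp
    qed
    ultimately show ?thesis by (simp add: Ck_lim_def)
  qed
  have "\<forall>\<^sub>F i in F. \<forall>t\<in>{a..b}. Y i t = X i t"
    using assms(1) by eventually_elim simp
  then show ?thesis
    using imp[of X x Y y, OF _ assms] imp[of Y y X x, OF _ _ assms(2)[symmetric]] by blast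
qed

lemma Ck_lim_0:
  "Ck_lim F 0 X x \<longleftrightarrow> (\<forall>\<^sub>F i in F. continuous_on {a..b} (X i)) \<and> continuous_on {a..b} x \<and>
     uniform_limit {a..b} X x F"
  by (simp add: Ck_lim_def Ck_0)

lemma Ck_lim_Suc:
  "Ck_lim F (Suc l) X x \<longleftrightarrow>
     uniform_limit {a..b} X x F \<and>
     (\<forall>\<^sub>F i in F. \<forall>t\<in>{a..b}.
        (X i has_vector_derivative deriv_on a b 1 (X i) t) (at t within {a..b})) \<and>
     (\<forall>t\<in>{a..b}. (x has_vector_derivative deriv_on a b 1 x t) (at t within {a..b})) \<and>
     Ck_lim F l (\<lambda>i. deriv_on a b 1 (X i)) (deriv_on a b 1 x)"
proof -
  have split: "(\<forall>k\<le>Suc l. P k) \<longleftrightarrow> P 0 \<and> (\<forall>k\<le>l. P (Suc k))" for P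
    using All_less_Suc2[of "Suc l" P] by (simp add: less_Suc_eq_le)
  show ?thesis
    unfolding Ck_lim_def split deriv_on_Suc' Ck_Suc eventually_conj_iff deriv_on.simps(1)
    by blast
qed

lemma Ck_lim_SucI:
  assumes "uniform_limit {a..b} X x F"
    and "\<forall>\<^sub>F i in F. \<forall>t\<in>{a..b}. (X i has_vector_derivative Y i t) (at t within {a..b})"
    and "\<And>t. t \<in> {a..b} \<Longrightarrow> (x has_vector_derivative y t) (at t within {a..b})"
    and "Ck_lim F l Y y"
  shows "Ck_lim F (Suc l) X x"
proof -
  have D: "deriv_on a b 1 x t = y t" if "t \<in> {a..b}" for t
    using deriv_on_1[OF that assms(3)[OF that]] .
  have E: "\<forall>\<^sub>F i in F. \<forall>t\<in>{a..b}. deriv_on a b 1 (X i) t = Y i t"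
    using assms(2) by eventually_elim (meson deriv_on_1)
  have "\<forall>\<^sub>F i in F. \<forall>t\<in>{a..b}.
      (X i has_vector_derivative deriv_on a b 1 (X i) t) (at t within {a..b})"
    using assms(2) E by eventually_elim auto
  moreover have "Ck_lim F l (\<lambda>i. deriv_on a b 1 (X i)) (deriv_on a b 1 x)"
    using Ck_lim_cong[of _ Y F "deriv_on a b 1 x" y l, OF E D] assms(4) by blast
  ultimately show ?thesis
    unfolding Ck_lim_Suc using assms(1,3) D by auto
qed

lemma Ck_lim_mono: "Ck_lim F l X x \<Longrightarrow> k \<le> l \<Longrightarrow> Ck_lim F k X x"
  unfolding Ck_lim_def by (auto elim!: eventually_mono dest: Ck_mono)

lemma Ck_lim_uniform_limit: "Ck_lim F l X x \<Longrightarrow> uniform_limit {a..b} X x F"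
  using Ck_lim_mono[of F l X x 0] by (simp add: Ck_lim_0)

lemma Ck_lim_deriv_on:
  assumes "Ck_lim F (l + j) X x"
  shows "Ck_lim F l (\<lambda>i. deriv_on a b j (X i)) (deriv_on a b j x)"
  using assms
proof (induction j arbitrary: X x)
  case (Suc j)
  then have "Ck_lim F (l + j) (\<lambda>i. deriv_on a b 1 (X i)) (deriv_on a b 1 x)"
    by (simp add: Ck_lim_Suc)
  from Suc.IH[OF this] show ?case by (simp only: deriv_on_Suc')
qed simp

text \<open>
  Every closure property of convergence, applied to a constant family, is a closure property of the
  differentiability class.
\<close>

lemma Ck_iff_Ck_lim: "Ck l x \<longleftrightarrow> Ck_lim (at_right (0::real)) l (\<lambda>_. x) x"
  by (auto simp: Ck_lim_def uniform_limit_const eventually_const_iff)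

lemma Ck_lim_const: "Ck l x \<Longrightarrow> Ck_lim F l (\<lambda>_. x) x"
  by (simp add: Ck_lim_def uniform_limit_const)

lemma Ck_deriv_on: "Ck (l + j) x \<Longrightarrow> Ck l (deriv_on a b j x)"
  unfolding Ck_iff_Ck_lim by (rule Ck_lim_deriv_on)

lemma has_vector_derivative_deriv_on:
  assumes "Ck l x" "j < l" "t \<in> {a..b}"
  shows "(deriv_on a b j x has_vector_derivative deriv_on a b (Suc j) x t) (at t within {a..b})"
  using assms by (auto simp: Ck_def vector_derivative_works)

lemma Ck_lim_value:
  fixes c :: "'i \<Rightarrow> 'a::real_normed_vector"
  assumes "(c \<longlongrightarrow> c0) F"
  shows "Ck_lim F l (\<lambda>i t. c i) (\<lambda>t. c0)"
proof -
  have u: "uniform_limit {a..b} (\<lambda>i t. c i) (\<lambda>t. c0) F" if "(c \<longlongrightarrow> c0) F" for c and c0 :: 'a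
    using that by (auto simp: uniform_limit_iff tendsto_iff elim!: eventually_mono)
  show ?thesis using assms
  proof (induction l arbitrary: c c0)
    case 0
    then show ?case using u by (simp add: Ck_lim_0)
  next
    case (Suc l)
    show ?case
    proof (rule Ck_lim_SucI)
      show "Ck_lim F l (\<lambda>_ _. 0 :: 'a) (\<lambda>_. 0)" by (rule Suc.IH) simp
    qed (use u[OF Suc.prems] in auto)
  qed
qed

lemma Ck_lim_valueD: "Ck_lim F l X x \<Longrightarrow> t \<in> {a..b} \<Longrightarrow> ((\<lambda>i. X i t) \<longlongrightarrow> x t) F"
  using Ck_lim_uniform_limit tendsto_uniform_limitI by metis

lemma Ck_lim_add:
  assumes "Ck_lim F l X x" "Ck_lim F l Y y"
  shows "Ck_lim F l (\<lambda>i t. X i t + Y i t) (\<lambda>t. x t + y t)"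
  using assms
proof (induction l arbitrary: X x Y y)
  case 0
  then have c: "\<forall>\<^sub>F i in F. continuous_on {a..b} (X i)" "\<forall>\<^sub>F i in F. continuous_on {a..b} (Y i)"
    by (auto simp: Ck_lim_0)
  have "\<forall>\<^sub>F i in F. continuous_on {a..b} (\<lambda>t. X i t + Y i t)"
    using c by eventually_elim (intro continuous_intros)
  then show ?case
    using 0 by (auto simp: Ck_lim_0 intro!: continuous_intros uniform_limit_intros)
next
  case (Suc l)
  note S = Suc.prems[unfolded Ck_lim_Suc]
  show ?case
  proof (rule Ck_lim_SucI)
    show "\<forall>\<^sub>F i in F. \<forall>t\<in>{a..b}. ((\<lambda>t. X i t + Y i t) has_vector_derivative
       deriv_on a b 1 (X i) t + deriv_on a b 1 (Y i) t) (at t within {a..b})"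
      using S(1)[THEN conjunct2, THEN conjunct1] S(2)[THEN conjunct2, THEN conjunct1]
      by eventually_elim (auto intro!: has_vector_derivative_add simp del: deriv_on.simps)
  qed (use S Suc.IH in \<open>auto intro!: uniform_limit_intros has_vector_derivative_add
        simp del: deriv_on.simps\<close>)
qed

lemma Ck_lim_linear:
  assumes "bounded_linear h" "Ck_lim F l X x"
  shows "Ck_lim F l (\<lambda>i t. h (X i t)) (\<lambda>t. h (x t))"
  using assms(2)
proof (induction l arbitrary: X x)
  case 0
  then show ?case
    by (auto simp: Ck_lim_0 elim!: eventually_mono
        intro!: bounded_linear.continuous_on[OF assms(1)] bounded_linear.uniform_limit[OF assms(1)])
next
  case (Suc l)
  note S = Suc.prems[unfolded Ck_lim_Suc]
  show ?case
  proof (rule Ck_lim_SucI)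
    show "\<forall>\<^sub>F i in F. \<forall>t\<in>{a..b}. ((\<lambda>t. h (X i t)) has_vector_derivative
       h (deriv_on a b 1 (X i) t)) (at t within {a..b})"
      using S[THEN conjunct2, THEN conjunct1]
      by eventually_elim
        (auto intro!: bounded_linear.has_vector_derivative[OF assms(1)] simp del: deriv_on.simps)
  qed (use S Suc.IH in \<open>auto intro!: bounded_linear.uniform_limit[OF assms(1)]
        bounded_linear.has_vector_derivative[OF assms(1)] simp del: deriv_on.simps\<close>)
qed

lemma Ck_lim_bilinear:
  assumes "bounded_bilinear h" "Ck_lim F l X x" "Ck_lim F l Y y"
  shows "Ck_lim F l (\<lambda>i t. h (X i t) (Y i t)) (\<lambda>t. h (x t) (y t))"
proof -
  interpret bounded_bilinear h by fact
  have u: "uniform_limit {a..b} (\<lambda>i t. h (X i t) (Y i t)) (\<lambda>t. h (x t) (y t)) F"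
    if "Ck_lim F l X x" "Ck_lim F l Y y" for l X x Y y
    using bounded_uniform_limit[OF Ck_lim_uniform_limit[OF that(1)] Ck_lim_uniform_limit[OF that(2)]]
      Ck_imp_bounded[of l x] Ck_imp_bounded[of l y] that by (simp add: Ck_lim_def)
  show ?thesis using assms(2,3)
  proof (induction l arbitrary: X x Y y)
    case 0
    then have c: "\<forall>\<^sub>F i in F. continuous_on {a..b} (X i)" "\<forall>\<^sub>F i in F. continuous_on {a..b} (Y i)"
      by (auto simp: Ck_lim_0)
    have "\<forall>\<^sub>F i in F. continuous_on {a..b} (\<lambda>t. h (X i t) (Y i t))"
      using c by eventually_elim (rule continuous_on)
    then show ?case
      using 0 u[OF 0] by (auto simp: Ck_lim_0 intro!: continuous_on)
  next
    case (Suc l)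
    note S = Suc.prems[unfolded Ck_lim_Suc]
    have *: "Ck_lim F l X x" "Ck_lim F l Y y"
      using Suc.prems Ck_lim_mono by (meson le_SucI order_refl)+
    show ?case
    proof (rule Ck_lim_SucI)
      show "\<forall>\<^sub>F i in F. \<forall>t\<in>{a..b}. ((\<lambda>t. h (X i t) (Y i t)) has_vector_derivative
         h (X i t) (deriv_on a b 1 (Y i) t) + h (deriv_on a b 1 (X i) t) (Y i t))
         (at t within {a..b})"
        using S(1)[THEN conjunct2, THEN conjunct1] S(2)[THEN conjunct2, THEN conjunct1]
        by eventually_elim (auto intro!: has_vector_derivative simp del: deriv_on.simps)
      show "Ck_lim F l (\<lambda>i t. h (X i t) (deriv_on a b 1 (Y i) t) + h (deriv_on a b 1 (X i) t) (Y i t))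
         (\<lambda>t. h (x t) (deriv_on a b 1 y t) + h (deriv_on a b 1 x t) (y t))"
        using S * by (intro Ck_lim_add Suc.IH) auto
    qed (use S u[OF Suc.prems] in \<open>auto intro!: has_vector_derivative simp del: deriv_on.simps\<close>)
  qed
qed

lemma Ck_lim_zero: "Ck_lim F l (\<lambda>i t. 0) (\<lambda>t. 0)"
  by (rule Ck_lim_value) simp

lemma Ck_lim_sum:
  assumes "\<And>s. s \<in> S \<Longrightarrow> Ck_lim F l (X s) (x s)"
  shows "Ck_lim F l (\<lambda>i t. \<Sum>s\<in>S. X s i t) (\<lambda>t. \<Sum>s\<in>S. x s t)"
  using assms by (induction S rule: infinite_finite_induct) (auto intro!: Ck_lim_add Ck_lim_zero)

lemma Ck_lim_mult:
  fixes X Y :: "'i \<Rightarrow> real \<Rightarrow> complex"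
  shows "Ck_lim F l X x \<Longrightarrow> Ck_lim F l Y y \<Longrightarrow> Ck_lim F l (\<lambda>i t. X i t * Y i t) (\<lambda>t. x t * y t)"
  by (rule Ck_lim_bilinear[OF bounded_bilinear_mult])

lemma Ck_lim_prod:
  fixes X :: "'s \<Rightarrow> 'i \<Rightarrow> real \<Rightarrow> complex"
  assumes "\<And>s. s \<in> S \<Longrightarrow> Ck_lim F l (X s) (x s)"
  shows "Ck_lim F l (\<lambda>i t. \<Prod>s\<in>S. X s i t) (\<lambda>t. \<Prod>s\<in>S. x s t)"
  using assms
  by (induction S rule: infinite_finite_induct) (auto intro!: Ck_lim_mult Ck_lim_value)

lemma Ck_lim_minus: "Ck_lim F l X x \<Longrightarrow> Ck_lim F l (\<lambda>i t. - X i t) (\<lambda>t. - x t)"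
  by (rule Ck_lim_linear[OF bounded_linear_minus[OF bounded_linear_ident]])

lemma Ck_lim_diff:
  "Ck_lim F l X x \<Longrightarrow> Ck_lim F l Y y \<Longrightarrow> Ck_lim F l (\<lambda>i t. X i t - Y i t) (\<lambda>t. x t - y t)"
  using Ck_lim_add[of F l X x "\<lambda>i t. - Y i t" "\<lambda>t. - y t"] Ck_lim_minus[of F l Y y] by simp

lemma Ck_lim_vec_iff:
  fixes X :: "'i \<Rightarrow> real \<Rightarrow> 'a::real_normed_vector ^ 'n"
  shows "Ck_lim F l X x \<longleftrightarrow> (\<forall>s. Ck_lim F l (\<lambda>i t. X i t $ s) (\<lambda>t. x t $ s))"
proof
  assume "Ck_lim F l X x"
  then show "\<forall>s. Ck_lim F l (\<lambda>i t. X i t $ s) (\<lambda>t. x t $ s)"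
    using Ck_lim_linear[OF bounded_linear_vec_nth] by blast
next
  assume "\<forall>s. Ck_lim F l (\<lambda>i t. X i t $ s) (\<lambda>t. x t $ s)"
  then have "Ck_lim F l (\<lambda>i t. \<Sum>s\<in>UNIV. axis s (X i t $ s)) (\<lambda>t. \<Sum>s\<in>UNIV. axis s (x t $ s))"
    by (intro Ck_lim_sum Ck_lim_linear[OF bounded_linear_axis]) auto
  then show "Ck_lim F l X x" unfolding sum_axis .
qed

lemma Ck_vec_iff:
  fixes x :: "real \<Rightarrow> 'a::real_normed_vector ^ 'n"
  shows "Ck l x \<longleftrightarrow> (\<forall>s. Ck l (\<lambda>t. x t $ s))"
  unfolding Ck_iff_Ck_lim by (rule Ck_lim_vec_iff)

lemma deriv_on_linear:
  assumes "bounded_linear h" "Ck l x" "j \<le> l" "t \<in> {a..b}"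
  shows "deriv_on a b j (\<lambda>t. h (x t)) t = h (deriv_on a b j x t)"
  using assms(3,4)
proof (induction j arbitrary: t)
  case (Suc j)
  have "((\<lambda>t. h (deriv_on a b j x t)) has_vector_derivative h (deriv_on a b (Suc j) x t))
      (at t within {a..b})"
    using has_vector_derivative_deriv_on[OF assms(2)] Suc.prems
    by (intro bounded_linear.has_vector_derivative[OF assms(1)]) auto
  then have "(deriv_on a b j (\<lambda>t. h (x t)) has_vector_derivative h (deriv_on a b (Suc j) x t))
      (at t within {a..b})"
    by (rule has_vector_derivative_transform[rotated 2]) (use Suc in auto)
  then show ?case
    using vector_derivative_segment[OF Suc.prems(2)] by simp
qed simp

lemma deriv_on_plus:
  assumes "Ck l x" "Ck l y" "j \<le> l" "t \<in> {a..b}"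
  shows "deriv_on a b j (\<lambda>t. x t + y t) t = deriv_on a b j x t + deriv_on a b j y t"
  using assms(3,4)
proof (induction j arbitrary: t)
  case (Suc j)
  have "((\<lambda>t. deriv_on a b j x t + deriv_on a b j y t) has_vector_derivative
      deriv_on a b (Suc j) x t + deriv_on a b (Suc j) y t) (at t within {a..b})"
    using has_vector_derivative_deriv_on[OF assms(1)] has_vector_derivative_deriv_on[OF assms(2)]
      Suc.prems by (intro has_vector_derivative_add) auto
  then have "(deriv_on a b j (\<lambda>t. x t + y t) has_vector_derivative
      deriv_on a b (Suc j) x t + deriv_on a b (Suc j) y t) (at t within {a..b})"
    by (rule has_vector_derivative_transform[rotated 2]) (use Suc in auto)
  then show ?case
    using vector_derivative_segment[OF Suc.prems(2)] by simp
qed simp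

lemma deriv_on_minus:
  assumes "Ck l x" "Ck l y" "j \<le> l" "t \<in> {a..b}"
  shows "deriv_on a b j (\<lambda>t. x t - y t) t = deriv_on a b j x t - deriv_on a b j y t"
proof -
  have bl: "bounded_linear (uminus :: 'a \<Rightarrow> 'a)"
    by (rule bounded_linear_minus[OF bounded_linear_ident])
  have m: "Ck l (\<lambda>t. - y t)"
    using assms(2) unfolding Ck_iff_Ck_lim by (rule Ck_lim_minus)
  show ?thesis
    using deriv_on_plus[OF assms(1) m assms(3,4)] deriv_on_linear[OF bl assms(2-4)] by simp
qed

end

lemma tendsto_sum_zero_iff:
  fixes f :: "'s \<Rightarrow> 'i \<Rightarrow> real"
  assumes "finite S" "\<And>s. s \<in> S \<Longrightarrow> \<forall>\<^sub>F i in F. 0 \<le> f s i"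
  shows "((\<lambda>i. \<Sum>s\<in>S. f s i) \<longlongrightarrow> 0) F \<longleftrightarrow> (\<forall>s\<in>S. (f s \<longlongrightarrow> 0) F)"
proof
  assume lim: "((\<lambda>i. \<Sum>s\<in>S. f s i) \<longlongrightarrow> 0) F"
  have all: "\<forall>\<^sub>F i in F. \<forall>s\<in>S. 0 \<le> f s i"
    using assms by (simp add: eventually_ball_finite)
  show "\<forall>s\<in>S. (f s \<longlongrightarrow> 0) F"
  proof
    fix s assume s: "s \<in> S"
    have "\<forall>\<^sub>F i in F. 0 \<le> f s i" "\<forall>\<^sub>F i in F. f s i \<le> (\<Sum>s\<in>S. f s i)"
      using all s assms(1) by (auto elim!: eventually_mono intro!: member_le_sum)
    then show "(f s \<longlongrightarrow> 0) F"
      by (rule tendsto_sandwich[OF _ _ tendsto_const lim])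
  qed
next
  assume "\<forall>s\<in>S. (f s \<longlongrightarrow> 0) F"
  then show "((\<lambda>i. \<Sum>s\<in>S. f s i) \<longlongrightarrow> 0) F"
    using tendsto_sum[of S f "\<lambda>_. 0" F] by simp
qed

context segment
begin

text \<open>
  The limit has no zero on a compact segment, so it stays away from 0, and so do the functions
  of the family eventually. The formula for the derivative of the reciprocal drives the induction.
\<close>

lemma Ck_lim_inverse:
  fixes G :: "'i \<Rightarrow> real \<Rightarrow> complex"
  assumes "Ck_lim F l G g" "\<And>t. t \<in> {a..b} \<Longrightarrow> g t \<noteq> 0"
  shows "Ck_lim F l (\<lambda>i t. inverse (G i t)) (\<lambda>t. inverse (g t))"
  using assms(1)
proof (induction l)
  have cont: "continuous_on {a..b} g" and uni: "uniform_limit {a..b} G g F"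
    using assms(1) Ck_lim_uniform_limit Ck_imp_continuous by (auto simp: Ck_lim_def)
  obtain s where s: "s \<in> {a..b}" "\<And>t. t \<in> {a..b} \<Longrightarrow> cmod (g s) \<le> cmod (g t)"
    using continuous_attains_inf[OF compact_Icc, of a b "\<lambda>t. cmod (g t)"]
      continuous_on_norm[OF cont] a_less_b by auto
  define \<delta> where "\<delta> = cmod (g s)"
  have \<delta>: "\<delta> > 0" "\<And>t. t \<in> {a..b} \<Longrightarrow> \<delta> \<le> cmod (g t)"
    using s assms(2) by (auto simp: \<delta>_def)
  have nz: "\<forall>\<^sub>F i in F. \<forall>t\<in>{a..b}. G i t \<noteq> 0"
    using uniform_limitD[OF uni \<delta>(1)]
  proof eventually_elim
    case (elim i)
    show ?case
    proof
      fix t assume t: "t \<in> {a..b}"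
      show "G i t \<noteq> 0"
        using bspec[OF elim t] \<delta>(2)[OF t] by (auto simp: dist_norm)
    qed
  qed
  have lim: "uniform_limit {a..b} (\<lambda>i t. inverse (G i t)) (\<lambda>t. inverse (g t)) F"
    using uniform_lim_inverse[OF uni \<delta>(2) \<delta>(1)] by (simp add: o_def)
  {
    case 0
    then have "\<forall>\<^sub>F i in F. continuous_on {a..b} (G i)" by (simp add: Ck_lim_0)
    then have "\<forall>\<^sub>F i in F. continuous_on {a..b} (\<lambda>t. inverse (G i t))"
      using nz by eventually_elim (auto intro!: continuous_on_inverse)
    then show ?case
      using cont assms(2) lim by (auto simp: Ck_lim_0 intro!: continuous_on_inverse)
  next
    case (Suc l)
    note S = Suc.prems[unfolded Ck_lim_Suc]
    have IH: "Ck_lim F l (\<lambda>i t. inverse (G i t)) (\<lambda>t. inverse (g t))"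
      using Suc.prems by (intro Suc.IH) (erule Ck_lim_mono, simp)
    have d: "((\<lambda>t. inverse (h t)) has_vector_derivative - (inverse (h t) * d * inverse (h t)))
        (at t within {a..b})"
      if "(h has_vector_derivative d) (at t within {a..b})" "h t \<noteq> 0" for h :: "real \<Rightarrow> complex" and d t
      using Deriv.has_derivative_inverse[OF that(2) that(1)[unfolded has_vector_derivative_def]]
      by (simp add: has_vector_derivative_def)
    show ?case
    proof (rule Ck_lim_SucI[OF lim])
      show "\<forall>\<^sub>F i in F. \<forall>t\<in>{a..b}. ((\<lambda>t. inverse (G i t)) has_vector_derivative
          - (inverse (G i t) * deriv_on a b 1 (G i) t * inverse (G i t))) (at t within {a..b})"
        using S[THEN conjunct2, THEN conjunct1] nz
        by eventually_elim (auto intro!: d simp del: deriv_on.simps)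
      show "((\<lambda>t. inverse (g t)) has_vector_derivative
          - (inverse (g t) * deriv_on a b 1 g t * inverse (g t))) (at t within {a..b})"
        if "t \<in> {a..b}" for t
        using S that assms(2) by (intro d) auto
      show "Ck_lim F l (\<lambda>i t. - (inverse (G i t) * deriv_on a b 1 (G i) t * inverse (G i t)))
          (\<lambda>t. - (inverse (g t) * deriv_on a b 1 g t * inverse (g t)))"
        using S IH by (intro Ck_lim_minus Ck_lim_mult) auto
    qed
  }
qed

lemma Ck_lim_det:
  fixes A :: "'i \<Rightarrow> real \<Rightarrow> complex ^ 'n ^ 'n"
  assumes "\<And>s u. Ck_lim F l (\<lambda>i t. A i t $ s $ u) (\<lambda>t. A0 t $ s $ u)"
  shows "Ck_lim F l (\<lambda>i t. det (A i t)) (\<lambda>t. det (A0 t))"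
  unfolding det_def
  by (intro Ck_lim_sum Ck_lim_mult Ck_lim_prod Ck_lim_value tendsto_const assms)

text \<open>
  Solutions of convergent invertible linear systems converge with all derivatives: by Cramer's rule
  their entries are quotients of determinants. Applied to functions constant in \<open>t\<close>, this
  also covers systems of numbers.
\<close>

lemma Ck_lim_cramer:
  fixes A :: "'i \<Rightarrow> real \<Rightarrow> complex ^ 'n ^ 'n"
  assumes A: "\<And>s u. Ck_lim F l (\<lambda>i t. A i t $ s $ u) (\<lambda>t. A0 t $ s $ u)"
    and y: "\<And>s. Ck_lim F l (\<lambda>i t. Y i t $ s) (\<lambda>t. y t $ s)"
    and eq: "\<forall>\<^sub>F i in F. \<forall>t\<in>{a..b}. det (A i t) \<noteq> 0 \<and> A i t *v X i t = Y i t"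
      "\<And>t. t \<in> {a..b} \<Longrightarrow> det (A0 t) \<noteq> 0 \<and> A0 t *v x t = y t"
  shows "Ck_lim F l (\<lambda>i t. X i t $ s) (\<lambda>t. x t $ s)"
proof -
  define C where "C M v = (\<chi> p q. if q = s then v $ p else M $ p $ q)"
    for M :: "complex ^ 'n ^ 'n" and v :: "complex ^ 'n"
  have C: "w $ s = det (C M v) * inverse (det M)" if "det M \<noteq> 0 \<and> M *v w = v" for M v and w :: "complex ^ 'n"
    using cramer[of M w v] that by (simp add: C_def divide_inverse)
  have "Ck_lim F l (\<lambda>i t. C (A i t) (Y i t) $ p $ q) (\<lambda>t. C (A0 t) (y t) $ p $ q)" for p q
    by (cases "q = s") (simp_all add: C_def A y)
  then have "Ck_lim F l (\<lambda>i t. det (C (A i t) (Y i t)) * inverse (det (A i t)))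
      (\<lambda>t. det (C (A0 t) (y t)) * inverse (det (A0 t)))"
    using eq(2) by (intro Ck_lim_mult Ck_lim_inverse Ck_lim_det A) auto
  moreover have "\<forall>\<^sub>F i in F. \<forall>t\<in>{a..b}. X i t $ s = det (C (A i t) (Y i t)) * inverse (det (A i t))"
    using eq(1) by eventually_elim (use C in blast)
  ultimately show ?thesis
    using Ck_lim_cong[where X = "\<lambda>i t. X i t $ s" and x = "\<lambda>t. x t $ s"] C[OF eq(2)] by simp
qed

lemma C_norm_nonneg: "0 \<le> C_norm a b l x" if "Ck l x"
proof -
  have "0 \<le> (SUP t\<in>{a..b}. cmod (deriv_on a b j x t))" if "j \<le> l" for j
  proof -
    have "bounded (deriv_on a b j x ` {a..b})"
      using \<open>Ck l x\<close> that Ck_deriv_on[of "l - j" j x] Ck_imp_bounded by simp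
    then have "bdd_above ((\<lambda>t. cmod (deriv_on a b j x t)) ` {a..b})"
      by (auto simp: bounded_iff bdd_above_def)
    then show ?thesis
      using a_less_b by (intro cSUP_upper2[where x = a]) auto
  qed
  then show ?thesis unfolding C_norm_def by (intro sum_nonneg) auto
qed

lemma C_norm_tendsto_0_iff:
  assumes X: "\<forall>\<^sub>F i in F. Ck l (X i)" and x: "Ck l x"
  shows "((\<lambda>i. C_norm a b l (\<lambda>t. X i t - x t)) \<longlongrightarrow> 0) F \<longleftrightarrow> Ck_lim F l X x"
proof -
  define N where "N j y = (SUP t\<in>{a..b}. cmod (deriv_on a b j y t))" for j and y :: "real \<Rightarrow> complex"
  have diff: "Ck l (\<lambda>t. y t - x t)" if "Ck l y" for y
    using that x unfolding Ck_iff_Ck_lim by (rule Ck_lim_diff)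
  have upper: "cmod (deriv_on a b j y t) \<le> N j y" if "Ck l y" "j \<le> l" "t \<in> {a..b}" for j y t
  proof -
    have "bounded (deriv_on a b j y ` {a..b})"
      using that Ck_deriv_on[of "l - j" j y] Ck_imp_bounded by simp
    then have "bdd_above ((\<lambda>t. cmod (deriv_on a b j y t)) ` {a..b})"
      by (auto simp: bounded_iff bdd_above_def)
    then show ?thesis unfolding N_def using that(3) by (intro cSUP_upper)
  qed
  have nonneg: "0 \<le> N j y" if "Ck l y" "j \<le> l" for j y
    using upper[OF that, of a] a_less_b by (auto intro: order_trans[OF norm_ge_zero])
  have "((\<lambda>i. C_norm a b l (\<lambda>t. X i t - x t)) \<longlongrightarrow> 0) F \<longleftrightarrow>
      (\<forall>j\<in>{..l}. ((\<lambda>i. N j (\<lambda>t. X i t - x t)) \<longlongrightarrow> 0) F)"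
    unfolding C_norm_def N_def[symmetric]
    by (rule tendsto_sum_zero_iff) (use X in \<open>auto elim!: eventually_mono intro!: nonneg diff\<close>)
  also have "\<dots> \<longleftrightarrow>
      (\<forall>j\<in>{..l}. uniform_limit {a..b} (\<lambda>i. deriv_on a b j (X i)) (deriv_on a b j x) F)"
  proof (intro ball_cong refl iffI)
    fix j assume j: "j \<in> {..l}"
    assume lim: "((\<lambda>i. N j (\<lambda>t. X i t - x t)) \<longlongrightarrow> 0) F"
    show "uniform_limit {a..b} (\<lambda>i. deriv_on a b j (X i)) (deriv_on a b j x) F"
    proof (rule uniform_limitI)
      fix e :: real assume "e > 0"
      from order_tendstoD(2)[OF lim this] X
      show "\<forall>\<^sub>F i in F. \<forall>t\<in>{a..b}. dist (deriv_on a b j (X i) t) (deriv_on a b j x t) < e"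
      proof eventually_elim
        case (elim i)
        show ?case
        proof
          fix t assume t: "t \<in> {a..b}"
          show "dist (deriv_on a b j (X i) t) (deriv_on a b j x t) < e"
            using upper[OF diff[OF elim(2)], of j t] deriv_on_minus[OF elim(2) x, of j t] t elim(1) j
            by (simp add: dist_norm)
        qed
      qed
    qed
  next
    fix j assume j: "j \<in> {..l}"
    assume lim: "uniform_limit {a..b} (\<lambda>i. deriv_on a b j (X i)) (deriv_on a b j x) F"
    show "((\<lambda>i. N j (\<lambda>t. X i t - x t)) \<longlongrightarrow> 0) F"
    proof (rule tendstoI)
      fix e :: real assume "e > 0"
      then have "e / 2 > 0" by simp
      from uniform_limitD[OF lim this] X
      show "\<forall>\<^sub>F i in F. dist (N j (\<lambda>t. X i t - x t)) 0 < e"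
      proof eventually_elim
        case (elim i)
        have "N j (\<lambda>t. X i t - x t) \<le> e / 2"
          unfolding N_def
        proof (rule cSUP_least)
          fix t assume t: "t \<in> {a..b}"
          then show "cmod (deriv_on a b j (\<lambda>t. X i t - x t) t) \<le> e / 2"
            using elim(1) deriv_on_minus[OF elim(2) x, of j t] j by (simp add: dist_norm less_imp_le)
        qed (use a_less_b in auto)
        then show ?case
          using nonneg[OF diff[OF elim(2)], of j] j \<open>e > 0\<close> by simp
      qed
    qed
  qed
  finally show ?thesis using X x unfolding Ck_lim_def atMost_iff Ball_def by blast
qed

lemma Cvec_space_iff: "x \<in> Cvec_space a b l \<longleftrightarrow> (\<forall>t. t \<notin> {a..b} \<longrightarrow> x t = 0) \<and> Ck l x"
  by (auto simp: Cvec_space_def C_space_iff Ck_vec_iff vec_eq_iff)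

lemma Cvec_norm_tendsto_0_iff:
  assumes X: "\<forall>\<^sub>F i in F. Ck l (X i)" and x: "Ck l x"
  shows "((\<lambda>i. Cvec_norm a b l (\<lambda>t. X i t - x t)) \<longlongrightarrow> 0) F \<longleftrightarrow> Ck_lim F l X x"
proof -
  have X': "\<forall>\<^sub>F i in F. Ck l (\<lambda>t. X i t $ s)" and x': "Ck l (\<lambda>t. x t $ s)" for s
    using assms by (auto simp: Ck_vec_iff elim!: eventually_mono)
  have "Ck l (\<lambda>t. X i t $ s - x t $ s)" if "Ck l (\<lambda>t. X i t $ s)" for i s
    using that x' unfolding Ck_iff_Ck_lim by (rule Ck_lim_diff)
  then have nonneg: "0 \<le> C_norm a b l (\<lambda>t. X i t $ s - x t $ s)" if "Ck l (\<lambda>t. X i t $ s)" for i s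
    using that by (intro C_norm_nonneg)
  have "\<forall>\<^sub>F i in F. 0 \<le> C_norm a b l (\<lambda>t. X i t $ s - x t $ s)" for s
    using X'[of s] by eventually_elim (rule nonneg)
  then show ?thesis
    unfolding Cvec_norm_def vector_minus_component
    by (subst tendsto_sum_zero_iff)
      (simp_all add: C_norm_tendsto_0_iff[OF X' x'] flip: Ck_lim_vec_iff)
qed

lemma Cvec_tends_iff:
  assumes "\<forall>\<^sub>F \<epsilon> in at_right 0. x \<epsilon> \<in> Cvec_space a b l" "x 0 \<in> Cvec_space a b l"
  shows "Cvec_tends a b l x \<longleftrightarrow> Ck_lim (at_right 0) l x (x 0)"
  unfolding Cvec_tends_def
  by (rule Cvec_norm_tendsto_0_iff) (use assms in \<open>auto simp: Cvec_space_iff elim!: eventually_mono\<close>)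

lemma Cmat_space_iff:
  "X \<in> Cmat_space a b l \<longleftrightarrow>
     (\<forall>t. t \<notin> {a..b} \<longrightarrow> X t = 0) \<and> (\<forall>i k. Ck l (\<lambda>t. X t $ i $ k))"
  by (auto simp: Cmat_space_def C_space_iff vec_eq_iff)

lemma Cmat_tends_iff:
  assumes "\<forall>\<^sub>F \<epsilon> in at_right 0. X \<epsilon> \<in> Cmat_space a b l" "X 0 \<in> Cmat_space a b l"
  shows "Cmat_tends a b l X \<longleftrightarrow>
    (\<forall>i k. Ck_lim (at_right 0) l (\<lambda>\<epsilon> t. X \<epsilon> t $ i $ k) (\<lambda>t. X 0 t $ i $ k))"
proof -
  have X: "\<forall>\<^sub>F \<epsilon> in at_right 0. Ck l (\<lambda>t. X \<epsilon> t $ i $ k)" and x: "Ck l (\<lambda>t. X 0 t $ i $ k)" for i k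
    using assms by (auto simp: Cmat_space_iff elim!: eventually_mono)
  have "Ck l (\<lambda>t. X \<epsilon> t $ i $ k - X 0 t $ i $ k)" if "Ck l (\<lambda>t. X \<epsilon> t $ i $ k)" for \<epsilon> i k
    using that x unfolding Ck_iff_Ck_lim by (rule Ck_lim_diff)
  then have nonneg: "0 \<le> C_norm a b l (\<lambda>t. X \<epsilon> t $ i $ k - X 0 t $ i $ k)"
    if "Ck l (\<lambda>t. X \<epsilon> t $ i $ k)" for \<epsilon> i k
    using that by (intro C_norm_nonneg)
  have n: "\<forall>\<^sub>F \<epsilon> in at_right 0. 0 \<le> C_norm a b l (\<lambda>t. X \<epsilon> t $ i $ k - X 0 t $ i $ k)" for i k
    using X[of i k] by eventually_elim (rule nonneg)
  have n': "\<forall>\<^sub>F \<epsilon> in at_right 0. 0 \<le> (\<Sum>k\<in>UNIV. C_norm a b l (\<lambda>t. X \<epsilon> t $ i $ k - X 0 t $ i $ k))" for i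
  proof -
    have "\<forall>\<^sub>F \<epsilon> in at_right 0. \<forall>k. 0 \<le> C_norm a b l (\<lambda>t. X \<epsilon> t $ i $ k - X 0 t $ i $ k)"
      using n by (simp add: eventually_all_finite)
    then show ?thesis by eventually_elim (simp add: sum_nonneg)
  qed
  show ?thesis
    unfolding Cmat_tends_def Cmat_norm_def vector_minus_component
    by (simp add: tendsto_sum_zero_iff n n' C_norm_tendsto_0_iff[OF X x])
qed

end

section \<open>Families of linear maps converging pointwise\<close>

text \<open>
  The Banach--Steinhaus principle for a continuous parameter. Pointwise convergence bounds each orbit
  only on an interval of parameters that depends on the point. The Baire category theorem,
  applied to the sets on which both bound and interval are prescribed by one integer, makes the bound
  uniform on a ball.
\<close>

lemma banach_steinhaus_tendsto:
  fixes T :: "real \<Rightarrow> 'a::{real_normed_vector, complete_space} \<Rightarrow> 'b::real_normed_vector"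
  assumes "0 < e0"
    and lin: "\<And>\<epsilon>. 0 < \<epsilon> \<Longrightarrow> \<epsilon> < e0 \<Longrightarrow> linear (T \<epsilon>)"
    and cont: "\<And>\<epsilon>. 0 < \<epsilon> \<Longrightarrow> \<epsilon> < e0 \<Longrightarrow> continuous_on UNIV (T \<epsilon>)"
    and lim: "\<And>x. ((\<lambda>\<epsilon>. T \<epsilon> x) \<longlongrightarrow> T 0 x) (at_right 0)"
    and u: "(u \<longlongrightarrow> u0) (at_right 0)"
  shows "((\<lambda>\<epsilon>. T \<epsilon> (u \<epsilon>)) \<longlongrightarrow> T 0 u0) (at_right 0)"
proof -
  define E where
    "E N = {x. \<forall>\<epsilon>\<in>{0<..<e0 / (real N + 1)}. norm (T \<epsilon> x) \<le> real N}" for N :: nat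
  have small: "0 < \<epsilon> \<and> \<epsilon> < e0" if "\<epsilon> \<in> {0<..<e0 / (real N + 1)}" for \<epsilon> and N :: nat
  proof -
    have "e0 / (real N + 1) \<le> e0 / 1"
      using \<open>0 < e0\<close> by (intro divide_left_mono) auto
    then show ?thesis using that by auto
  qed
  have closed: "closed (E N)" for N
  proof -
    have "E N = (\<Inter>\<epsilon>\<in>{0<..<e0 / (real N + 1)}. {x. norm (T \<epsilon> x) \<le> real N})"
      by (auto simp: E_def)
    then show ?thesis
      using small cont by (auto intro!: closed_INT closed_Collect_le continuous_on_norm)
  qed
  have "\<exists>N. x \<in> E N" for x
  proof -
    have "\<forall>\<^sub>F \<epsilon> in at_right 0. norm (T \<epsilon> x) < norm (T 0 x) + 1"
      using tendsto_norm[OF lim[of x]] by (rule order_tendstoD) simp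
    then obtain d where d: "d > 0" "\<And>\<epsilon>. 0 < \<epsilon> \<Longrightarrow> \<epsilon> < d \<Longrightarrow> norm (T \<epsilon> x) < norm (T 0 x) + 1"
      by (auto simp: eventually_at_right_field)
    obtain N :: nat where N: "real N \<ge> max (norm (T 0 x) + 1) (e0 / d)"
      using real_arch_simple by blast
    have "e0 / (real N + 1) \<le> d"
      using N d(1) by (simp add: divide_simps mult.commute) (smt (verit) d(1) mult_left_mono)
    then have "x \<in> E N"
      using N d(2) by (fastforce simp: E_def)
    then show ?thesis ..
  qed
  then have "\<Union>(range E) = UNIV" by auto
  then have "euclidean interior_of \<Union>(range E) \<noteq> {}" by simp
  then obtain N where "euclidean interior_of (E N) \<noteq> {}"
    using Baire_category_alt[of "euclidean :: 'a topology" "range E"] closed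
      completely_metrizable_space_euclidean by fastforce
  then obtain x0 \<rho> where \<rho>: "\<rho> > 0" "ball x0 \<rho> \<subseteq> E N"
    by (auto simp: mem_interior)
  have bound: "norm (T \<epsilon> h) \<le> 2 * real N" if "\<epsilon> \<in> {0<..<e0 / (real N + 1)}" "norm h < \<rho>" for \<epsilon> h
  proof -
    have "x0 + h \<in> E N" "x0 \<in> E N"
      using \<rho> that(2) by (auto simp: subset_iff dist_norm)
    then have "norm (T \<epsilon> (x0 + h)) \<le> real N" "norm (T \<epsilon> x0) \<le> real N"
      using that(1) by (auto simp: E_def)
    moreover have "T \<epsilon> h = T \<epsilon> (x0 + h) - T \<epsilon> x0"
      using lin small[OF that(1)] by (simp add: linear_add)
    ultimately show ?thesis
      using norm_triangle_ineq4[of "T \<epsilon> (x0 + h)" "T \<epsilon> x0"] by simp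
  qed
  have "((\<lambda>\<epsilon>. T \<epsilon> (u \<epsilon> - u0)) \<longlongrightarrow> 0) (at_right 0)"
  proof (rule tendstoI)
    fix e :: real assume "e > 0"
    define \<eta> where "\<eta> = e / (2 * real N + 1)"
    have \<eta>: "\<eta> > 0" "\<eta> * (2 * real N) < e"
      using \<open>e > 0\<close> by (auto simp: \<eta>_def divide_simps)
    have "\<forall>\<^sub>F \<epsilon> in at_right 0. norm (u \<epsilon> - u0) < \<eta> * \<rho>"
      using tendstoD[OF u, of "\<eta> * \<rho>"] \<eta>(1) \<rho>(1) by (simp add: dist_norm)
    moreover have "\<forall>\<^sub>F \<epsilon> in at_right 0. \<epsilon> \<in> {0<..<e0 / (real N + 1)}"
      using \<open>0 < e0\<close> by (intro eventually_at_right_real) simp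
    ultimately show "\<forall>\<^sub>F \<epsilon> in at_right 0. dist (T \<epsilon> (u \<epsilon> - u0)) 0 < e"
    proof eventually_elim
      case (elim \<epsilon>)
      have "norm ((1 / \<eta>) *\<^sub>R (u \<epsilon> - u0)) < \<rho>"
        using elim(1) \<eta>(1) by (simp add: divide_simps mult.commute)
      from bound[OF elim(2) this] have "norm (T \<epsilon> (u \<epsilon> - u0)) \<le> \<eta> * (2 * real N)"
        using lin small[OF elim(2)] \<eta>(1) by (simp add: linear_scale divide_simps mult.commute)
      then show ?case using \<eta>(2) by simp
    qed
  qed
  from tendsto_add[OF this lim[of u0]]
  have "((\<lambda>\<epsilon>. T \<epsilon> (u \<epsilon> - u0) + T \<epsilon> u0) \<longlongrightarrow> T 0 u0) (at_right 0)" by simp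
  moreover have "\<forall>\<^sub>F \<epsilon> in at_right 0. T \<epsilon> (u \<epsilon> - u0) + T \<epsilon> u0 = T \<epsilon> (u \<epsilon>)"
    using eventually_at_right_real[OF \<open>0 < e0\<close>]
    by eventually_elim (use lin in \<open>simp add: linear_diff\<close>)
  ultimately show ?thesis
    by (rule Lim_transform_eventually)
qed

section \<open>Ordinary differential equations\<close>

text \<open>
  A Gronwall estimate. In an inner product space the squared norm is differentiable, with derivative
  at most \<open>(2 M + 1) |x|\<^sup>2 + G\<^sup>2\<close>, so that no integral is needed.
\<close>

lemma differential_inequality:
  fixes x :: "real \<Rightarrow> 'e::real_inner"
  assumes "\<And>t. t \<in> {\<alpha>..\<beta>} \<Longrightarrow> (x has_vector_derivative h t) (at t within {\<alpha>..\<beta>})"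
    and "\<And>t. t \<in> {\<alpha>..\<beta>} \<Longrightarrow> norm (h t) \<le> M * norm (x t) + G"
    and "0 \<le> M" "0 \<le> G" "t \<in> {\<alpha>..\<beta>}"
  shows "(norm (x t))\<^sup>2 \<le> exp ((2 * M + 1) * (t - \<alpha>)) * ((norm (x \<alpha>))\<^sup>2 + G\<^sup>2 * (t - \<alpha>))"
proof -
  define c where "c = 2 * M + 1"
  define \<phi> where "\<phi> s = exp (- (c * (s - \<alpha>))) * (x s \<bullet> x s) - G\<^sup>2 * (s - \<alpha>)" for s
  define \<phi>' where "\<phi>' s = exp (- (c * (s - \<alpha>))) * (2 * (x s \<bullet> h s) - c * (x s \<bullet> x s)) - G\<^sup>2" for s
  have le: "\<phi>' s \<le> 0" if s: "s \<in> {\<alpha>..\<beta>}" for s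
  proof -
    have "2 * (x s \<bullet> h s) \<le> 2 * (norm (x s) * norm (h s))"
      using norm_cauchy_schwarz by simp
    also have "\<dots> \<le> 2 * (norm (x s) * (M * norm (x s) + G))"
      using assms(2)[OF s] by (intro mult_left_mono) auto
    also have "\<dots> \<le> c * (norm (x s))\<^sup>2 + G\<^sup>2"
      using sum_squares_bound[of "norm (x s)" G] by (simp add: c_def algebra_simps power2_eq_square)
    finally have "2 * (x s \<bullet> h s) - c * (x s \<bullet> x s) \<le> G\<^sup>2"
      by (simp add: power2_norm_eq_inner)
    moreover have "exp (- (c * (s - \<alpha>))) \<le> 1"
      using s assms(3) by (simp add: c_def)
    ultimately have "exp (- (c * (s - \<alpha>))) * (2 * (x s \<bullet> h s) - c * (x s \<bullet> x s)) \<le> 1 * G\<^sup>2"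
      by (meson exp_ge_zero mult_left_mono mult_right_mono order_trans zero_le_power2)
    then show ?thesis by (simp add: \<phi>'_def)
  qed
  have "\<phi> t \<le> \<phi> \<alpha>"
  proof (rule DERIV_nonpos_imp_decreasing_open[where f = \<phi> and a = \<alpha> and b = t])
    show "\<alpha> \<le> t" using assms(5) by simp
    fix s assume s: "\<alpha> < s" "s < t"
    have "(x has_vector_derivative h s) (at s)"
      using assms(1)[of s] s assms(5) at_within_Icc_at[of \<alpha> s \<beta>] by auto
    then have "(\<phi> has_real_derivative \<phi>' s) (at s)"
      unfolding \<phi>_def \<phi>'_def has_vector_derivative_def has_field_derivative_def
      by (auto intro!: derivative_eq_intros ext simp: algebra_simps inner_commute)
    then show "\<exists>y. (\<phi> has_real_derivative y) (at s) \<and> y \<le> 0"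
      using le s assms(5) by (intro exI[of _ "\<phi>' s"]) auto
  next
    have "continuous_on {\<alpha>..\<beta>} x"
      using assms(1) by (meson continuous_on_eq_continuous_within has_vector_derivative_continuous)
    then have "continuous_on {\<alpha>..t} x"
      by (rule continuous_on_subset) (use assms(5) in auto)
    then show "continuous_on {\<alpha>..t} \<phi>"
      unfolding \<phi>_def by (intro continuous_intros)
  qed
  then have "exp (- (c * (t - \<alpha>))) * (norm (x t))\<^sup>2 \<le> (norm (x \<alpha>))\<^sup>2 + G\<^sup>2 * (t - \<alpha>)"
    by (simp add: \<phi>_def power2_norm_eq_inner)
  then have "exp (c * (t - \<alpha>)) * (exp (- (c * (t - \<alpha>))) * (norm (x t))\<^sup>2) \<le>
      exp (c * (t - \<alpha>)) * ((norm (x \<alpha>))\<^sup>2 + G\<^sup>2 * (t - \<alpha>))"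
    by (intro mult_left_mono) auto
  then show ?thesis
    by (simp add: c_def mult.assoc[symmetric] flip: exp_add)
qed

text \<open>
  Uniqueness to the left of \<open>s\<close> follows from uniqueness to the right by reversing time.
\<close>

lemma vanishing_at_a_point:
  fixes x :: "real \<Rightarrow> 'e::real_inner"
  assumes d: "\<And>t. t \<in> {\<alpha>..\<beta>} \<Longrightarrow> (x has_vector_derivative h t) (at t within {\<alpha>..\<beta>})"
    and le: "\<And>t. t \<in> {\<alpha>..\<beta>} \<Longrightarrow> norm (h t) \<le> M * norm (x t)"
    and "0 \<le> M" "s \<in> {\<alpha>..\<beta>}" "x s = 0" "t \<in> {\<alpha>..\<beta>}"
  shows "x t = 0"
proof (cases "s \<le> t")
  case True
  have "(norm (x t))\<^sup>2 \<le> exp ((2 * M + 1) * (t - s)) * ((norm (x s))\<^sup>2 + 0\<^sup>2 * (t - s))"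
  proof (rule differential_inequality[where h = h and \<beta> = \<beta>])
    show "(x has_vector_derivative h u) (at u within {s..\<beta>})" if "u \<in> {s..\<beta>}" for u
      using d[of u] that assms(4) by (auto intro: has_vector_derivative_within_subset)
  qed (use le assms True in auto)
  then show ?thesis using assms(5) by simp
next
  case False
  have "(norm (x (- (- t))))\<^sup>2 \<le>
      exp ((2 * M + 1) * (- t - (- s))) * ((norm (x (- (- s))))\<^sup>2 + 0\<^sup>2 * (- t - (- s)))"
  proof (rule differential_inequality[where x = "\<lambda>u. x (- u)" and h = "\<lambda>u. - h (- u)" and \<beta> = "- \<alpha>"])
    fix u assume u: "u \<in> {- s..- \<alpha>}"
    have "(x has_vector_derivative h (- u)) (at (- u) within {\<alpha>..\<beta>})"
      using d[of "- u"] u assms(4) by auto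
    then have "(x has_vector_derivative h (- u)) (at (- u) within uminus ` {- s..- \<alpha>})"
      by (rule has_vector_derivative_within_subset) (use assms(4) in auto)
    then show "((\<lambda>u. x (- u)) has_vector_derivative - h (- u)) (at u within {- s..- \<alpha>})"
      using vector_diff_chain_within[of uminus "-1" u "{- s..- \<alpha>}" x "h (- u)"]
        has_vector_derivative_minus[OF has_vector_derivative_id] by (simp add: o_def)
    show "norm (- h (- u)) \<le> M * norm (x (- u)) + 0"
      using le[of "- u"] u assms(4) by auto
  qed (use assms False in auto)
  then show ?thesis using assms(5) by simp
qed

text \<open>
  The Picard operator contracts the norm weighted by \<open>exp (- \<kappa> (t - \<alpha>))\<close> when \<open>\<kappa>\<close> exceeds
  the Lipschitz constant, so a single fixed point covers the whole interval.
\<close>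

lemma picard_lindeloef_global:
  fixes f :: "real \<Rightarrow> 'e::banach \<Rightarrow> 'e"
  assumes "\<alpha> \<le> \<beta>"
    and cont: "\<And>y. continuous_on {\<alpha>..\<beta>} y \<Longrightarrow> continuous_on {\<alpha>..\<beta>} (\<lambda>t. f t (y t))"
    and lip: "\<And>t v w. t \<in> {\<alpha>..\<beta>} \<Longrightarrow> norm (f t v - f t w) \<le> L * norm (v - w)"
    and "0 \<le> L"
  obtains x where "x \<alpha> = c"
    and "\<And>t. t \<in> {\<alpha>..\<beta>} \<Longrightarrow> (x has_vector_derivative f t (x t)) (at t within {\<alpha>..\<beta>})"
proof -
  define \<kappa> where "\<kappa> = 2 * L + 1"
  have \<kappa>: "\<kappa> > 0" "L / \<kappa> \<le> 1 / 2" using \<open>0 \<le> L\<close> by (auto simp: \<kappa>_def divide_simps)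
  \<comment> \<open>The fixed point is sought as \<open>y = x / E\<close>, to which the unweighted supremum norm applies.\<close>
  define E where "E s = exp (\<kappa> * (s - \<alpha>))" for s
  define I where "I y s = integral {\<alpha>..s} (\<lambda>\<tau>. f \<tau> (E \<tau> *\<^sub>R y \<tau>))" for y s
  define G where "G y s = inverse (E s) *\<^sub>R (c + I y s)" for y s
  have E: "E s > 0" "continuous_on S E" for s S
    by (auto simp: E_def intro!: continuous_intros)
  have nz: "E s \<noteq> 0" for s using E(1)[of s] by simp
  have integrand: "continuous_on {\<alpha>..\<beta>} (\<lambda>\<tau>. f \<tau> (E \<tau> *\<^sub>R apply_bcontfun y \<tau>))" for y
    by (intro cont continuous_on_scaleR E continuous_on_apply_bcontfun)
  have dI: "((\<lambda>s. I (apply_bcontfun y) s) has_vector_derivative f t (E t *\<^sub>R apply_bcontfun y t))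
      (at t within {\<alpha>..\<beta>})" if "t \<in> {\<alpha>..\<beta>}" for y t
    unfolding I_def using integral_has_vector_derivative[OF integrand that] .
  have "continuous_on {\<alpha>..\<beta>} (I (apply_bcontfun y))" for y
    using dI by (meson continuous_on_eq_continuous_within has_vector_derivative_continuous)
  then have "continuous_on (cbox \<alpha> \<beta>) (G (apply_bcontfun y))" for y
    unfolding G_def box_real using nz
    by (intro continuous_on_scaleR continuous_on_add continuous_on_const continuous_on_inverse E(2)) auto
  then have "\<exists>g. \<forall>s. apply_bcontfun g s = G (apply_bcontfun y) (clamp \<alpha> \<beta> s)" for y
    using continuous_on_cbox_bcontfunE by metis
  then obtain \<Phi> where \<Phi>: "apply_bcontfun (\<Phi> y) s = G (apply_bcontfun y) (clamp \<alpha> \<beta> s)" for y s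
    by metis
  have "dist (\<Phi> y) (\<Phi> z) \<le> 1 / 2 * dist y z" for y z
  proof (rule dist_bound)
    fix s0
    define s where "s = clamp \<alpha> \<beta> s0"
    have s: "s \<in> {\<alpha>..\<beta>}" using clamp_in_interval[of \<alpha> \<beta> s0] \<open>\<alpha> \<le> \<beta>\<close> by (simp add: s_def)
    define d where "d = dist y z"
    have exp_int: "((\<lambda>\<tau>. L * (E \<tau> * d)) has_integral L / \<kappa> * d * E s - L / \<kappa> * d * E \<alpha>) {\<alpha>..s}"
    proof (rule fundamental_theorem_of_calculus)
      show "\<alpha> \<le> s" using s by simp
      show "((\<lambda>s. L / \<kappa> * d * E s) has_vector_derivative L * (E \<tau> * d)) (at \<tau> within {\<alpha>..s})" for \<tau>
        unfolding has_real_derivative_iff_has_vector_derivative[symmetric] E_def using \<kappa>(1)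
        by (auto intro!: derivative_eq_intros)
    qed
    have int: "(\<lambda>\<tau>. f \<tau> (E \<tau> *\<^sub>R apply_bcontfun y \<tau>)) integrable_on {\<alpha>..s}" for y
      by (intro integrable_continuous_real continuous_on_subset[OF integrand]) (use s in auto)
    have "norm (I y s - I z s) = norm (integral {\<alpha>..s}
        (\<lambda>\<tau>. f \<tau> (E \<tau> *\<^sub>R apply_bcontfun y \<tau>) - f \<tau> (E \<tau> *\<^sub>R apply_bcontfun z \<tau>)))"
      unfolding I_def by (simp add: integral_diff int)
    also have "\<dots> \<le> integral {\<alpha>..s} (\<lambda>\<tau>. L * (E \<tau> * d))"
    proof (rule integral_norm_bound_integral)
      fix \<tau> assume \<tau>: "\<tau> \<in> {\<alpha>..s}"
      have "norm (f \<tau> (E \<tau> *\<^sub>R y \<tau>) - f \<tau> (E \<tau> *\<^sub>R z \<tau>)) \<le> L * norm (E \<tau> *\<^sub>R y \<tau> - E \<tau> *\<^sub>R z \<tau>)"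
        by (rule lip) (use \<tau> s in auto)
      also have "norm (E \<tau> *\<^sub>R y \<tau> - E \<tau> *\<^sub>R z \<tau>) = E \<tau> * dist (y \<tau>) (z \<tau>)"
        using E(1)[of \<tau>] by (simp add: dist_norm flip: scaleR_diff_right)
      also have "L * (E \<tau> * dist (y \<tau>) (z \<tau>)) \<le> L * (E \<tau> * d)"
        unfolding d_def using \<open>0 \<le> L\<close> E(1)[of \<tau>] dist_bounded[of y \<tau> z]
        by (intro mult_left_mono) auto
      finally show "norm (f \<tau> (E \<tau> *\<^sub>R y \<tau>) - f \<tau> (E \<tau> *\<^sub>R z \<tau>)) \<le> L * (E \<tau> * d)" .
    qed (use int exp_int in \<open>auto intro: integrable_diff has_integral_integrable\<close>)
    also have "\<dots> = L / \<kappa> * d * E s - L / \<kappa> * d * E \<alpha>"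
      using exp_int by (rule integral_unique)
    also have "\<dots> \<le> L / \<kappa> * d * E s"
      using \<open>0 \<le> L\<close> \<kappa>(1) E(1)[of \<alpha>] by (simp add: d_def)
    also have "\<dots> \<le> 1 / 2 * d * E s"
      using \<kappa>(2) E(1)[of s] by (intro mult_right_mono) (auto simp: d_def)
    finally have *: "norm (I y s - I z s) \<le> 1 / 2 * d * E s" .
    have "dist (\<Phi> y s0) (\<Phi> z s0) = inverse (E s) * norm (I y s - I z s)"
      using E(1)[of s] by (simp add: \<Phi> G_def dist_norm flip: s_def scaleR_diff_right)
    also have "\<dots> \<le> inverse (E s) * (1 / 2 * d * E s)"
      using * E(1)[of s] by (intro mult_left_mono) auto
    also have "\<dots> = 1 / 2 * d" using E(1)[of s] by simp
    finally show "dist (\<Phi> y s0) (\<Phi> z s0) \<le> 1 / 2 * dist y z" by (simp add: d_def)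
  qed
  then obtain y where y: "\<Phi> y = y"
    using banach_fix_type[of "1 / 2" \<Phi>] by auto
  define x where "x s = c + I (apply_bcontfun y) s" for s
  have x: "x s = E s *\<^sub>R apply_bcontfun y s" if "s \<in> {\<alpha>..\<beta>}" for s
    using \<Phi>[of y s] that E(1)[of s] by (simp add: y G_def x_def)
  show ?thesis
  proof
    show "x \<alpha> = c" by (simp add: x_def I_def)
    show "(x has_vector_derivative f t (x t)) (at t within {\<alpha>..\<beta>})" if "t \<in> {\<alpha>..\<beta>}" for t
      using dI[OF that, of y] x[OF that] unfolding x_def[abs_def]
      by (auto intro!: derivative_eq_intros simp: x_def)
  qed
qed

section \<open>Convergent operators along convergent arguments\<close>

context segment
begin

definition extend_zero :: "(real \<Rightarrow> 'a::zero) \<Rightarrow> real \<Rightarrow> 'a" where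
  "extend_zero x t = (if t \<in> {a..b} then x t else 0)"

definition antideriv :: "(real \<Rightarrow> 'a::banach) \<Rightarrow> real \<Rightarrow> 'a" where
  "antideriv x t = integral {a..t} x"

lemma Ck_lim_extend_zero: "Ck_lim F l X x \<Longrightarrow> Ck_lim F l (\<lambda>i. extend_zero (X i)) (extend_zero x)"
  using Ck_lim_cong[of "\<lambda>i. extend_zero (X i)" X F "extend_zero x" x l] by (simp add: extend_zero_def)

lemma Ck_extend_zero: "Ck l (extend_zero x) \<longleftrightarrow> Ck l x"
  by (rule Ck_cong) (simp add: extend_zero_def)

lemma extend_zero_in_Cvec_space: "Ck l x \<Longrightarrow> extend_zero x \<in> Cvec_space a b l"
  by (simp add: Cvec_space_iff Ck_extend_zero) (simp add: extend_zero_def)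

lemma extend_zero_ident: "x \<in> Cvec_space a b l \<Longrightarrow> extend_zero x = x"
  by (auto simp: Cvec_space_iff extend_zero_def)

lemma extend_zero_cong: "(\<And>t. t \<in> {a..b} \<Longrightarrow> x t = y t) \<Longrightarrow> extend_zero x = extend_zero y"
  by (auto simp: extend_zero_def)

lemma Ck_lim_antideriv:
  assumes "Ck_lim F l X x"
  shows "Ck_lim F (Suc l) (\<lambda>i. antideriv (X i)) (antideriv x)"
proof (rule Ck_lim_SucI[OF _ _ _ assms])
  have d: "(antideriv y has_vector_derivative y t) (at t within {a..b})"
    if "Ck l y" "t \<in> {a..b}" for y t
    unfolding antideriv_def[abs_def]
    using integral_has_vector_derivative[OF Ck_imp_continuous[OF that(1)] that(2)] .
  show "\<forall>\<^sub>F i in F. \<forall>t\<in>{a..b}. (antideriv (X i) has_vector_derivative X i t) (at t within {a..b})"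
    using assms unfolding Ck_lim_def by (auto elim!: eventually_mono intro!: d)
  show "(antideriv x has_vector_derivative x t) (at t within {a..b})" if "t \<in> {a..b}" for t
    using assms that unfolding Ck_lim_def by (auto intro!: d)
  show "uniform_limit {a..b} (\<lambda>i. antideriv (X i)) (antideriv x) F"
  proof (rule uniform_limitI)
    fix e :: real assume "e > 0"
    define \<eta> where "\<eta> = e / (2 * (b - a))"
    have \<eta>: "\<eta> > 0" "\<eta> * (b - a) < e"
      using \<open>e > 0\<close> a_less_b by (auto simp: \<eta>_def field_simps)
    have "\<forall>\<^sub>F i in F. Ck l (X i)" using assms by (simp add: Ck_lim_def)
    with uniform_limitD[OF Ck_lim_uniform_limit[OF assms] \<eta>(1)]
    show "\<forall>\<^sub>F i in F. \<forall>t\<in>{a..b}. dist (antideriv (X i) t) (antideriv x t) < e"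
    proof eventually_elim
      case (elim i)
      show ?case
      proof
        fix t assume t: "t \<in> {a..b}"
        have int: "y integrable_on {a..t}" if "Ck l y" for y :: "real \<Rightarrow> 'b"
          by (intro integrable_continuous_real continuous_on_subset[OF Ck_imp_continuous[OF that]])
            (use t in auto)
        have x: "Ck l x" using assms by (simp add: Ck_lim_def)
        have "norm (integral {a..t} (\<lambda>s. X i s - x s)) \<le> \<eta> * (t - a)"
        proof (rule integral_bound)
          show "continuous_on {a..t} (\<lambda>s. X i s - x s)"
            by (intro continuous_on_diff continuous_on_subset[OF Ck_imp_continuous[OF elim(2)]]
                continuous_on_subset[OF Ck_imp_continuous[OF x]]) (use t in auto)
          show "norm (X i s - x s) \<le> \<eta>" if "s \<in> {a..t}" for s
            using bspec[OF elim(1), of s] that t by (simp add: dist_norm)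
        qed (use t in auto)
        also have "\<dots> \<le> \<eta> * (b - a)"
          using t \<eta>(1) by (intro mult_left_mono) auto
        finally show "dist (antideriv (X i) t) (antideriv x t) < e"
          using \<eta>(2) by (simp add: antideriv_def dist_norm integral_diff int elim(2) x)
      qed
    qed
  qed
qed

lemma antideriv_pow_Suc: "(antideriv ^^ Suc k) x t = integral {a..t} ((antideriv ^^ k) x)"
  by (simp add: antideriv_def)

lemma Ck_lim_antideriv_pow:
  "Ck_lim F l X x \<Longrightarrow> Ck_lim F (k + l) (\<lambda>i. (antideriv ^^ k) (X i)) ((antideriv ^^ k) x)"
  by (induction k) (auto intro: Ck_lim_antideriv)

lemma Ck_antideriv_pow: "Ck l x \<Longrightarrow> Ck (k + l) ((antideriv ^^ k) x)"
  unfolding Ck_iff_Ck_lim by (rule Ck_lim_antideriv_pow)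

lemma antideriv_pow_cong:
  assumes "\<And>t. t \<in> {a..b} \<Longrightarrow> x t = y t" "t \<in> {a..b}"
  shows "(antideriv ^^ k) x t = (antideriv ^^ k) y t"
  using assms(2)
proof (induction k arbitrary: t)
  case (Suc k)
  have "integral {a..t} ((antideriv ^^ k) x) = integral {a..t} ((antideriv ^^ k) y)"
    by (rule Henstock_Kurzweil_Integration.integral_cong) (use Suc in auto)
  then show ?case unfolding antideriv_pow_Suc .
qed (use assms in simp)

lemma antideriv_pow_add:
  assumes "continuous_on {a..b} x" "continuous_on {a..b} y" "t \<in> {a..b}"
  shows "(antideriv ^^ k) (\<lambda>t. x t + y t) t = (antideriv ^^ k) x t + (antideriv ^^ k) y t"
  using assms(3)
proof (induction k arbitrary: t)
  case (Suc k)
  have int: "(antideriv ^^ k) z integrable_on {a..t}" if "continuous_on {a..b} z" for z :: "real \<Rightarrow> 'a"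
    by (intro integrable_continuous_real
        continuous_on_subset[OF Ck_imp_continuous[OF Ck_antideriv_pow[of 0]]])
      (use that Suc.prems in \<open>auto simp: Ck_0\<close>)
  have "integral {a..t} ((antideriv ^^ k) (\<lambda>t. x t + y t)) =
      integral {a..t} (\<lambda>t. (antideriv ^^ k) x t + (antideriv ^^ k) y t)"
    by (rule Henstock_Kurzweil_Integration.integral_cong) (use Suc in auto)
  then show ?case
    unfolding antideriv_pow_Suc
    using assms by (simp add: Henstock_Kurzweil_Integration.integral_add int)
qed simp

lemma antideriv_pow_scaleR:
  "(antideriv ^^ k) (\<lambda>t. c *\<^sub>R x t) = (\<lambda>t. c *\<^sub>R (antideriv ^^ k) x t)"
  by (induction k) (simp_all add: antideriv_def[abs_def])

lemma antideriv_deriv_on: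
  assumes "Ck (Suc l) x" "t \<in> {a..b}"
  shows "x t = x a + antideriv (deriv_on a b 1 x) t"
proof -
  have "(deriv_on a b 1 x has_integral x t - x a) {a..t}"
  proof (rule fundamental_theorem_of_calculus)
    show "(x has_vector_derivative deriv_on a b 1 x s) (at s within {a..t})" if "s \<in> {a..t}" for s
      using Ck_SucE(1)[OF assms(1), of s] that assms(2)
      by (auto intro: has_vector_derivative_within_subset simp del: deriv_on.simps)
  qed (use assms(2) in auto)
  then show ?thesis by (simp add: antideriv_def integral_unique del: deriv_on.simps)
qed

lemma op_tendsto:
  assumes T: "continuous_linear_op a b l T"
    and X: "\<forall>\<^sub>F i in F. X i \<in> Cvec_space a b l" "x \<in> Cvec_space a b l" "Ck_lim F l X x"
  shows "((\<lambda>i. T (X i)) \<longlongrightarrow> T x) F"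
proof (rule tendstoI)
  fix e :: real assume "e > 0"
  then obtain d where d: "d > 0"
    "\<And>y. y \<in> Cvec_space a b l \<Longrightarrow> Cvec_norm a b l (\<lambda>t. y t - x t) < d \<Longrightarrow> norm (T y - T x) < e"
    using T X(2) unfolding continuous_linear_op_def by blast
  have "((\<lambda>i. Cvec_norm a b l (\<lambda>t. X i t - x t)) \<longlongrightarrow> 0) F"
    using X by (subst Cvec_norm_tendsto_0_iff) (auto simp: Ck_lim_def)
  from order_tendstoD(2)[OF this d(1)] X(1)
  show "\<forall>\<^sub>F i in F. dist (T (X i)) (T x) < e"
    by eventually_elim (simp add: d dist_norm)
qed

lemma op_add:
  assumes "continuous_linear_op a b l T" "x \<in> Cvec_space a b l" "y \<in> Cvec_space a b l"
  shows "T (\<lambda>t. x t + y t) = T x + T y"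
  using assms by (auto simp: continuous_linear_op_def)

lemma op_scale:
  assumes "continuous_linear_op a b l T" "x \<in> Cvec_space a b l"
  shows "T (\<lambda>t. c *s x t) = c *s T x"
  using assms by (auto simp: continuous_linear_op_def)

lemma scaleR_eq_scale: "c *\<^sub>R (v :: complex ^ 'n) = complex_of_real c *s v"
  unfolding vec_eq_iff vector_scaleR_component vector_smult_component
  by (simp add: scaleR_conv_of_real)

text \<open>
  The domain of the operators is a set of functions rather than a type, so the Banach--Steinhaus
  principle is applied after composition with a continuous linear map \<open>J\<close> from a Banach space.
\<close>

lemma op_family_tendsto_of_parametrization:
  fixes B :: "real \<Rightarrow> (real \<Rightarrow> complex ^ 'm) \<Rightarrow> complex ^ 'k" and J :: "'u::{real_normed_vector, complete_space} \<Rightarrow> real \<Rightarrow> complex ^ 'm"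
  assumes "0 < e0"
    and B: "\<And>\<epsilon>. \<epsilon> \<in> {0..<e0} \<Longrightarrow> continuous_linear_op a b l (B \<epsilon>)"
    and strong: "\<And>z. z \<in> Cvec_space a b l \<Longrightarrow> ((\<lambda>\<epsilon>. B \<epsilon> z) \<longlongrightarrow> B 0 z) (at_right 0)"
    and J: "\<And>u. J u \<in> Cvec_space a b l" "\<And>u v. J (u + v) = (\<lambda>t. J u t + J v t)"
      "\<And>c u. J (c *\<^sub>R u) = (\<lambda>t. c *\<^sub>R J u t)" "\<And>u. Ck_lim (at u) l J (J u)"
    and u: "(u \<longlongrightarrow> u0) (at_right 0)"
  shows "((\<lambda>\<epsilon>. B \<epsilon> (J (u \<epsilon>))) \<longlongrightarrow> B 0 (J u0)) (at_right 0)"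
proof (rule banach_steinhaus_tendsto[where T = "\<lambda>\<epsilon> u. B \<epsilon> (J u)", OF \<open>0 < e0\<close> _ _ strong[OF J(1)] u])
  fix \<epsilon> assume \<epsilon>: "0 < \<epsilon>" "\<epsilon> < e0"
  have T: "continuous_linear_op a b l (B \<epsilon>)" using B \<epsilon> by simp
  show "linear (\<lambda>u. B \<epsilon> (J u))"
    by (rule linearI)
      (simp_all add: J(2,3) op_add[OF T] J(1) scaleR_eq_scale op_scale[OF T])
  show "continuous_on UNIV (\<lambda>u. B \<epsilon> (J u))"
    unfolding continuous_on_def using op_tendsto[OF T always_eventually J(1) J(4)] J(1) by simp
qed

text \<open>
  The space of \<open>N\<close> times differentiable functions is exhausted by images of Banach types:
  \<open>x = x(a) + \<integral> x'\<close> peels off one constant and one antiderivative at a time. Hence the claim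
  is proved for \<open>N - l\<close> fold antiderivatives of functions of class \<open>l\<close>, by induction on
  \<open>l\<close>, starting from bounded continuous functions.
\<close>

lemma op_family_tendsto:
  fixes B :: "real \<Rightarrow> (real \<Rightarrow> complex ^ 'm) \<Rightarrow> complex ^ 'k"
  assumes "0 < e0"
    and B: "\<And>\<epsilon>. \<epsilon> \<in> {0..<e0} \<Longrightarrow> continuous_linear_op a b N (B \<epsilon>)"
    and strong: "\<And>z. z \<in> Cvec_space a b N \<Longrightarrow> ((\<lambda>\<epsilon>. B \<epsilon> z) \<longlongrightarrow> B 0 z) (at_right 0)"
    and Z: "\<forall>\<^sub>F \<epsilon> in at_right 0. Z \<epsilon> \<in> Cvec_space a b N" "z \<in> Cvec_space a b N"
      "Ck_lim (at_right 0) N Z z"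
  shows "((\<lambda>\<epsilon>. B \<epsilon> (Z \<epsilon>)) \<longlongrightarrow> B 0 z) (at_right 0)"
proof -
  have "((\<lambda>\<epsilon>. B \<epsilon> (extend_zero ((antideriv ^^ (N - l)) (X \<epsilon>)))) \<longlongrightarrow> B 0 (extend_zero ((antideriv ^^ (N - l)) x)))
      (at_right 0)" if "l \<le> N" "Ck_lim (at_right 0) l X x" for l X x
    using that
  proof (induction l arbitrary: X x)
    case 0
    \<comment> \<open>Constant continuation beyond the end points makes a continuous function on the segment a bounded continuous function on the line.\<close>
    define ext where "ext y = (SOME g. \<forall>t. apply_bcontfun g t = y (clamp a b t))"
      for y :: "real \<Rightarrow> complex ^ 'm"
    have ext: "apply_bcontfun (ext y) t = y (clamp a b t)" if "continuous_on {a..b} y" for y t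
    proof -
      have "continuous_on (cbox a b) y" using that by simp
      then obtain g :: "real \<Rightarrow>\<^sub>C (complex ^ 'm)" where "\<And>t. apply_bcontfun g t = y (clamp a b t)"
        by (rule continuous_on_cbox_bcontfunE) blast
      then have "\<exists>g. \<forall>t. apply_bcontfun g t = y (clamp a b t)" by blast
      from someI_ex[OF this] show ?thesis unfolding ext_def by blast
    qed
    have cont: "\<forall>\<^sub>F \<epsilon> in at_right 0. continuous_on {a..b} (X \<epsilon>)" "continuous_on {a..b} x"
      and uni: "uniform_limit {a..b} X x (at_right 0)"
      using 0 by (auto simp: Ck_lim_0)
    have "uniform_limit UNIV (\<lambda>\<epsilon> t. X \<epsilon> (clamp a b t)) (\<lambda>t. x (clamp a b t)) (at_right 0)"
      by (rule uniform_limit_compose'[OF uni])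
        (use clamp_in_interval[of a b] a_less_b in \<open>auto simp: Pi_iff\<close>)
    moreover have "\<forall>\<^sub>F \<epsilon> in at_right 0. \<forall>t\<in>UNIV. X \<epsilon> (clamp a b t) = apply_bcontfun (ext (X \<epsilon>)) t"
      using cont(1) by eventually_elim (simp add: ext)
    ultimately have "uniform_limit UNIV (\<lambda>\<epsilon>. apply_bcontfun (ext (X \<epsilon>))) (apply_bcontfun (ext x)) (at_right 0)"
      by (subst (asm) uniform_limit_cong[where i = "apply_bcontfun (ext x)"]) (auto simp: ext cont)
    then have lim: "((\<lambda>\<epsilon>. ext (X \<epsilon>)) \<longlongrightarrow> ext x) (at_right 0)"
      by (rule uniform_limit_tendsto_bcontfun)
    define J where "J u = extend_zero ((antideriv ^^ N) (apply_bcontfun u))" for u :: "real \<Rightarrow>\<^sub>C (complex ^ 'm)"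
    have limJ: "((\<lambda>\<epsilon>. B \<epsilon> (J (ext (X \<epsilon>)))) \<longlongrightarrow> B 0 (J (ext x))) (at_right 0)"
    proof (rule op_family_tendsto_of_parametrization[where J = J, OF \<open>0 < e0\<close> B strong])
      show "((\<lambda>\<epsilon>. ext (X \<epsilon>)) \<longlongrightarrow> ext x) (at_right 0)" by (rule lim)
      show "J u \<in> Cvec_space a b N" for u
        unfolding J_def using Ck_antideriv_pow[of 0 "apply_bcontfun u" N]
        by (intro extend_zero_in_Cvec_space) (simp add: Ck_0)
      show "J (u + v) = (\<lambda>t. J u t + J v t)" for u v
        unfolding J_def using antideriv_pow_add[of "apply_bcontfun u" "apply_bcontfun v" _ N]
        by (auto simp: extend_zero_def plus_bcontfun.rep_eq)
      show "J (c *\<^sub>R u) = (\<lambda>t. c *\<^sub>R J u t)" for c u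
        unfolding J_def by (auto simp: extend_zero_def scaleR_bcontfun.rep_eq antideriv_pow_scaleR)
      show "Ck_lim (at u) N J (J u)" for u
      proof -
        have "uniform_limit {a..b} apply_bcontfun (apply_bcontfun u) (at u)"
          using uniform_limit_on_subset[OF tendsto_bcontfun_uniform_limit[OF tendsto_ident_at]] by blast
        then have "Ck_lim (at u) 0 apply_bcontfun (apply_bcontfun u)"
          by (simp add: Ck_lim_0)
        from Ck_lim_extend_zero[OF Ck_lim_antideriv_pow[OF this, of N]] show ?thesis
          by (simp add: J_def[abs_def])
      qed
    qed
    have J: "J (ext y) = extend_zero ((antideriv ^^ N) y)" if "continuous_on {a..b} y" for y
      unfolding J_def using that by (intro extend_zero_cong antideriv_pow_cong) (auto simp: ext)
    have "\<forall>\<^sub>F \<epsilon> in at_right 0. B \<epsilon> (J (ext (X \<epsilon>))) = B \<epsilon> (extend_zero ((antideriv ^^ N) (X \<epsilon>)))"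
      using cont(1) by eventually_elim (simp add: J)
    from Lim_transform_eventually[OF limJ this] show ?case
      by (simp add: J[OF cont(2)])
  next
    case (Suc l)
    define k where "k = N - Suc l"
    have k: "N - l = Suc k" "k + Suc l = N" using Suc.prems(1) by (auto simp: k_def)
    \<comment> \<open>\<open>P\<close> depends only on the value at \<open>a\<close>, a vector in a Banach space; \<open>Q\<close> is covered by the induction hypothesis.\<close>
    define P where "P y = extend_zero ((antideriv ^^ k) (\<lambda>t. y a))" for y :: "real \<Rightarrow> complex ^ 'm"
    define Q where "Q y = extend_zero ((antideriv ^^ Suc k) (deriv_on a b 1 y))" for y :: "real \<Rightarrow> complex ^ 'm"
    have PQ: "P y \<in> Cvec_space a b N" "Q y \<in> Cvec_space a b N"
      "extend_zero ((antideriv ^^ k) y) = (\<lambda>t. P y t + Q y t)" if y: "Ck (Suc l) y" for y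
    proof -
      have const: "Ck (Suc l) (\<lambda>t. y a)"
        unfolding Ck_iff_Ck_lim by (rule Ck_lim_value) simp
      have D: "Ck l (deriv_on a b 1 y)" by (rule Ck_SucE(2)[OF y])
      have "Ck (k + Suc l) ((antideriv ^^ k) (\<lambda>t. y a))"
        "Ck (Suc k + l) ((antideriv ^^ Suc k) (deriv_on a b 1 y))"
        by (intro Ck_antideriv_pow const D)+
      then show "P y \<in> Cvec_space a b N" "Q y \<in> Cvec_space a b N"
        unfolding P_def Q_def using k by (auto intro!: extend_zero_in_Cvec_space simp del: deriv_on.simps)
      have c: "continuous_on {a..b} (antideriv (deriv_on a b 1 y))"
        using Ck_antideriv_pow[OF D, of 1] by (simp add: Ck_imp_continuous del: deriv_on.simps)
      show "extend_zero ((antideriv ^^ k) y) = (\<lambda>t. P y t + Q y t)"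
      proof
        fix t
        show "extend_zero ((antideriv ^^ k) y) t = P y t + Q y t"
        proof (cases "t \<in> {a..b}")
          case True
          have "(antideriv ^^ k) y t = (antideriv ^^ k) (\<lambda>t. y a + antideriv (deriv_on a b 1 y) t) t"
            by (intro antideriv_pow_cong antideriv_deriv_on[OF y] True)
          also have "\<dots> = (antideriv ^^ k) (\<lambda>t. y a) t + (antideriv ^^ k) (antideriv (deriv_on a b 1 y)) t"
            by (intro antideriv_pow_add True c continuous_on_const)
          finally show ?thesis
            using True by (simp add: P_def Q_def extend_zero_def funpow_swap1 del: deriv_on.simps)
        qed (auto simp: P_def Q_def extend_zero_def)
      qed
    qed
    have limQ: "((\<lambda>\<epsilon>. B \<epsilon> (Q (X \<epsilon>))) \<longlongrightarrow> B 0 (Q x)) (at_right 0)"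
      using Suc.IH[of "\<lambda>\<epsilon>. deriv_on a b 1 (X \<epsilon>)" "deriv_on a b 1 x"] Suc.prems
      by (simp add: k Q_def Ck_lim_Suc del: deriv_on.simps funpow.simps)
    have lima: "((\<lambda>\<epsilon>. X \<epsilon> a) \<longlongrightarrow> x a) (at_right 0)"
      using Ck_lim_valueD[OF Suc.prems(2)] a_less_b by simp
    have limP: "((\<lambda>\<epsilon>. B \<epsilon> (P (X \<epsilon>))) \<longlongrightarrow> B 0 (P x)) (at_right 0)"
      unfolding P_def
    proof (rule op_family_tendsto_of_parametrization[where J = "\<lambda>v. extend_zero ((antideriv ^^ k) (\<lambda>t. v))",
          OF \<open>0 < e0\<close> B strong])
      show "((\<lambda>\<epsilon>. X \<epsilon> a) \<longlongrightarrow> x a) (at_right 0)" by (rule lima)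
      have *: "Ck_lim (at v) (k + Suc l) (\<lambda>v. (antideriv ^^ k) (\<lambda>t. v)) ((antideriv ^^ k) (\<lambda>t. v))"
        for v :: "complex ^ 'm"
        by (intro Ck_lim_antideriv_pow Ck_lim_value tendsto_ident_at)
      then show "Ck_lim (at v) N (\<lambda>v. extend_zero ((antideriv ^^ k) (\<lambda>t. v))) (extend_zero ((antideriv ^^ k) (\<lambda>t. v)))"
        for v :: "complex ^ 'm"
        using k by (intro Ck_lim_extend_zero) simp
      show "extend_zero ((antideriv ^^ k) (\<lambda>t. v)) \<in> Cvec_space a b N" for v :: "complex ^ 'm"
        using *[of v] k by (intro extend_zero_in_Cvec_space) (simp add: Ck_lim_def)
      show "extend_zero ((antideriv ^^ k) (\<lambda>t. u + v)) =
          (\<lambda>t. extend_zero ((antideriv ^^ k) (\<lambda>t. u)) t + extend_zero ((antideriv ^^ k) (\<lambda>t. v)) t)"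
        for u v :: "complex ^ 'm"
        using antideriv_pow_add[of "\<lambda>t. u" "\<lambda>t. v" _ k] by (auto simp: extend_zero_def)
      show "extend_zero ((antideriv ^^ k) (\<lambda>t. c *\<^sub>R v)) = (\<lambda>t. c *\<^sub>R extend_zero ((antideriv ^^ k) (\<lambda>t. v)) t)"
        for c and v :: "complex ^ 'm"
        using antideriv_pow_scaleR[of k c "\<lambda>t. v"] by (auto simp: extend_zero_def)
    qed
    have sum: "B 0 (P x) + B 0 (Q x) = B 0 (extend_zero ((antideriv ^^ k) x))"
      using op_add[OF B[of 0]] PQ[of x] \<open>0 < e0\<close> Suc.prems(2) by (simp add: Ck_lim_def)
    have "\<forall>\<^sub>F \<epsilon> in at_right 0. Ck (Suc l) (X \<epsilon>)"
      using Suc.prems(2) by (simp add: Ck_lim_def)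
    then have "\<forall>\<^sub>F \<epsilon> in at_right 0.
        B \<epsilon> (P (X \<epsilon>)) + B \<epsilon> (Q (X \<epsilon>)) = B \<epsilon> (extend_zero ((antideriv ^^ k) (X \<epsilon>)))"
      using eventually_at_right_real[OF \<open>0 < e0\<close>]
    proof eventually_elim
      case (elim \<epsilon>)
      then show ?case using op_add[OF B[of \<epsilon>] PQ(1,2)] PQ(3) by simp
    qed
    from Lim_transform_eventually[OF tendsto_add[OF limP limQ] this] show ?case
      unfolding k_def[symmetric] sum .
  qed
  from this[OF order_refl Z(3)]
  have "((\<lambda>\<epsilon>. B \<epsilon> (extend_zero (Z \<epsilon>))) \<longlongrightarrow> B 0 z) (at_right 0)"
    using extend_zero_ident[OF Z(2)] by simp
  moreover have "\<forall>\<^sub>F \<epsilon> in at_right 0. B \<epsilon> (extend_zero (Z \<epsilon>)) = B \<epsilon> (Z \<epsilon>)"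
    using Z(1) by eventually_elim (simp add: extend_zero_ident)
  ultimately show ?thesis by (rule Lim_transform_eventually)
qed

end

section \<open>Linear first order systems depending on a parameter\<close>

lemma det_nonzero_iff_ker:
  fixes M :: "complex ^ 'n ^ 'n"
  shows "det M \<noteq> 0 \<longleftrightarrow> (\<forall>v. M *v v = 0 \<longrightarrow> v = 0)"
  by (simp add: invertible_left_inverse matrix_left_invertible_ker flip: invertible_det_nz)

lemma norm_matrix_vector_le:
  fixes M :: "complex ^ 'n ^ 'q"
  shows "norm (M *v v) \<le> (\<Sum>i\<in>UNIV. \<Sum>j\<in>UNIV. cmod (M $ i $ j)) * norm v"
proof -
  have "norm (M *v v) \<le> (\<Sum>i\<in>UNIV. cmod ((M *v v) $ i))"
    unfolding norm_vec_def by (rule L2_set_le_sum) simp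
  also have "\<dots> \<le> (\<Sum>i\<in>UNIV. \<Sum>j\<in>UNIV. cmod (M $ i $ j) * norm v)"
  proof (rule sum_mono)
    fix i
    have "cmod ((M *v v) $ i) \<le> (\<Sum>j\<in>UNIV. cmod (M $ i $ j * v $ j))"
      unfolding matrix_vector_mult_def by (simp add: norm_sum)
    also have "\<dots> \<le> (\<Sum>j\<in>UNIV. cmod (M $ i $ j) * norm v)"
      by (intro sum_mono) (simp add: norm_mult mult_left_mono Finite_Cartesian_Product.norm_nth_le)
    finally show "cmod ((M *v v) $ i) \<le> (\<Sum>j\<in>UNIV. cmod (M $ i $ j) * norm v)" .
  qed
  finally show ?thesis by (simp add: sum_distrib_right)
qed

context segment
begin

lemma Ck_lim_matrix_vector_mult:
  fixes A :: "'i \<Rightarrow> real \<Rightarrow> complex ^ 'n ^ 'q"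
  assumes "\<And>u v. Ck_lim F l (\<lambda>i t. A i t $ u $ v) (\<lambda>t. A0 t $ u $ v)" "Ck_lim F l X x"
  shows "Ck_lim F l (\<lambda>i t. A i t *v X i t) (\<lambda>t. A0 t *v x t)"
  using assms(2) unfolding Ck_lim_vec_iff matrix_vector_mult_def
  by (auto intro!: Ck_lim_sum Ck_lim_mult assms(1))

lemma eventually_matrix_bound:
  fixes A :: "'i \<Rightarrow> real \<Rightarrow> complex ^ 'n ^ 'q"
  assumes "\<And>u v. Ck_lim F l (\<lambda>i t. A i t $ u $ v) (\<lambda>t. A0 t $ u $ v)"
  obtains L where "0 \<le> L" "\<forall>\<^sub>F i in F. \<forall>t\<in>{a..b}. \<forall>v. norm (A i t *v v) \<le> L * norm v"
proof -
  have "\<exists>c. \<forall>t\<in>{a..b}. cmod (A0 t $ u $ v) \<le> c" for u v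
    using assms[of u v] Ck_imp_bounded[of l "\<lambda>t. A0 t $ u $ v"]
    by (auto simp: Ck_lim_def bounded_iff)
  then obtain c where c: "\<And>u v t. t \<in> {a..b} \<Longrightarrow> cmod (A0 t $ u $ v) \<le> c u v" by metis
  define L where "L = (\<Sum>u\<in>UNIV. \<Sum>v\<in>UNIV. \<bar>c u v\<bar> + 1)"
  have "0 \<le> L" unfolding L_def by (intro sum_nonneg) auto
  have "\<forall>\<^sub>F i in F. \<forall>u v. \<forall>t\<in>{a..b}. dist (A i t $ u $ v) (A0 t $ u $ v) < 1"
    using uniform_limitD[OF Ck_lim_uniform_limit[OF assms], of 1]
    by (simp add: eventually_all_finite)
  then have "\<forall>\<^sub>F i in F. \<forall>t\<in>{a..b}. \<forall>v. norm (A i t *v v) \<le> L * norm v"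
  proof eventually_elim
    case (elim i)
    show ?case
    proof (intro ballI allI)
      fix t and v :: "complex ^ 'n" assume t: "t \<in> {a..b}"
      have "cmod (A i t $ u $ w) \<le> \<bar>c u w\<bar> + 1" for u w
      proof -
        have "cmod (A i t $ u $ w - A0 t $ u $ w) < 1"
          using elim t by (simp add: dist_norm)
        then show ?thesis
          using c[OF t, of u w] norm_triangle_sub[of "A i t $ u $ w" "A0 t $ u $ w"] by linarith
      qed
      then have "(\<Sum>u\<in>UNIV. \<Sum>w\<in>UNIV. cmod (A i t $ u $ w)) \<le> L"
        unfolding L_def by (intro sum_mono) auto
      then have "(\<Sum>u\<in>UNIV. \<Sum>w\<in>UNIV. cmod (A i t $ u $ w)) * norm v \<le> L * norm v"
        by (intro mult_right_mono) auto
      with norm_matrix_vector_le[of "A i t" v] show "norm (A i t *v v) \<le> L * norm v" by linarith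
    qed
  qed
  with \<open>0 \<le> L\<close> show ?thesis using that by blast
qed

lemma matrix_bound:
  fixes A :: "real \<Rightarrow> complex ^ 'n ^ 'q"
  assumes "\<And>u v. Ck l (\<lambda>t. A t $ u $ v)"
  obtains L where "0 \<le> L" "\<And>t v. t \<in> {a..b} \<Longrightarrow> norm (A t *v v) \<le> L * norm v"
proof -
  obtain L where "0 \<le> L"
    "\<forall>\<^sub>F i in at_right (0::real). \<forall>t\<in>{a..b}. \<forall>v. norm (A t *v v) \<le> L * norm v"
    using eventually_matrix_bound[OF Ck_lim_const[OF assms]] by blast
  then show ?thesis using that by (simp add: eventually_const_iff)
qed

lemma linear_ode_exists:
  fixes A :: "real \<Rightarrow> complex ^ 'n ^ 'n"
  assumes A: "\<And>u v. Ck 0 (\<lambda>t. A t $ u $ v)" and g: "Ck 0 g"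
  obtains x where "x a = c"
    "\<And>t. t \<in> {a..b} \<Longrightarrow> (x has_vector_derivative A t *v x t + g t) (at t within {a..b})"
proof -
  obtain L where L: "0 \<le> L" "\<And>t v. t \<in> {a..b} \<Longrightarrow> norm (A t *v v) \<le> L * norm v"
    using matrix_bound[OF A] by blast
  have "Ck 0 (\<lambda>t. A t *v y t + g t)" if "Ck 0 y" for y
    using A g that unfolding Ck_iff_Ck_lim by (intro Ck_lim_add Ck_lim_matrix_vector_mult)
  then have cont: "continuous_on {a..b} (\<lambda>t. A t *v y t + g t)" if "continuous_on {a..b} y" for y
    using that unfolding Ck_0 .
  have lip: "norm (A t *v v + g t - (A t *v w + g t)) \<le> L * norm (v - w)" if "t \<in> {a..b}" for t v w
    using L(2)[OF that, of "v - w"] by (simp add: matrix_vector_mult_diff_distrib)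
  show ?thesis
    using picard_lindeloef_global[OF less_imp_le[OF a_less_b] cont lip L(1), of c] that by blast
qed

lemma linear_ode_vanishing:
  fixes A :: "real \<Rightarrow> complex ^ 'n ^ 'n"
  assumes A: "\<And>u v. Ck l (\<lambda>t. A t $ u $ v)"
    and "\<And>t. t \<in> {a..b} \<Longrightarrow> (x has_vector_derivative A t *v x t) (at t within {a..b})"
    and "s \<in> {a..b}" "x s = 0" "t \<in> {a..b}"
  shows "x t = 0"
proof -
  obtain L where L: "0 \<le> L" "\<And>t v. t \<in> {a..b} \<Longrightarrow> norm (A t *v v) \<le> L * norm v"
    using matrix_bound[OF A] by blast
  show ?thesis
    using vanishing_at_a_point[OF assms(2) L(2) L(1) assms(3-5)] .
qed

text \<open>
  The difference \<open>X i - x\<close> solves the homogeneous system of the family up to a uniformly small error, so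
  \<open>differential_inequality\<close> gives uniform convergence. The equation itself then gains one
  derivative at a time, up to one more than the coefficients have.
\<close>

lemma linear_ode_limit:
  fixes A :: "'i \<Rightarrow> real \<Rightarrow> complex ^ 'n ^ 'n"
  assumes A: "\<And>u v. Ck_lim F l (\<lambda>i t. A i t $ u $ v) (\<lambda>t. A0 t $ u $ v)"
    and g: "Ck_lim F l g g0"
    and X: "\<forall>\<^sub>F i in F. \<forall>t\<in>{a..b}. (X i has_vector_derivative A i t *v X i t + g i t) (at t within {a..b})"
    and x: "\<And>t. t \<in> {a..b} \<Longrightarrow> (x has_vector_derivative A0 t *v x t + g0 t) (at t within {a..b})"
    and init: "((\<lambda>i. X i a) \<longlongrightarrow> x a) F"
  shows "Ck_lim F (Suc l) X x"
proof -
  obtain L where L: "0 \<le> L" "\<forall>\<^sub>F i in F. \<forall>t\<in>{a..b}. \<forall>v. norm (A i t *v v) \<le> L * norm v"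
    using eventually_matrix_bound[OF A] by blast
  have contI: "continuous_on {a..b} y"
    if "\<And>t. t \<in> {a..b} \<Longrightarrow> (y has_vector_derivative h t) (at t within {a..b})"
    for y h :: "real \<Rightarrow> complex ^ 'n"
    using that by (meson continuous_on_eq_continuous_within has_vector_derivative_continuous)
  have cx: "continuous_on {a..b} x" using x by (rule contI)
  have uni: "uniform_limit {a..b} X x F"
  proof (rule uniform_limitI)
    fix e :: real assume "e > 0"
    define C where "C = exp ((2 * L + 1) * (b - a)) * (1 + (b - a))"
    have C: "C > 0" using a_less_b by (simp add: C_def)
    \<comment> \<open>A common bound for the initial error and the defect: it makes the final bound \<open>C * G\<^sup>2\<close> less than \<open>e\<^sup>2\<close>.\<close>
    define G where "G = e / (1 + C)"
    have G: "G > 0" "C * G\<^sup>2 < e\<^sup>2"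
    proof -
      show "G > 0" using \<open>e > 0\<close> C by (simp add: G_def)
      have "C * 1 < (1 + C) * (1 + C)" using C by (intro mult_strict_mono) auto
      then have "C / (1 + C)\<^sup>2 < 1" using C by (simp add: power2_eq_square)
      then have "e\<^sup>2 * (C / (1 + C)\<^sup>2) < e\<^sup>2 * 1"
        using \<open>e > 0\<close> by (intro mult_strict_left_mono) auto
      then show "C * G\<^sup>2 < e\<^sup>2" by (simp add: G_def power_divide mult.commute)
    qed
    have "Ck_lim F 0 (\<lambda>i t. A i t *v x t + g i t) (\<lambda>t. A0 t *v x t + g0 t)"
      using A g cx by (intro Ck_lim_add Ck_lim_matrix_vector_mult Ck_lim_const)
        (auto simp: Ck_0 intro: Ck_lim_mono)
    from uniform_limitD[OF Ck_lim_uniform_limit[OF this] G(1)]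
    have "\<forall>\<^sub>F i in F. \<forall>t\<in>{a..b}. norm (A i t *v x t + g i t - (A0 t *v x t + g0 t)) < G"
      by (simp add: dist_norm)
    moreover have "\<forall>\<^sub>F i in F. norm (X i a - x a) < G"
      using tendstoD[OF init G(1)] by (simp add: dist_norm)
    ultimately show "\<forall>\<^sub>F i in F. \<forall>t\<in>{a..b}. dist (X i t) (x t) < e"
      using L(2) X
    proof eventually_elim
      case (elim i)
      show ?case
      proof
        fix t assume t: "t \<in> {a..b}"
        define h where "h s = A i s *v X i s + g i s - (A0 s *v x s + g0 s)" for s
        have "(norm (X i t - x t))\<^sup>2 \<le>
            exp ((2 * L + 1) * (t - a)) * ((norm (X i a - x a))\<^sup>2 + G\<^sup>2 * (t - a))"
        proof (rule differential_inequality[where x = "\<lambda>s. X i s - x s" and h = h and \<beta> = b])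
          show "((\<lambda>s. X i s - x s) has_vector_derivative h s) (at s within {a..b})"
            if "s \<in> {a..b}" for s
            unfolding h_def using elim(4) x that by (intro has_vector_derivative_diff) auto
          show "norm (h s) \<le> L * norm (X i s - x s) + G" if s: "s \<in> {a..b}" for s
          proof -
            have "h s = A i s *v (X i s - x s) + (A i s *v x s + g i s - (A0 s *v x s + g0 s))"
              by (simp add: h_def matrix_vector_mult_diff_distrib)
            also have "norm \<dots> \<le> norm (A i s *v (X i s - x s)) +
                norm (A i s *v x s + g i s - (A0 s *v x s + g0 s))"
              by (rule norm_triangle_ineq)
            also have "\<dots> \<le> L * norm (X i s - x s) + G"
              using elim(1,3) s by (intro add_mono) (auto intro: less_imp_le)
            finally show ?thesis .
          qed
        qed (use L G t in auto)
        also have "\<dots> \<le> exp ((2 * L + 1) * (b - a)) * (G\<^sup>2 + G\<^sup>2 * (b - a))"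
        proof (rule mult_mono)
          show "exp ((2 * L + 1) * (t - a)) \<le> exp ((2 * L + 1) * (b - a))"
            using t L(1) by (simp add: mult_left_mono)
          have "(norm (X i a - x a))\<^sup>2 \<le> G\<^sup>2"
            using elim(2) by (intro power_mono) auto
          moreover have "G\<^sup>2 * (t - a) \<le> G\<^sup>2 * (b - a)"
            using t by (intro mult_left_mono) auto
          ultimately show "(norm (X i a - x a))\<^sup>2 + G\<^sup>2 * (t - a) \<le> G\<^sup>2 + G\<^sup>2 * (b - a)"
            by linarith
        qed (use t in auto)
        also have "\<dots> = C * G\<^sup>2" by (simp add: C_def algebra_simps)
        finally have "(norm (X i t - x t))\<^sup>2 < e\<^sup>2" using G(2) by simp
        then show "dist (X i t) (x t) < e"
          using \<open>e > 0\<close> by (simp add: dist_norm power2_less_imp_less)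
      qed
    qed
  qed
  have "k \<le> Suc l \<Longrightarrow> Ck_lim F k X x" for k
  proof (induction k)
    case 0
    have "\<forall>\<^sub>F i in F. continuous_on {a..b} (X i)"
      using X by eventually_elim (rule contI, erule bspec)
    then show ?case using uni cx by (simp add: Ck_lim_0)
  next
    case (Suc k)
    then have k: "k \<le> l" "Ck_lim F k X x" by auto
    have "Ck_lim F k (\<lambda>i t. A i t *v X i t + g i t) (\<lambda>t. A0 t *v x t + g0 t)"
      using k by (intro Ck_lim_add Ck_lim_matrix_vector_mult Ck_lim_mono[OF A] Ck_lim_mono[OF g])
    with uni X x show ?case
      by (rule Ck_lim_SucI[where Y = "\<lambda>i t. A i t *v X i t + g i t" and y = "\<lambda>t. A0 t *v x t + g0 t"])
  qed
  then show ?thesis by blast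
qed

end

section \<open>Reduction of the equation to a first order system\<close>

text \<open>
  The components of the derivatives of order below \<open>r\<close> are listed by the index type of the boundary
  values: the index \<open>k\<close> stands for component \<open>s k\<close> of the derivative of order \<open>p k\<close>.
  The matrix of boundary values of a fundamental system is then literally a square matrix.
\<close>

locale jets = segment a b for a b :: real +
  fixes r :: nat and p :: "'k::finite \<Rightarrow> nat" and s :: "'k \<Rightarrow> 'm::finite"
  assumes r_pos: "r \<ge> 1"
    and bij: "bij_betw (\<lambda>k. (p k, s k)) UNIV ({..<r} \<times> UNIV)"
begin

definition idx :: "nat \<Rightarrow> 'm \<Rightarrow> 'k" where
  "idx j i = inv_into UNIV (\<lambda>k. (p k, s k)) (j, i)"

definition jet :: "(real \<Rightarrow> complex ^ 'm) \<Rightarrow> real \<Rightarrow> complex ^ 'k" where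
  "jet z t = (\<chi> k. deriv_on a b (p k) z t $ s k)"

definition companion :: "(nat \<Rightarrow> real \<Rightarrow> complex ^ 'm ^ 'm) \<Rightarrow> real \<Rightarrow> complex ^ 'k ^ 'k" where
  "companion Q t = (\<chi> k l. if Suc (p k) < r then (if l = idx (Suc (p k)) (s k) then 1 else 0)
     else - (Q (p l) t $ s k $ s l))"

definition source :: "(real \<Rightarrow> complex ^ 'm) \<Rightarrow> real \<Rightarrow> complex ^ 'k" where
  "source f t = (\<chi> k. if Suc (p k) < r then 0 else f t $ s k)"

lemma p_less: "p k < r"
  using bij_betwE[OF bij] by auto

lemma idx_p_s: "idx (p k) (s k) = k"
  unfolding idx_def using bij_betw_inv_into_left[OF bij, of k] by simp

lemma p_s_idx:
  assumes "j < r"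
  shows "p (idx j i) = j" "s (idx j i) = i"
  unfolding idx_def using bij_betw_inv_into_right[OF bij, of "(j, i)"] assms by auto

lemma sum_jets: "(\<Sum>k\<in>UNIV. \<phi> (p k) (s k)) = (\<Sum>j<r. \<Sum>i\<in>UNIV. \<phi> j i)"
proof -
  have "(\<Sum>k\<in>UNIV. \<phi> (p k) (s k)) = (\<Sum>(j, i)\<in>{..<r} \<times> UNIV. \<phi> j i)"
    using sum.reindex_bij_betw[OF bij, of "\<lambda>(j, i). \<phi> j i"] by simp
  then show ?thesis by (simp add: sum.cartesian_product)
qed

lemma L_op_nth:
  "L_op a b r K \<epsilon> z t $ i =
     deriv_on a b r z t $ i + (\<Sum>l\<in>UNIV. K (p l) \<epsilon> t $ i $ s l * jet z t $ l)"
proof -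
  have "(\<Sum>j = 1..r. K (r - j) \<epsilon> t *v deriv_on a b (r - j) z t) =
      (\<Sum>j<r. K j \<epsilon> t *v deriv_on a b j z t)"
    by (rule sum.reindex_bij_witness[of _ "\<lambda>j. r - j" "\<lambda>j. r - j"]) auto
  then have "L_op a b r K \<epsilon> z t $ i = deriv_on a b r z t $ i +
      (\<Sum>j<r. \<Sum>i'\<in>UNIV. K j \<epsilon> t $ i $ i' * deriv_on a b j z t $ i')"
    by (simp add: L_op_def matrix_vector_mult_def)
  then show ?thesis
    using sum_jets[of "\<lambda>j i'. K j \<epsilon> t $ i $ i' * deriv_on a b j z t $ i'"] by (simp add: jet_def)
qed

lemma companion_mult_nth:
  "(companion Q t *v x) $ k = (if Suc (p k) < r then x $ idx (Suc (p k)) (s k)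
     else - (\<Sum>l\<in>UNIV. Q (p l) t $ s k $ s l * x $ l))"
  by (simp add: companion_def matrix_vector_mult_def sum_negf if_distrib[of "\<lambda>c. c * _"] cong: if_cong)

lemma jet_ode:
  assumes "Ck r z" "t \<in> {a..b}"
  shows "(jet z has_vector_derivative companion (\<lambda>i. K i \<epsilon>) t *v jet z t + source (L_op a b r K \<epsilon> z) t)
    (at t within {a..b})"
  unfolding has_vector_derivative_vec_iff
proof
  fix k
  have "((\<lambda>t. deriv_on a b (p k) z t $ s k) has_vector_derivative deriv_on a b (Suc (p k)) z t $ s k)
      (at t within {a..b})"
    using has_vector_derivative_deriv_on[OF assms(1) p_less assms(2), of k]
    unfolding has_vector_derivative_vec_iff by blast
  moreover have "deriv_on a b (Suc (p k)) z t $ s k =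
      (companion (\<lambda>i. K i \<epsilon>) t *v jet z t + source (L_op a b r K \<epsilon> z) t) $ k"
  proof (cases "Suc (p k) < r")
    case True
    then show ?thesis
      by (simp add: companion_mult_nth source_def jet_def p_s_idx del: deriv_on.simps)
  next
    case False
    then have "Suc (p k) = r" using p_less[of k] by simp
    then show ?thesis
      by (simp add: companion_mult_nth source_def L_op_nth del: deriv_on.simps)
  qed
  ultimately show "((\<lambda>t. jet z t $ k) has_vector_derivative
      (companion (\<lambda>i. K i \<epsilon>) t *v jet z t + source (L_op a b r K \<epsilon> z) t) $ k) (at t within {a..b})"
    by (simp add: jet_def)
qed

lemma Ck_lim_companion:
  assumes "\<And>i u v. i < r \<Longrightarrow> Ck_lim F l (\<lambda>\<epsilon> t. Q \<epsilon> i t $ u $ v) (\<lambda>t. Q0 i t $ u $ v)"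
  shows "Ck_lim F l (\<lambda>\<epsilon> t. companion (Q \<epsilon>) t $ u $ v) (\<lambda>t. companion Q0 t $ u $ v)"
  by (cases "Suc (p u) < r")
    (auto simp: companion_def intro!: Ck_lim_minus assms p_less Ck_lim_value)

lemma Ck_lim_source:
  assumes "Ck_lim F l f f0"
  shows "Ck_lim F l (\<lambda>\<epsilon>. source (f \<epsilon>)) (source f0)"
  unfolding Ck_lim_vec_iff
proof
  fix k
  show "Ck_lim F l (\<lambda>\<epsilon> t. source (f \<epsilon>) t $ k) (\<lambda>t. source f0 t $ k)"
    using assms by (cases "Suc (p k) < r") (auto simp: source_def Ck_lim_vec_iff intro!: Ck_lim_value)
qed

text \<open>
  Convergence of the jets in class \<open>n + 1\<close> gives convergence of the derivative of order
  \<open>r - 1\<close> in that class; each antiderivative adds one more. The parameter map \<open>\<omega>\<close> admits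
  constant families, which is how \<open>solution_smooth\<close> follows.
\<close>

lemma solution_limit:
  assumes K: "\<And>i u v. i < r \<Longrightarrow> Ck_lim F n (\<lambda>\<epsilon> t. K i (\<omega> \<epsilon>) t $ u $ v) (\<lambda>t. K i \<omega>0 t $ u $ v)"
    and Z: "\<forall>\<^sub>F \<epsilon> in F. Ck r (Z \<epsilon>)" and z: "Ck r z"
    and L: "Ck_lim F n (\<lambda>\<epsilon>. L_op a b r K (\<omega> \<epsilon>) (Z \<epsilon>)) (L_op a b r K \<omega>0 z)"
    and init: "((\<lambda>\<epsilon>. jet (Z \<epsilon>) a) \<longlongrightarrow> jet z a) F"
  shows "Ck_lim F (n + r) Z z"
proof -
  have "Ck_lim F (Suc n) (\<lambda>\<epsilon>. jet (Z \<epsilon>)) (jet z)"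
  proof (rule linear_ode_limit[where A = "\<lambda>\<epsilon>. companion (\<lambda>i. K i (\<omega> \<epsilon>))"
        and g = "\<lambda>\<epsilon>. source (L_op a b r K (\<omega> \<epsilon>) (Z \<epsilon>))"
        and ?A0.0 = "companion (\<lambda>i. K i \<omega>0)" and ?g0.0 = "source (L_op a b r K \<omega>0 z)"])
    show "Ck_lim F n (\<lambda>\<epsilon>. source (L_op a b r K (\<omega> \<epsilon>) (Z \<epsilon>))) (source (L_op a b r K \<omega>0 z))"
      by (rule Ck_lim_source[OF L])
    show "((\<lambda>\<epsilon>. jet (Z \<epsilon>) a) \<longlongrightarrow> jet z a) F" by (rule init)
    show "Ck_lim F n (\<lambda>\<epsilon> t. companion (\<lambda>i. K i (\<omega> \<epsilon>)) t $ u $ v)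
        (\<lambda>t. companion (\<lambda>i. K i \<omega>0) t $ u $ v)" for u v
      by (rule Ck_lim_companion) (rule K)
    show "\<forall>\<^sub>F \<epsilon> in F. \<forall>t\<in>{a..b}. (jet (Z \<epsilon>) has_vector_derivative
        companion (\<lambda>i. K i (\<omega> \<epsilon>)) t *v jet (Z \<epsilon>) t + source (L_op a b r K (\<omega> \<epsilon>) (Z \<epsilon>)) t)
        (at t within {a..b})"
      using Z by eventually_elim (blast intro: jet_ode)
  qed (rule jet_ode[OF z])
  then have J: "Ck_lim F (Suc n) (\<lambda>\<epsilon> t. jet (Z \<epsilon>) t $ idx j u) (\<lambda>t. jet z t $ idx j u)" for j u
    unfolding Ck_lim_vec_iff by blast
  have D: "Ck_lim F (Suc n) (\<lambda>\<epsilon>. deriv_on a b j (Z \<epsilon>)) (deriv_on a b j z)" if "j < r" for j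
    unfolding Ck_lim_vec_iff using J[of j] by (simp add: jet_def p_s_idx[OF that])
  have "j < r \<Longrightarrow> Ck_lim F (Suc n + j) (\<lambda>\<epsilon>. deriv_on a b (r - 1 - j) (Z \<epsilon>)) (deriv_on a b (r - 1 - j) z)"
    for j
  proof (induction j)
    case 0
    then show ?case using D[of "r - 1"] by simp
  next
    case (Suc j)
    define k where "k = r - 1 - Suc j"
    have k: "Suc k = r - 1 - j" "k < r" using Suc.prems by (auto simp: k_def)
    have "Ck_lim F (Suc (Suc n + j)) (\<lambda>\<epsilon>. deriv_on a b k (Z \<epsilon>)) (deriv_on a b k z)"
    proof (rule Ck_lim_SucI)
      show "uniform_limit {a..b} (\<lambda>\<epsilon>. deriv_on a b k (Z \<epsilon>)) (deriv_on a b k z) F"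
        by (rule Ck_lim_uniform_limit[OF D[OF k(2)]])
      show "\<forall>\<^sub>F \<epsilon> in F. \<forall>t\<in>{a..b}. (deriv_on a b k (Z \<epsilon>) has_vector_derivative
          deriv_on a b (Suc k) (Z \<epsilon>) t) (at t within {a..b})"
        using Z by eventually_elim (blast intro: has_vector_derivative_deriv_on k)
      show "(deriv_on a b k z has_vector_derivative deriv_on a b (Suc k) z t) (at t within {a..b})"
        if "t \<in> {a..b}" for t
        using has_vector_derivative_deriv_on[OF z k(2) that] .
      show "Ck_lim F (Suc n + j) (\<lambda>\<epsilon>. deriv_on a b (Suc k) (Z \<epsilon>)) (deriv_on a b (Suc k) z)"
        using Suc by (simp add: k(1) del: deriv_on.simps)
    qed
    then show ?case by (simp add: k_def del: deriv_on.simps)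
  qed
  from this[of "r - 1"] show ?thesis using r_pos by simp
qed

lemma solution_smooth:
  fixes z :: "real \<Rightarrow> complex ^ 'm"
  assumes "\<And>i u v. i < r \<Longrightarrow> Ck n (\<lambda>t. K i \<epsilon> t $ u $ v)"
    and "Ck r z" "Ck n (L_op a b r K \<epsilon> z)"
  shows "Ck (n + r) z"
  using assms solution_limit[where \<omega> = "\<lambda>_. \<epsilon>" and ?\<omega>0.0 = \<epsilon> and Z = "\<lambda>_. z" and z = z and K = K
      and F = "at_right (0::real)" and n = n]
  by (simp add: Ck_iff_Ck_lim[of n] Ck_iff_Ck_lim[of "n + r"])

lemma initial_value_problem:
  assumes K: "\<And>i u v. i < r \<Longrightarrow> Ck n (\<lambda>t. K i \<epsilon> t $ u $ v)" and f: "Ck n f"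
  obtains z where "z \<in> Cvec_space a b (n + r)" "\<And>t. t \<in> {a..b} \<Longrightarrow> L_op a b r K \<epsilon> z t = f t"
    "jet z a = c"
proof -
  let ?A = "companion (\<lambda>i. K i \<epsilon>)"
  have A: "Ck n (\<lambda>t. ?A t $ u $ v)" for u v
    using K unfolding Ck_iff_Ck_lim by (rule Ck_lim_companion)
  have src: "Ck n (source f)"
    using f unfolding Ck_iff_Ck_lim by (rule Ck_lim_source)
  obtain x where x: "x a = c"
    "\<And>t. t \<in> {a..b} \<Longrightarrow> (x has_vector_derivative ?A t *v x t + source f t) (at t within {a..b})"
    using linear_ode_exists[OF Ck_mono[OF A] Ck_mono[OF src]] by blast
  define y where "y j t = (\<chi> i. x t $ idx j i)" for j t
  have dy: "(y j has_vector_derivative y (Suc j) t) (at t within {a..b})"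
    if "Suc j < r" "t \<in> {a..b}" for j t
    unfolding has_vector_derivative_vec_iff
  proof
    fix i
    have "((\<lambda>t. x t $ idx j i) has_vector_derivative
        (?A t *v x t + source f t) $ idx j i) (at t within {a..b})"
      using x(2)[OF that(2)] unfolding has_vector_derivative_vec_iff by blast
    then show "((\<lambda>t. y j t $ i) has_vector_derivative y (Suc j) t $ i) (at t within {a..b})"
      using that(1) p_s_idx[of j i] by (simp add: y_def companion_mult_nth source_def)
  qed
  define w where "w t = (\<chi> i. f t $ i - (\<Sum>l\<in>UNIV. K (p l) \<epsilon> t $ i $ s l * x t $ l))" for t
  have dw: "(y (r - 1) has_vector_derivative w t) (at t within {a..b})" if "t \<in> {a..b}" for t
    unfolding has_vector_derivative_vec_iff
  proof
    fix i
    have "((\<lambda>t. x t $ idx (r - 1) i) has_vector_derivative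
        (?A t *v x t + source f t) $ idx (r - 1) i) (at t within {a..b})"
      using x(2)[OF that] unfolding has_vector_derivative_vec_iff by blast
    then show "((\<lambda>t. y (r - 1) t $ i) has_vector_derivative w t $ i) (at t within {a..b})"
      using r_pos by (simp add: y_def w_def companion_mult_nth source_def p_s_idx)
  qed
  have cx: "Ck 0 (\<lambda>t. x t $ l)" for l
  proof -
    have "continuous_on {a..b} x"
      using x(2) by (meson continuous_on_eq_continuous_within has_vector_derivative_continuous)
    then show ?thesis by (simp add: Ck_0 continuous_on_component)
  qed
  have "Ck 0 (\<lambda>t. f t $ i - (\<Sum>l\<in>UNIV. K (p l) \<epsilon> t $ i $ s l * x t $ l))" for i
    using cx Ck_mono[OF K[OF p_less], of 0] Ck_mono[OF f, of 0]
    unfolding Ck_vec_iff[of 0 f] unfolding Ck_iff_Ck_lim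
    by (intro Ck_lim_diff Ck_lim_sum Ck_lim_mult) auto
  then have w: "Ck 0 w" by (simp add: Ck_vec_iff w_def)
  have "j < r \<Longrightarrow> Ck (Suc j) (y (r - 1 - j))" for j
  proof (induction j)
    case 0
    then show ?case using Ck_SucI[OF dw w] by simp
  next
    case (Suc j)
    define k where "k = r - 1 - Suc j"
    have k: "Suc k = r - 1 - j" "Suc k < r" using Suc.prems by (auto simp: k_def)
    have "Ck (Suc (Suc j)) (y k)"
      by (rule Ck_SucI[OF dy[OF k(2)]]) (use Suc k in simp_all)
    then show ?case by (simp add: k_def)
  qed
  from this[of "r - 1"] have y0: "Ck r (y 0)" using r_pos by simp
  have Dy: "j < r \<Longrightarrow> t \<in> {a..b} \<Longrightarrow> deriv_on a b j (y 0) t = y j t" for j t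
  proof (induction j arbitrary: t)
    case (Suc j)
    have "(y j has_vector_derivative y (Suc j) t) (at t within {a..b})"
      by (rule dy[OF Suc.prems])
    then have "(deriv_on a b j (y 0) has_vector_derivative y (Suc j) t) (at t within {a..b})"
      by (rule has_vector_derivative_transform[rotated 2]) (use Suc in auto)
    then show ?case using vector_derivative_segment[OF Suc.prems(2)] by simp
  qed simp
  have Dr: "deriv_on a b r (y 0) t = w t" if t: "t \<in> {a..b}" for t
  proof -
    have "(deriv_on a b (r - 1) (y 0) has_vector_derivative w t) (at t within {a..b})"
      by (rule has_vector_derivative_transform[rotated 2, OF dw[OF t]]) (use t Dy r_pos in auto)
    then have "deriv_on a b (Suc (r - 1)) (y 0) t = w t"
      using vector_derivative_segment[OF t] by simp
    then show ?thesis using r_pos by simp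
  qed
  define z where "z = extend_zero (y 0)"
  have Dz: "deriv_on a b j z t = deriv_on a b j (y 0) t" if "t \<in> {a..b}" for j t
    using that unfolding z_def by (intro deriv_on_cong) (auto simp: extend_zero_def)
  have jet: "jet z t = x t" if "t \<in> {a..b}" for t
    using that by (simp add: jet_def vec_eq_iff Dz Dy p_less y_def idx_p_s)
  have L: "L_op a b r K \<epsilon> z t = f t" if "t \<in> {a..b}" for t
    using that by (simp add: vec_eq_iff L_op_nth jet Dz Dr w_def)
  have "Ck r z" using y0 by (simp add: z_def Ck_extend_zero)
  moreover have "Ck n (L_op a b r K \<epsilon> z)"
    using f Ck_cong[of "L_op a b r K \<epsilon> z" f] L by blast
  ultimately have "Ck (n + r) z" using solution_smooth[of n K \<epsilon> z] K by blast
  then have "z \<in> Cvec_space a b (n + r)"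
    using extend_zero_in_Cvec_space[of "n + r" "y 0"] by (simp add: z_def Ck_extend_zero)
  moreover have "jet z a = c" using jet[of a] a_less_b x(1) by simp
  ultimately show ?thesis using L that by blast
qed

text \<open>
  The point where the jet vanishes may be any point of the segment. This is what makes the jet matrix of
  an arbitrary basis of solutions invertible everywhere.
\<close>

lemma homogeneous_solution_vanishing:
  assumes K: "\<And>i u v. i < r \<Longrightarrow> Ck n (\<lambda>t. K i \<epsilon> t $ u $ v)"
    and z: "Ck r z" "\<And>t. t \<in> {a..b} \<Longrightarrow> L_op a b r K \<epsilon> z t = 0"
    and t0: "t0 \<in> {a..b}" "jet z t0 = 0" and t: "t \<in> {a..b}"
  shows "z t = 0"
proof -
  have A: "Ck n (\<lambda>t. companion (\<lambda>i. K i \<epsilon>) t $ u $ v)" for u v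
    using K unfolding Ck_iff_Ck_lim by (rule Ck_lim_companion)
  have "jet z t = 0"
  proof (rule linear_ode_vanishing[where A = "companion (\<lambda>i. K i \<epsilon>)" and x = "jet z", OF A _ t0 t])
    show "(jet z has_vector_derivative companion (\<lambda>i. K i \<epsilon>) t *v jet z t) (at t within {a..b})"
      if "t \<in> {a..b}" for t
    proof -
      have "source (L_op a b r K \<epsilon> z) t = 0"
        using z(2)[OF that] by (simp add: source_def vec_eq_iff)
      then show ?thesis using jet_ode[OF z(1) that, of K \<epsilon>] by simp
    qed
  qed
  then have "deriv_on a b (p k) z t $ s k = 0" for k
    by (simp add: jet_def vec_eq_iff)
  from this[of "idx 0 i" for i] show ?thesis
    using r_pos by (simp add: p_s_idx vec_eq_iff)
qed

end

section \<open>Linear functionals of the solution\<close>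

lemma bounded_linear_scale: "bounded_linear (\<lambda>v :: complex ^ 'n. c *s v)"
proof (rule bounded_linear_intro[where K = "cmod c"])
  show "norm (c *s v) \<le> norm v * cmod c" for v :: "complex ^ 'n"
    by (simp add: norm_vec_def norm_mult L2_set_right_distrib[symmetric] mult.commute)
qed (auto simp: vec_eq_iff algebra_simps)

context segment
begin

text \<open>
  Boundary operators, the differential expression at a point and the jet at a point all have this
  property, so their values on combinations of solutions are computed by one lemma.
\<close>

definition linear_on_Cvec :: "nat \<Rightarrow> ((real \<Rightarrow> complex ^ 'm) \<Rightarrow> complex ^ 'q) \<Rightarrow> bool" where
  "linear_on_Cvec l T \<longleftrightarrow>
     (\<forall>x\<in>Cvec_space a b l. \<forall>y\<in>Cvec_space a b l. T (\<lambda>t. x t + y t) = T x + T y) \<and>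
     (\<forall>c. \<forall>x\<in>Cvec_space a b l. T (\<lambda>t. c *s x t) = c *s T x)"

lemma Cvec_space_zero: "(\<lambda>t. 0) \<in> Cvec_space a b l"
  unfolding Cvec_space_iff Ck_iff_Ck_lim by (simp add: Ck_lim_zero)

lemma Cvec_space_add:
  "x \<in> Cvec_space a b l \<Longrightarrow> y \<in> Cvec_space a b l \<Longrightarrow> (\<lambda>t. x t + y t) \<in> Cvec_space a b l"
  unfolding Cvec_space_iff Ck_iff_Ck_lim by (simp add: Ck_lim_add)

lemma Cvec_space_scale: "x \<in> Cvec_space a b l \<Longrightarrow> (\<lambda>t. c *s x t) \<in> Cvec_space a b l"
  unfolding Cvec_space_iff Ck_iff_Ck_lim
  using Ck_lim_linear[OF bounded_linear_scale, of "at_right (0::real)" l "\<lambda>_. x" x c] by simp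

lemma Cvec_space_diff:
  "x \<in> Cvec_space a b l \<Longrightarrow> y \<in> Cvec_space a b l \<Longrightarrow> (\<lambda>t. x t - y t) \<in> Cvec_space a b l"
  unfolding Cvec_space_iff Ck_iff_Ck_lim by (simp add: Ck_lim_diff)

lemma Cvec_space_sum:
  "(\<And>k. V k \<in> Cvec_space a b l) \<Longrightarrow> (\<lambda>t. \<Sum>k\<in>S. c k *s V k t) \<in> Cvec_space a b l"
  by (induction S rule: infinite_finite_induct)
    (simp_all add: Cvec_space_zero Cvec_space_add Cvec_space_scale)

lemma linear_on_Cvec_add:
  "linear_on_Cvec l T \<Longrightarrow> x \<in> Cvec_space a b l \<Longrightarrow> y \<in> Cvec_space a b l \<Longrightarrow>
    T (\<lambda>t. x t + y t) = T x + T y"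
  unfolding linear_on_Cvec_def by blast

lemma linear_on_Cvec_scale:
  "linear_on_Cvec l T \<Longrightarrow> x \<in> Cvec_space a b l \<Longrightarrow> T (\<lambda>t. c *s x t) = c *s T x"
  unfolding linear_on_Cvec_def by blast

lemma linear_on_Cvec_zero:
  assumes "linear_on_Cvec l T"
  shows "T (\<lambda>t. 0) = 0"
proof -
  show ?thesis
    using linear_on_Cvec_scale[OF assms Cvec_space_zero, of 0] by simp
qed

lemma linear_on_Cvec_sum:
  assumes T: "linear_on_Cvec l T" and V: "\<And>k. V k \<in> Cvec_space a b l"
  shows "T (\<lambda>t. \<Sum>k\<in>S. c k *s V k t) = (\<Sum>k\<in>S. c k *s T (V k))"
proof (induction S rule: infinite_finite_induct)
  case (insert k S)
  then show ?case
    using linear_on_Cvec_add[OF T Cvec_space_scale[OF V, of "c k" k] Cvec_space_sum[of V l c S, OF V]]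
      linear_on_Cvec_scale[OF T V, of "c k" k] by simp
qed (simp_all add: linear_on_Cvec_zero[OF T])

lemma linear_on_Cvec_diff:
  assumes T: "linear_on_Cvec l T" and x: "x \<in> Cvec_space a b l" and y: "y \<in> Cvec_space a b l"
  shows "T (\<lambda>t. x t - y t) = T x - T y"
proof -
  show ?thesis
    using linear_on_Cvec_add[OF T Cvec_space_diff[OF x y] y] by simp
qed

lemma linear_on_Cvec_op: "continuous_linear_op a b l T \<Longrightarrow> linear_on_Cvec l T"
  unfolding linear_on_Cvec_def continuous_linear_op_def by blast

lemma linear_on_Cvec_deriv_on:
  assumes "j \<le> l" "t \<in> {a..b}"
  shows "linear_on_Cvec l (\<lambda>z. deriv_on a b j z t)"
  using assms
  by (simp add: linear_on_Cvec_def Cvec_space_iff deriv_on_plus[of l] deriv_on_linear[OF bounded_linear_scale, of l])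

lemma linear_on_Cvec_L_op:
  assumes "r \<le> l" "t \<in> {a..b}"
  shows "linear_on_Cvec l (\<lambda>z. L_op a b r K \<epsilon> z t)"
proof -
  have D: "linear_on_Cvec l (\<lambda>z. deriv_on a b j z t)" if "j \<le> r" for j
    using assms that by (intro linear_on_Cvec_deriv_on) auto
  note rules = linear_on_Cvec_add[OF D] linear_on_Cvec_scale[OF D]
  show ?thesis
    unfolding linear_on_Cvec_def L_op_def
    by (simp add: rules matrix_vector_right_distrib vector_scalar_commute sum.distrib vec.scale_right_distrib
        vec.scale_sum_right)
qed

end

lemma tendsto_cramer:
  fixes M :: "'i \<Rightarrow> complex ^ 'n ^ 'n"
  assumes M: "\<And>u v. ((\<lambda>i. M i $ u $ v) \<longlongrightarrow> M0 $ u $ v) F" "det M0 \<noteq> 0"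
    and y: "(y \<longlongrightarrow> y0) F"
    and eq: "\<forall>\<^sub>F i in F. M i *v x i = y i" "M0 *v x0 = y0"
  shows "(x \<longlongrightarrow> x0) F"
proof -
  interpret segment 0 1 by unfold_locales simp
  have "Ck_lim F 0 (\<lambda>i t. det (M i)) (\<lambda>t. det M0)"
    by (rule Ck_lim_det) (intro Ck_lim_value M)
  then have "((\<lambda>i. det (M i)) \<longlongrightarrow> det M0) F"
    using Ck_lim_valueD[of F 0 _ _ 0] by fastforce
  then have "\<forall>\<^sub>F i in F. det (M i) \<noteq> 0"
    using M(2) by (rule tendsto_imp_eventually_ne)
  then have ev: "\<forall>\<^sub>F i in F. \<forall>t\<in>{0..1::real}. det (M i) \<noteq> 0 \<and> M i *v x i = y i"
    using eq(1) by eventually_elim simp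
  have "Ck_lim F 0 (\<lambda>i t. x i $ u) (\<lambda>t. x0 $ u)" for u
  proof (rule Ck_lim_cramer[where A = "\<lambda>i t. M i" and ?A0.0 = "\<lambda>t. M0"
        and Y = "\<lambda>i t. y i" and y = "\<lambda>t. y0"])
    show "Ck_lim F 0 (\<lambda>i t. M i $ u $ v) (\<lambda>t. M0 $ u $ v)" for u v
      by (intro Ck_lim_value M)
    show "Ck_lim F 0 (\<lambda>i t. y i $ u) (\<lambda>t. y0 $ u)" for u
      by (intro Ck_lim_value tendsto_vec_nth y)
  qed (use M(2) ev eq(2) in simp_all)
  then have "((\<lambda>i. x i $ u) \<longlongrightarrow> x0 $ u) F" for u
    using Ck_lim_valueD[of F 0 _ _ 0] by fastforce
  then show ?thesis by (rule vec_tendstoI)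
qed

context jets
begin

lemma linear_on_Cvec_jet:
  assumes "r \<le> l" "t \<in> {a..b}"
  shows "linear_on_Cvec l (\<lambda>z. jet z t)"
proof -
  have D: "linear_on_Cvec l (\<lambda>z. deriv_on a b (p k) z t)" for k
    using assms p_less[of k] by (intro linear_on_Cvec_deriv_on) auto
  note rules = linear_on_Cvec_add[OF D] linear_on_Cvec_scale[OF D]
  show ?thesis
    unfolding linear_on_Cvec_def jet_def by (simp add: vec_eq_iff rules)
qed

lemma Ck_lim_jet:
  assumes "Ck_lim F (n + r) Z z"
  shows "Ck_lim F n (\<lambda>\<epsilon> t. jet (Z \<epsilon>) t $ k) (\<lambda>t. jet z t $ k)"
proof -
  have "Ck_lim F (n + p k) Z z"
    using Ck_lim_mono[OF assms] p_less[of k] by simp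
  then show ?thesis
    using Ck_lim_deriv_on[of F n "p k" Z z] by (simp add: jet_def Ck_lim_vec_iff)
qed

lemma tendsto_jet:
  assumes "Ck_lim F (n + r) Z z" "t \<in> {a..b}"
  shows "((\<lambda>\<epsilon>. jet (Z \<epsilon>) t) \<longlongrightarrow> jet z t) F"
  by (rule vec_tendstoI) (rule Ck_lim_valueD[OF Ck_lim_jet[OF assms(1)] assms(2)])

lemma Ck_lim_L_op:
  fixes z :: "real \<Rightarrow> complex ^ 'm"
  assumes K: "\<And>i u v. i < r \<Longrightarrow> Ck_lim F n (\<lambda>\<epsilon> t. K i (\<omega> \<epsilon>) t $ u $ v) (\<lambda>t. K i \<omega>0 t $ u $ v)"
    and z: "Ck (n + r) z"
  shows "Ck_lim F n (\<lambda>\<epsilon>. L_op a b r K (\<omega> \<epsilon>) z) (L_op a b r K \<omega>0 z)"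
proof -
  have D: "Ck_lim F n (\<lambda>\<epsilon> t. deriv_on a b r z t $ i) (\<lambda>t. deriv_on a b r z t $ i)" for i
    using Ck_lim_const[OF Ck_deriv_on[OF z], of F] unfolding Ck_lim_vec_iff by blast
  show ?thesis
    unfolding Ck_lim_vec_iff L_op_nth
    by (intro allI Ck_lim_add Ck_lim_sum Ck_lim_mult D K p_less Ck_lim_jet Ck_lim_const[OF z])
qed

end

section \<open>The boundary-value problem\<close>

locale bvp = jets a b r p s for a b :: real and r :: nat
    and p :: "'k::finite \<Rightarrow> nat" and s :: "'k \<Rightarrow> 'm::finite" +
  fixes n :: nat and \<epsilon>0 :: real and K :: "nat \<Rightarrow> real \<Rightarrow> real \<Rightarrow> complex ^ 'm ^ 'm"
    and B :: "real \<Rightarrow> (real \<Rightarrow> complex ^ 'm) \<Rightarrow> complex ^ 'k"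
  assumes \<epsilon>0_pos: "0 < \<epsilon>0"
    and K_smooth: "\<And>\<epsilon> i u v. \<epsilon> \<in> {0..<\<epsilon>0} \<Longrightarrow> i < r \<Longrightarrow> Ck n (\<lambda>t. K i \<epsilon> t $ u $ v)"
    and B_op: "\<And>\<epsilon>. \<epsilon> \<in> {0..<\<epsilon>0} \<Longrightarrow> continuous_linear_op a b (n + r) (B \<epsilon>)"
begin

definition coefficients_converge :: bool where
  "coefficients_converge \<longleftrightarrow> (\<forall>i<r. \<forall>u v.
     Ck_lim (at_right 0) n (\<lambda>\<epsilon> t. K i \<epsilon> t $ u $ v) (\<lambda>t. K i 0 t $ u $ v))"

definition operators_converge :: bool where
  "operators_converge \<longleftrightarrow>
     (\<forall>z\<in>Cvec_space a b (n + r). ((\<lambda>\<epsilon>. B \<epsilon> z) \<longlongrightarrow> B 0 z) (at_right 0))"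

definition limit_problem_injective :: bool where
  "limit_problem_injective \<longleftrightarrow> (\<forall>z\<in>Cvec_space a b (n + r).
     (\<forall>t\<in>{a..b}. L_op a b r K 0 z t = 0) \<and> B 0 z = 0 \<longrightarrow> z = (\<lambda>t. 0))"

lemma linear_B: "\<epsilon> \<in> {0..<\<epsilon>0} \<Longrightarrow> linear_on_Cvec (n + r) (B \<epsilon>)"
  by (rule linear_on_Cvec_op[OF B_op])

lemma linear_L: "t \<in> {a..b} \<Longrightarrow> linear_on_Cvec (n + r) (\<lambda>z. L_op a b r K \<epsilon> z t)"
  by (rule linear_on_Cvec_L_op) simp

lemma linear_jet: "t \<in> {a..b} \<Longrightarrow> linear_on_Cvec (n + r) (\<lambda>z. jet z t)"
  by (rule linear_on_Cvec_jet) simp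

lemma a_in: "a \<in> {a..b}"
  using a_less_b by simp

lemma eventually_parameter: "0 < \<delta> \<Longrightarrow> \<delta> \<le> \<epsilon>0 \<Longrightarrow> \<forall>\<^sub>F \<epsilon> in at_right 0. \<epsilon> \<in> {0..<\<delta>}"
  using eventually_at_right_real[of 0 \<delta>] by (auto elim!: eventually_mono)

lemma equation_cancel:
  assumes "\<epsilon> \<in> {0..<\<epsilon>0}" "z \<in> Cvec_space a b (n + r)" "w \<in> Cvec_space a b (n + r)"
    and "\<And>t. t \<in> {a..b} \<Longrightarrow> L_op a b r K \<epsilon> z t = L_op a b r K \<epsilon> w t"
    and "t0 \<in> {a..b}" "jet z t0 = jet w t0"
  shows "z = w"
proof -
  let ?h = "\<lambda>t. z t - w t"
  have h: "?h \<in> Cvec_space a b (n + r)" by (rule Cvec_space_diff[OF assms(2,3)])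
  have "Ck r ?h" using h Ck_mono[of "n + r" ?h r] by (simp add: Cvec_space_iff)
  moreover have "L_op a b r K \<epsilon> ?h t = 0" if "t \<in> {a..b}" for t
    using linear_on_Cvec_diff[OF linear_L[OF that] assms(2,3)] assms(4)[OF that] by simp
  moreover have "jet ?h t0 = 0"
    using linear_on_Cvec_diff[OF linear_jet[OF assms(5)] assms(2,3)] assms(6) by simp
  ultimately have "?h t = 0" if "t \<in> {a..b}" for t
    using homogeneous_solution_vanishing[where K = K and \<epsilon> = \<epsilon> and n = n and z = ?h and ?t0.0 = t0 and t = t]
      K_smooth[OF assms(1)] assms(5) that by blast
  then have "z t = w t" if "t \<in> {a..b}" for t using that by simp
  then show ?thesis using assms(2,3) by (fastforce simp: Cvec_space_iff)
qed

lemma equation_limit: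
  assumes coefficients_converge
    and Z: "\<forall>\<^sub>F \<epsilon> in at_right 0. Z \<epsilon> \<in> Cvec_space a b (n + r) \<and> (\<forall>t\<in>{a..b}. L_op a b r K \<epsilon> (Z \<epsilon>) t = f \<epsilon> t)"
    and z: "z \<in> Cvec_space a b (n + r)" "\<And>t. t \<in> {a..b} \<Longrightarrow> L_op a b r K 0 z t = f0 t"
    and f: "Ck_lim (at_right 0) n f f0"
    and init: "((\<lambda>\<epsilon>. jet (Z \<epsilon>) a) \<longlongrightarrow> jet z a) (at_right 0)"
  shows "Ck_lim (at_right 0) (n + r) Z z"
proof (rule solution_limit[where \<omega> = "\<lambda>\<epsilon>. \<epsilon>" and ?\<omega>0.0 = 0 and K = K])
  show "\<forall>\<^sub>F \<epsilon> in at_right 0. Ck r (Z \<epsilon>)"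
    using Z by eventually_elim (auto simp: Cvec_space_iff intro: Ck_mono)
  show "Ck r z" using z(1) by (auto simp: Cvec_space_iff intro: Ck_mono)
  have "\<forall>\<^sub>F \<epsilon> in at_right 0. \<forall>t\<in>{a..b}. L_op a b r K \<epsilon> (Z \<epsilon>) t = f \<epsilon> t"
    using Z by eventually_elim simp
  from Ck_lim_cong[OF this, of "L_op a b r K 0 z" f0 n]
  show "Ck_lim (at_right 0) n (\<lambda>\<epsilon>. L_op a b r K \<epsilon> (Z \<epsilon>)) (L_op a b r K 0 z)"
    using f z(2) by blast
qed (use assms(1) init in \<open>auto simp: coefficients_converge_def\<close>)

definition ivp :: "real \<Rightarrow> (real \<Rightarrow> complex ^ 'm) \<Rightarrow> complex ^ 'k \<Rightarrow> real \<Rightarrow> complex ^ 'm" where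
  "ivp \<epsilon> f c = (SOME z. z \<in> Cvec_space a b (n + r) \<and>
     (\<forall>t\<in>{a..b}. L_op a b r K \<epsilon> z t = f t) \<and> jet z a = c)"

lemma ivp:
  assumes "\<epsilon> \<in> {0..<\<epsilon>0}" "f \<in> Cvec_space a b n"
  shows "ivp \<epsilon> f c \<in> Cvec_space a b (n + r)"
    and "t \<in> {a..b} \<Longrightarrow> L_op a b r K \<epsilon> (ivp \<epsilon> f c) t = f t"
    and "jet (ivp \<epsilon> f c) a = c"
proof -
  have "Ck n f" using assms(2) by (simp add: Cvec_space_iff)
  obtain z where "z \<in> Cvec_space a b (n + r)" "\<And>t. t \<in> {a..b} \<Longrightarrow> L_op a b r K \<epsilon> z t = f t" "jet z a = c"
    by (rule initial_value_problem[where K = K and \<epsilon> = \<epsilon> and f = f and c = c,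
          OF K_smooth[OF assms(1)] \<open>Ck n f\<close>]) (assumption, rule that)
  then have "\<exists>z. z \<in> Cvec_space a b (n + r) \<and>
     (\<forall>t\<in>{a..b}. L_op a b r K \<epsilon> z t = f t) \<and> jet z a = c" by blast
  from someI_ex[OF this, folded ivp_def]
  show "ivp \<epsilon> f c \<in> Cvec_space a b (n + r)"
    and "t \<in> {a..b} \<Longrightarrow> L_op a b r K \<epsilon> (ivp \<epsilon> f c) t = f t"
    and "jet (ivp \<epsilon> f c) a = c" by blast+
qed

lemma ivp_limit:
  assumes coefficients_converge
    and f: "\<And>\<epsilon>. \<epsilon> \<in> {0..<\<epsilon>0} \<Longrightarrow> f \<epsilon> \<in> Cvec_space a b n" "Ck_lim (at_right 0) n f (f 0)"
  shows "Ck_lim (at_right 0) (n + r) (\<lambda>\<epsilon>. ivp \<epsilon> (f \<epsilon>) c) (ivp 0 (f 0) c)"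
proof (rule equation_limit[OF assms(1) _ _ _ f(2)])
  have 0: "(0::real) \<in> {0..<\<epsilon>0}" using \<epsilon>0_pos by simp
  have ev: "\<forall>\<^sub>F \<epsilon> in at_right 0. \<epsilon> \<in> {0..<\<epsilon>0}"
    using \<epsilon>0_pos by (intro eventually_parameter) auto
  show "\<forall>\<^sub>F \<epsilon> in at_right 0. ivp \<epsilon> (f \<epsilon>) c \<in> Cvec_space a b (n + r) \<and>
      (\<forall>t\<in>{a..b}. L_op a b r K \<epsilon> (ivp \<epsilon> (f \<epsilon>) c) t = f \<epsilon> t)"
    using ev by eventually_elim (blast intro: ivp f)
  show "ivp 0 (f 0) c \<in> Cvec_space a b (n + r)" by (rule ivp[OF 0 f(1)[OF 0]])
  show "L_op a b r K 0 (ivp 0 (f 0) c) t = f 0 t" if "t \<in> {a..b}" for t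
    by (rule ivp(2)[OF 0 f(1)[OF 0] that])
  have "\<forall>\<^sub>F \<epsilon> in at_right 0. c = jet (ivp \<epsilon> (f \<epsilon>) c) a"
    using ev by eventually_elim (simp add: ivp f)
  then show "((\<lambda>\<epsilon>. jet (ivp \<epsilon> (f \<epsilon>) c) a) \<longlongrightarrow> jet (ivp 0 (f 0) c) a) (at_right 0)"
    by (rule Lim_transform_eventually[rotated]) (simp add: ivp[OF 0 f(1)[OF 0]])
qed

definition fundamental :: "real \<Rightarrow> 'k \<Rightarrow> real \<Rightarrow> complex ^ 'm" where
  "fundamental \<epsilon> k = ivp \<epsilon> (\<lambda>t. 0) (axis k 1)"

definition combination :: "('k \<Rightarrow> real \<Rightarrow> complex ^ 'm) \<Rightarrow> complex ^ 'k \<Rightarrow> real \<Rightarrow> complex ^ 'm" where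
  "combination V c t = (\<Sum>k\<in>UNIV. c $ k *s V k t)"

text \<open>
  The boundary values of the fundamental system normalized at \<open>a\<close>: the boundary-value problem is
  uniquely solvable if this matrix is invertible.
\<close>

definition characteristic_matrix :: "real \<Rightarrow> complex ^ 'k ^ 'k" where
  "characteristic_matrix \<epsilon> = (\<chi> i k. B \<epsilon> (fundamental \<epsilon> k) $ i)"

lemma linear_combination:
  assumes "linear_on_Cvec (n + r) T" "\<And>k. V k \<in> Cvec_space a b (n + r)"
  shows "T (combination V c) = (\<chi> i k. T (V k) $ i) *v c"
proof -
  have "T (combination V c) = (\<Sum>k\<in>UNIV. c $ k *s T (V k))"
    unfolding combination_def[abs_def] by (rule linear_on_Cvec_sum[OF assms])
  then show ?thesis
    by (simp add: vec_eq_iff matrix_vector_mult_def mult.commute)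
qed

lemma combination_in: "(\<And>k. V k \<in> Cvec_space a b (n + r)) \<Longrightarrow> combination V c \<in> Cvec_space a b (n + r)"
  unfolding combination_def[abs_def] by (rule Cvec_space_sum)

lemma combination_homogeneous:
  assumes "\<And>k. V k \<in> Cvec_space a b (n + r)"
    and "\<And>k t. t \<in> {a..b} \<Longrightarrow> L_op a b r K \<epsilon> (V k) t = 0" "t \<in> {a..b}"
  shows "L_op a b r K \<epsilon> (combination V c) t = 0"
  using linear_combination[OF linear_L[OF assms(3)] assms(1), where c = c] assms(2)[OF assms(3)]
  by (simp add: vec_eq_iff matrix_vector_mult_def)

lemma fundamental:
  assumes "\<epsilon> \<in> {0..<\<epsilon>0}"
  shows "fundamental \<epsilon> k \<in> Cvec_space a b (n + r)"
    and "t \<in> {a..b} \<Longrightarrow> L_op a b r K \<epsilon> (fundamental \<epsilon> k) t = 0"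
    and "jet (fundamental \<epsilon> k) a = axis k 1"
  unfolding fundamental_def using ivp[OF assms Cvec_space_zero] by auto

lemma matrix_of_axes: "(\<chi> i k. axis k 1 $ i) *v c = (c :: complex ^ 'k)"
  by (simp add: vec_eq_iff matrix_vector_mult_def axis_def if_distrib[of "\<lambda>x. x * _"] cong: if_cong)

lemma jet_combination_fundamental:
  assumes "\<epsilon> \<in> {0..<\<epsilon>0}"
  shows "jet (combination (fundamental \<epsilon>) c) a = c"
  using linear_combination[OF linear_jet[OF a_in] fundamental(1)[OF assms], where c = c]
  by (simp add: fundamental(3)[OF assms] matrix_of_axes)

text \<open>
  The general solution of the inhomogeneous equation, with the free coefficients identified as its jet
  at \<open>a\<close>. The boundary condition thereby becomes a linear system for that jet.
\<close>

lemma boundary_values: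
  assumes \<epsilon>: "\<epsilon> \<in> {0..<\<epsilon>0}" and f: "f \<in> Cvec_space a b n" and z: "z \<in> Cvec_space a b (n + r)"
    and L: "\<And>t. t \<in> {a..b} \<Longrightarrow> L_op a b r K \<epsilon> z t = f t"
  shows "z = (\<lambda>t. ivp \<epsilon> f 0 t + combination (fundamental \<epsilon>) (jet z a) t)"
    and "B \<epsilon> z = B \<epsilon> (ivp \<epsilon> f 0) + characteristic_matrix \<epsilon> *v jet z a"
proof -
  let ?w = "ivp \<epsilon> f 0" and ?c = "combination (fundamental \<epsilon>) (jet z a)"
  note w = ivp[OF \<epsilon> f, where c = 0]
  note V = fundamental[OF \<epsilon>]
  have c: "?c \<in> Cvec_space a b (n + r)" by (rule combination_in[OF V(1)])
  show eq: "z = (\<lambda>t. ?w t + ?c t)"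
  proof (rule equation_cancel[OF \<epsilon> z Cvec_space_add[OF w(1) c] _ a_in])
    show "L_op a b r K \<epsilon> z t = L_op a b r K \<epsilon> (\<lambda>t. ?w t + ?c t) t" if "t \<in> {a..b}" for t
      using linear_on_Cvec_add[OF linear_L[OF that] w(1) c, of \<epsilon>] w(2)[OF that] L[OF that]
        combination_homogeneous[OF V(1) V(2) that, where c = "jet z a"] by simp
    show "jet z a = jet (\<lambda>t. ?w t + ?c t) a"
      using linear_on_Cvec_add[OF linear_jet[OF a_in] w(1) c] w(3) jet_combination_fundamental[OF \<epsilon>] by simp
  qed
  have "B \<epsilon> (\<lambda>t. ?w t + ?c t) = B \<epsilon> ?w + characteristic_matrix \<epsilon> *v jet z a"
    using linear_on_Cvec_add[OF linear_B[OF \<epsilon>] w(1) c] linear_combination[OF linear_B[OF \<epsilon>] V(1), where c = "jet z a"]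
    by (simp add: characteristic_matrix_def)
  then show "B \<epsilon> z = B \<epsilon> ?w + characteristic_matrix \<epsilon> *v jet z a" by (simp flip: eq)
qed

lemma det_characteristic_matrix_0:
  assumes limit_problem_injective
  shows "det (characteristic_matrix 0) \<noteq> 0"
  unfolding det_nonzero_iff_ker
proof (intro allI impI)
  fix c assume c: "characteristic_matrix 0 *v c = 0"
  have 0: "(0::real) \<in> {0..<\<epsilon>0}" using \<epsilon>0_pos by simp
  note V = fundamental[OF 0]
  let ?z = "combination (fundamental 0) c"
  have "B 0 ?z = 0"
    using linear_combination[OF linear_B[OF 0] V(1), where c = c] c by (simp add: characteristic_matrix_def)
  then have "?z = (\<lambda>t. 0)"
    using assms combination_in[of "fundamental 0" c, OF V(1)]
      combination_homogeneous[of "fundamental 0" 0 _ c, OF V(1) V(2)]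
    unfolding limit_problem_injective_def by blast
  then have "jet (\<lambda>t. 0) a = c" using jet_combination_fundamental[OF 0, of c] by simp
  then show "c = 0" using linear_on_Cvec_zero[OF linear_jet[OF a_in]] by simp
qed

lemma B_limit:
  assumes operators_converge
    and "\<forall>\<^sub>F \<epsilon> in at_right 0. Z \<epsilon> \<in> Cvec_space a b (n + r)" "z \<in> Cvec_space a b (n + r)"
    and "Ck_lim (at_right 0) (n + r) Z z"
  shows "((\<lambda>\<epsilon>. B \<epsilon> (Z \<epsilon>)) \<longlongrightarrow> B 0 z) (at_right 0)"
  using op_family_tendsto[where B = B, OF \<epsilon>0_pos B_op _ assms(2-4)] assms(1)
  by (simp add: operators_converge_def)

lemma solution_continuous_if:
  assumes inj: limit_problem_injective and coeff: coefficients_converge and ops: operators_converge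
  shows "solution_continuous_at_0 a b n r \<epsilon>0 K B"
proof -
  let ?M = characteristic_matrix
  have 0: "(0::real) \<in> {0..<\<epsilon>0}" using \<epsilon>0_pos by simp
  have ev: "\<forall>\<^sub>F \<epsilon> in at_right 0. \<epsilon> \<in> {0..<\<epsilon>0}"
    using \<epsilon>0_pos by (intro eventually_parameter) auto
  have "((\<lambda>\<epsilon>. B \<epsilon> (fundamental \<epsilon> k)) \<longlongrightarrow> B 0 (fundamental 0 k)) (at_right 0)" for k
  proof (rule B_limit[OF ops])
    show "\<forall>\<^sub>F \<epsilon> in at_right 0. fundamental \<epsilon> k \<in> Cvec_space a b (n + r)"
      using ev by eventually_elim (rule fundamental)
    show "Ck_lim (at_right 0) (n + r) (\<lambda>\<epsilon>. fundamental \<epsilon> k) (fundamental 0 k)"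
      unfolding fundamental_def
      using ivp_limit[OF coeff, of "\<lambda>_ _. 0"] Cvec_space_zero Ck_lim_zero by blast
  qed (rule fundamental[OF 0])
  then have M: "((\<lambda>\<epsilon>. ?M \<epsilon> $ u $ v) \<longlongrightarrow> ?M 0 $ u $ v) (at_right 0)" for u v
    by (simp add: characteristic_matrix_def tendsto_vec_nth)
  have det0: "det (?M 0) \<noteq> 0" by (rule det_characteristic_matrix_0[OF inj])
  have "Ck_lim (at_right 0) 0 (\<lambda>\<epsilon> t. det (?M \<epsilon>)) (\<lambda>t. det (?M 0))"
    by (rule Ck_lim_det) (intro Ck_lim_value M)
  then have "((\<lambda>\<epsilon>. det (?M \<epsilon>)) \<longlongrightarrow> det (?M 0)) (at_right 0)"
    using Ck_lim_valueD[OF _ a_in] by fastforce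
  then have "\<forall>\<^sub>F \<epsilon> in at_right 0. det (?M \<epsilon>) \<noteq> 0"
    using det0 by (rule tendsto_imp_eventually_ne)
  then obtain d where d: "d > 0" "\<And>\<epsilon>. 0 < \<epsilon> \<Longrightarrow> \<epsilon> < d \<Longrightarrow> det (?M \<epsilon>) \<noteq> 0"
    by (auto simp: eventually_at_right_field)
  define \<epsilon>1 where "\<epsilon>1 = min d (\<epsilon>0 / 2)"
  have \<epsilon>1: "0 < \<epsilon>1" "\<epsilon>1 < \<epsilon>0" using d(1) \<epsilon>0_pos by (auto simp: \<epsilon>1_def)
  have det: "det (?M \<epsilon>) \<noteq> 0" if "\<epsilon> \<in> {0..<\<epsilon>1}" for \<epsilon>
    using that d(2)[of \<epsilon>] det0 by (cases "\<epsilon> = 0") (auto simp: \<epsilon>1_def)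
  \<comment> \<open>Solutions correspond to the solutions \<open>c\<close> of the characteristic system, which form a singleton.\<close>
  have unique: "\<exists>!z. is_solution a b n r K B \<epsilon> f q z" if "\<epsilon> \<in> {0..<\<epsilon>1}" "f \<in> Cvec_space a b n" for \<epsilon> f q
  proof -
    have \<epsilon>: "\<epsilon> \<in> {0..<\<epsilon>0}" using that \<epsilon>1 by auto
    note w = ivp[OF \<epsilon> that(2), where c = 0]
    note V = fundamental[OF \<epsilon>]
    have "\<exists>!c. ?M \<epsilon> *v c = q - B \<epsilon> (ivp \<epsilon> f 0)"
      using cramer[OF det[OF that(1)]] by auto
    then obtain c where c: "?M \<epsilon> *v c = q - B \<epsilon> (ivp \<epsilon> f 0)"
        and c_unique: "\<And>c'. ?M \<epsilon> *v c' = q - B \<epsilon> (ivp \<epsilon> f 0) \<Longrightarrow> c' = c" by auto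
    let ?z = "\<lambda>t. ivp \<epsilon> f 0 t + combination (fundamental \<epsilon>) c t"
    have C: "combination (fundamental \<epsilon>) c \<in> Cvec_space a b (n + r)" by (rule combination_in[OF V(1)])
    have "is_solution a b n r K B \<epsilon> f q ?z"
      unfolding is_solution_def
    proof (intro conjI ballI)
      show "?z \<in> Cvec_space a b (n + r)" by (rule Cvec_space_add[OF w(1) C])
      show "L_op a b r K \<epsilon> ?z t = f t" if "t \<in> {a..b}" for t
        using linear_on_Cvec_add[OF linear_L[OF that] w(1) C, of \<epsilon>] w(2)[OF that]
          combination_homogeneous[OF V(1) V(2) that, where c = c] by simp
      show "B \<epsilon> ?z = q"
        using linear_on_Cvec_add[OF linear_B[OF \<epsilon>] w(1) C] c
          linear_combination[OF linear_B[OF \<epsilon>] V(1), where c = c] by (simp add: characteristic_matrix_def)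
    qed
    moreover have "z = ?z" if "is_solution a b n r K B \<epsilon> f q z" for z
    proof -
      have z: "z \<in> Cvec_space a b (n + r)" "\<And>t. t \<in> {a..b} \<Longrightarrow> L_op a b r K \<epsilon> z t = f t" "B \<epsilon> z = q"
        using that by (auto simp: is_solution_def)
      note bv = boundary_values[OF \<epsilon> \<open>f \<in> Cvec_space a b n\<close> z(1,2)]
      have "jet z a = c" using bv(2) z(3) by (intro c_unique) simp
      with bv(1) show ?thesis by simp
    qed
    ultimately show ?thesis by blast
  qed
  have conv: "Cvec_tends a b (n + r) z"
    if f: "\<forall>\<epsilon>\<in>{0..<\<epsilon>0}. f \<epsilon> \<in> Cvec_space a b n" "Cvec_tends a b n f"
      and q: "(q \<longlongrightarrow> q 0) (at_right 0)"
      and z: "\<forall>\<epsilon>\<in>{0..<\<epsilon>1}. is_solution a b n r K B \<epsilon> (f \<epsilon>) (q \<epsilon>) (z \<epsilon>)" for f q z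
  proof -
    have ev1: "\<forall>\<^sub>F \<epsilon> in at_right 0. \<epsilon> \<in> {0..<\<epsilon>1}"
      using \<epsilon>1 by (intro eventually_parameter) auto
    have 01: "(0::real) \<in> {0..<\<epsilon>1}" using \<epsilon>1 by simp
    have sub: "\<epsilon> \<in> {0..<\<epsilon>0}" if "\<epsilon> \<in> {0..<\<epsilon>1}" for \<epsilon> using that \<epsilon>1 by auto
    have z': "z \<epsilon> \<in> Cvec_space a b (n + r)" "\<And>t. t \<in> {a..b} \<Longrightarrow> L_op a b r K \<epsilon> (z \<epsilon>) t = f \<epsilon> t"
      "B \<epsilon> (z \<epsilon>) = q \<epsilon>" if "\<epsilon> \<in> {0..<\<epsilon>1}" for \<epsilon>
      using z that by (auto simp: is_solution_def)
    have "\<forall>\<^sub>F \<epsilon> in at_right 0. f \<epsilon> \<in> Cvec_space a b n"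
      using ev by eventually_elim (use f(1) in blast)
    then have flim: "Ck_lim (at_right 0) n f (f 0)"
      using f 0 by (simp add: Cvec_tends_iff)
    have wlim: "Ck_lim (at_right 0) (n + r) (\<lambda>\<epsilon>. ivp \<epsilon> (f \<epsilon>) 0) (ivp 0 (f 0) 0)"
      by (rule ivp_limit[OF coeff _ flim]) (use f(1) in blast)
    have "\<forall>\<^sub>F \<epsilon> in at_right 0. ivp \<epsilon> (f \<epsilon>) 0 \<in> Cvec_space a b (n + r)"
      using ev by eventually_elim (use ivp f(1) in blast)
    from B_limit[OF ops this ivp(1)[OF 0] wlim]
    have Bw: "((\<lambda>\<epsilon>. B \<epsilon> (ivp \<epsilon> (f \<epsilon>) 0)) \<longlongrightarrow> B 0 (ivp 0 (f 0) 0)) (at_right 0)"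
      using f(1) 0 by blast
    have c: "?M \<epsilon> *v jet (z \<epsilon>) a = q \<epsilon> - B \<epsilon> (ivp \<epsilon> (f \<epsilon>) 0)" if "\<epsilon> \<in> {0..<\<epsilon>1}" for \<epsilon>
      using boundary_values(2)[OF sub[OF that] _ z'(1)[OF that] z'(2)[OF that]] f(1) sub[OF that] z'(3)[OF that]
      by simp
    have "\<forall>\<^sub>F \<epsilon> in at_right 0. ?M \<epsilon> *v jet (z \<epsilon>) a = q \<epsilon> - B \<epsilon> (ivp \<epsilon> (f \<epsilon>) 0)"
      using ev1 by eventually_elim (rule c)
    from tendsto_cramer[OF M det0 tendsto_diff[OF q Bw] this c[OF 01]]
    have init: "((\<lambda>\<epsilon>. jet (z \<epsilon>) a) \<longlongrightarrow> jet (z 0) a) (at_right 0)" .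
    have "\<forall>\<^sub>F \<epsilon> in at_right 0. z \<epsilon> \<in> Cvec_space a b (n + r) \<and>
        (\<forall>t\<in>{a..b}. L_op a b r K \<epsilon> (z \<epsilon>) t = f \<epsilon> t)"
      using ev1 by eventually_elim (use z' in blast)
    from equation_limit[OF coeff this z'(1)[OF 01] z'(2)[OF 01] flim init]
    have "Ck_lim (at_right 0) (n + r) z (z 0)" .
    moreover have "\<forall>\<^sub>F \<epsilon> in at_right 0. z \<epsilon> \<in> Cvec_space a b (n + r)"
      using ev1 by eventually_elim (rule z')
    ultimately show ?thesis
      using z'(1)[OF 01] by (simp add: Cvec_tends_iff)
  qed
  show ?thesis
    unfolding solution_continuous_at_0_def
    using \<epsilon>1 unique conv by (intro exI[of _ \<epsilon>1]) blast
qed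

end

context bvp
begin

text \<open>
  Both convergence statements are obtained by inverting the jet matrix \<open>W\<close> of the solutions with
  unit boundary values, which converges by assumption.
\<close>

lemma solution_continuous_only_if:
  assumes "solution_continuous_at_0 a b n r \<epsilon>0 K B"
  shows limit_problem_injective coefficients_converge operators_converge
proof -
  obtain \<epsilon>1 where \<epsilon>1: "0 < \<epsilon>1" "\<epsilon>1 < \<epsilon>0"
    and unique': "\<forall>\<epsilon>\<in>{0..<\<epsilon>1}. \<forall>f\<in>Cvec_space a b n. \<forall>q. \<exists>!z. is_solution a b n r K B \<epsilon> f q z"
    and conv: "\<forall>f q z. (\<forall>\<epsilon>\<in>{0..<\<epsilon>0}. f \<epsilon> \<in> Cvec_space a b n) \<longrightarrow>
      Cvec_tends a b n f \<longrightarrow> (q \<longlongrightarrow> q 0) (at_right 0) \<longrightarrow>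
      (\<forall>\<epsilon>\<in>{0..<\<epsilon>1}. is_solution a b n r K B \<epsilon> (f \<epsilon>) (q \<epsilon>) (z \<epsilon>)) \<longrightarrow>
      Cvec_tends a b (n + r) z"
    using assms unfolding solution_continuous_at_0_def by (elim exE conjE) (rule that)
  have unique: "\<exists>!z. is_solution a b n r K B \<epsilon> f q z"
    if "\<epsilon> \<in> {0..<\<epsilon>1}" "f \<in> Cvec_space a b n" for \<epsilon> f q
    using unique' that by blast
  have 0: "(0::real) \<in> {0..<\<epsilon>0}" and 01: "(0::real) \<in> {0..<\<epsilon>1}" using \<epsilon>0_pos \<epsilon>1 by auto
  have sub: "\<epsilon> \<in> {0..<\<epsilon>0}" if "\<epsilon> \<in> {0..<\<epsilon>1}" for \<epsilon> using that \<epsilon>1 by auto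
  have ev: "\<forall>\<^sub>F \<epsilon> in at_right 0. \<epsilon> \<in> {0..<\<epsilon>1}"
    using \<epsilon>1 by (intro eventually_parameter) auto
  have ev0: "\<forall>\<^sub>F \<epsilon> in at_right 0. \<epsilon> \<in> {0..<\<epsilon>0}"
    using ev by eventually_elim (rule sub)
  have zero_solution: "is_solution a b n r K B \<epsilon> (\<lambda>t. 0) 0 (\<lambda>t. 0)" if "\<epsilon> \<in> {0..<\<epsilon>1}" for \<epsilon>
    unfolding is_solution_def
    using Cvec_space_zero linear_on_Cvec_zero[OF linear_L] linear_on_Cvec_zero[OF linear_B[OF sub[OF that]]]
    by blast
  show limit_problem_injective
    unfolding limit_problem_injective_def
  proof (intro ballI impI)
    fix z assume "z \<in> Cvec_space a b (n + r)" "(\<forall>t\<in>{a..b}. L_op a b r K 0 z t = 0) \<and> B 0 z = 0"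
    then have "is_solution a b n r K B 0 (\<lambda>t. 0) 0 z" by (simp add: is_solution_def)
    then show "z = (\<lambda>t. 0)"
      using zero_solution[OF 01] unique[OF 01 Cvec_space_zero, of 0] by blast
  qed
  have limit: "Ck_lim (at_right 0) (n + r) z (z 0)"
    if f: "\<And>\<epsilon>. \<epsilon> \<in> {0..<\<epsilon>0} \<Longrightarrow> f \<epsilon> \<in> Cvec_space a b n" "Ck_lim (at_right 0) n f (f 0)"
      and z: "\<And>\<epsilon>. \<epsilon> \<in> {0..<\<epsilon>1} \<Longrightarrow> is_solution a b n r K B \<epsilon> (f \<epsilon>) (q \<epsilon>) (z \<epsilon>)"
      and q: "(q \<longlongrightarrow> q 0) (at_right 0)" for f q z
  proof -
    have "\<forall>\<^sub>F \<epsilon> in at_right 0. f \<epsilon> \<in> Cvec_space a b n"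
      using ev0 by eventually_elim (rule f)
    then have "Cvec_tends a b n f" using f 0 by (simp add: Cvec_tends_iff)
    from conv[rule_format, OF f(1) this q z] have tends: "Cvec_tends a b (n + r) z" by simp
    have "\<forall>\<^sub>F \<epsilon> in at_right 0. z \<epsilon> \<in> Cvec_space a b (n + r)"
      using ev by eventually_elim (use z in \<open>auto simp: is_solution_def\<close>)
    moreover have "z 0 \<in> Cvec_space a b (n + r)" using z[OF 01] by (simp add: is_solution_def)
    ultimately show ?thesis using tends by (simp add: Cvec_tends_iff)
  qed
  define Y where "Y \<epsilon> l = (THE z. is_solution a b n r K B \<epsilon> (\<lambda>t. 0) (axis l 1) z)" for \<epsilon> l
  have Y_sol: "is_solution a b n r K B \<epsilon> (\<lambda>t. 0) (axis l 1) (Y \<epsilon> l)" if "\<epsilon> \<in> {0..<\<epsilon>1}" for \<epsilon> l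
    unfolding Y_def using theI'[OF unique[OF that Cvec_space_zero]] .
  have Y: "Y \<epsilon> l \<in> Cvec_space a b (n + r)" "\<And>t. t \<in> {a..b} \<Longrightarrow> L_op a b r K \<epsilon> (Y \<epsilon> l) t = 0"
    "B \<epsilon> (Y \<epsilon> l) = axis l 1" if "\<epsilon> \<in> {0..<\<epsilon>1}" for \<epsilon> l
    using Y_sol[OF that, of l] by (auto simp: is_solution_def)
  have Y_lim: "Ck_lim (at_right 0) (n + r) (\<lambda>\<epsilon>. Y \<epsilon> l) (Y 0 l)" for l
    by (rule limit[of "\<lambda>_ _. 0" "\<lambda>_. axis l 1"]) (simp_all add: Y_sol Cvec_space_zero Ck_lim_zero del: atLeastLessThan_iff)
  define W where "W \<epsilon> t = (\<chi> k l. jet (Y \<epsilon> l) t $ k)" for \<epsilon> t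
  have B_comb: "B \<epsilon> (combination (Y \<epsilon>) c) = c" if "\<epsilon> \<in> {0..<\<epsilon>1}" for \<epsilon> c
    using linear_combination[OF linear_B[OF sub[OF that]] Y(1)[OF that], where c = c]
    by (simp add: Y(3)[OF that] matrix_of_axes)
  have jet_comb: "jet (combination (Y \<epsilon>) c) t = W \<epsilon> t *v c" if "\<epsilon> \<in> {0..<\<epsilon>1}" "t \<in> {a..b}" for \<epsilon> c t
    using linear_combination[OF linear_jet[OF that(2)] Y(1)[OF that(1)], where c = c]
    by (simp add: W_def)
  have comb_hom: "L_op a b r K \<epsilon> (combination (Y \<epsilon>) c) t = 0" if "\<epsilon> \<in> {0..<\<epsilon>1}" "t \<in> {a..b}" for \<epsilon> c t
    by (rule combination_homogeneous[OF Y(1,2)[OF that(1)] that(2)])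
  have comb_in: "combination (Y \<epsilon>) c \<in> Cvec_space a b (n + r)" if "\<epsilon> \<in> {0..<\<epsilon>1}" for \<epsilon> c
    by (rule combination_in[OF Y(1)[OF that]])
  \<comment> \<open>A combination whose jet vanishes somewhere is 0, and its coefficients are its boundary values.\<close>
  have det_W: "det (W \<epsilon> t) \<noteq> 0" if \<epsilon>: "\<epsilon> \<in> {0..<\<epsilon>1}" and t: "t \<in> {a..b}" for \<epsilon> t
    unfolding det_nonzero_iff_ker
  proof (intro allI impI)
    fix c assume "W \<epsilon> t *v c = 0"
    then have "jet (combination (Y \<epsilon>) c) t = jet (\<lambda>t. 0) t"
      using jet_comb[OF \<epsilon> t] linear_on_Cvec_zero[OF linear_jet[OF t]] by simp
    then have "combination (Y \<epsilon>) c = (\<lambda>t. 0)"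
      using comb_hom[OF \<epsilon>] linear_on_Cvec_zero[OF linear_L]
      by (intro equation_cancel[OF sub[OF \<epsilon>] comb_in[OF \<epsilon>] Cvec_space_zero _ t]) simp_all
    then show "c = 0"
      using B_comb[OF \<epsilon>, of c] linear_on_Cvec_zero[OF linear_B[OF sub[OF \<epsilon>]]] by simp
  qed
  have W_lim: "Ck_lim (at_right 0) n (\<lambda>\<epsilon> t. W \<epsilon> t $ k $ l) (\<lambda>t. W 0 t $ k $ l)" for k l
    using Ck_lim_jet[OF Y_lim, of l k] by (simp add: W_def)
  show coeff: coefficients_converge
    unfolding coefficients_converge_def
  proof (intro allI impI)
    fix i u v assume i: "i < r"
    define X where "X \<epsilon> t = (\<chi> k. K (p k) \<epsilon> t $ u $ s k)" for \<epsilon> t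
    define R where "R \<epsilon> t = (\<chi> l. - (deriv_on a b r (Y \<epsilon> l) t $ u))" for \<epsilon> t
    \<comment> \<open>The homogeneous equation for \<open>Y \<epsilon> l\<close>, read as the \<open>l\<close>-th equation for the unknown row \<open>u\<close> of the coefficients.\<close>
    have eq: "det (transpose (W \<epsilon> t)) \<noteq> 0 \<and> transpose (W \<epsilon> t) *v X \<epsilon> t = R \<epsilon> t"
      if "\<epsilon> \<in> {0..<\<epsilon>1}" "t \<in> {a..b}" for \<epsilon> t
    proof -
      have "(\<Sum>k\<in>UNIV. K (p k) \<epsilon> t $ u $ s k * jet (Y \<epsilon> l) t $ k) = - (deriv_on a b r (Y \<epsilon> l) t $ u)" for l
        using Y(2)[OF that, of l] L_op_nth[of K \<epsilon> "Y \<epsilon> l" t u]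
        by (simp add: eq_neg_iff_add_eq_0 add.commute)
      then have "transpose (W \<epsilon> t) *v X \<epsilon> t = R \<epsilon> t"
        by (simp add: vec_eq_iff matrix_vector_mult_def transpose_def W_def X_def R_def mult.commute)
      then show ?thesis using det_W[OF that] by (simp add: det_transpose)
    qed
    have "Ck_lim (at_right 0) n (\<lambda>\<epsilon> t. X \<epsilon> t $ idx i v) (\<lambda>t. X 0 t $ idx i v)"
    proof (rule Ck_lim_cramer[where A = "\<lambda>\<epsilon> t. transpose (W \<epsilon> t)" and ?A0.0 = "\<lambda>t. transpose (W 0 t)"
          and Y = R and y = "R 0"])
      show "Ck_lim (at_right 0) n (\<lambda>\<epsilon> t. transpose (W \<epsilon> t) $ k $ l) (\<lambda>t. transpose (W 0 t) $ k $ l)" for k l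
        using W_lim[of l k] by (simp add: transpose_def)
      show "Ck_lim (at_right 0) n (\<lambda>\<epsilon> t. R \<epsilon> t $ l) (\<lambda>t. R 0 t $ l)" for l
        using Ck_lim_deriv_on[OF Y_lim[of l]] by (simp add: R_def Ck_lim_vec_iff Ck_lim_minus)
      show "\<forall>\<^sub>F \<epsilon> in at_right 0. \<forall>t\<in>{a..b}. det (transpose (W \<epsilon> t)) \<noteq> 0 \<and> transpose (W \<epsilon> t) *v X \<epsilon> t = R \<epsilon> t"
        using ev by eventually_elim (intro ballI eq)
    qed (rule eq[OF 01])
    then show "Ck_lim (at_right 0) n (\<lambda>\<epsilon> t. K i \<epsilon> t $ u $ v) (\<lambda>t. K i 0 t $ u $ v)"
      by (simp add: X_def p_s_idx i)
  qed
  show operators_converge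
    unfolding operators_converge_def
  proof
    fix z :: "real \<Rightarrow> complex ^ 'm" assume z: "z \<in> Cvec_space a b (n + r)"
    then have zC: "Ck (n + r) z" by (simp add: Cvec_space_iff)
    define f where "f \<epsilon> = extend_zero (L_op a b r K \<epsilon> z)" for \<epsilon>
    have f_in: "f \<epsilon> \<in> Cvec_space a b n" if "\<epsilon> \<in> {0..<\<epsilon>0}" for \<epsilon>
    proof -
      have "Ck n (L_op a b r K \<epsilon> z)"
        using Ck_lim_L_op[where F = "at_right (0::real)" and K = K and \<omega> = "\<lambda>_. \<epsilon>" and ?\<omega>0.0 = \<epsilon>, OF _ zC]
          K_smooth[OF that] unfolding Ck_iff_Ck_lim by blast
      then show ?thesis unfolding f_def by (rule extend_zero_in_Cvec_space)
    qed
    have f_lim: "Ck_lim (at_right 0) n f (f 0)"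
      unfolding f_def
      using coeff by (intro Ck_lim_extend_zero Ck_lim_L_op zC) (auto simp: coefficients_converge_def)
    \<comment> \<open>At the parameter 0 the solution of this auxiliary problem is \<open>z\<close> itself.\<close>
    define w where "w \<epsilon> = (if \<epsilon> = 0 then z else THE w. is_solution a b n r K B \<epsilon> (f \<epsilon>) (B 0 z) w)" for \<epsilon>
    have w_sol: "is_solution a b n r K B \<epsilon> (f \<epsilon>) (B 0 z) (w \<epsilon>)" if "\<epsilon> \<in> {0..<\<epsilon>1}" for \<epsilon>
    proof (cases "\<epsilon> = 0")
      case True
      then show ?thesis using z by (simp add: is_solution_def w_def f_def extend_zero_def)
    next
      case False
      then show ?thesis
        using theI'[OF unique[OF that f_in[OF sub[OF that]]]] by (simp add: w_def)
    qed
    then have w: "w \<epsilon> \<in> Cvec_space a b (n + r)" "\<And>t. t \<in> {a..b} \<Longrightarrow> L_op a b r K \<epsilon> (w \<epsilon>) t = L_op a b r K \<epsilon> z t"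
      "B \<epsilon> (w \<epsilon>) = B 0 z" if "\<epsilon> \<in> {0..<\<epsilon>1}" for \<epsilon>
      using that by (auto simp: is_solution_def f_def extend_zero_def)
    have w_lim: "Ck_lim (at_right 0) (n + r) w z"
      using limit[of f "\<lambda>_. B 0 z" w, OF f_in f_lim w_sol] by (simp add: w_def)
    define d where "d \<epsilon> = B \<epsilon> z - B 0 z" for \<epsilon>
    define h where "h \<epsilon> t = z t - w \<epsilon> t" for \<epsilon> t
    have h_eq: "h \<epsilon> = combination (Y \<epsilon>) (d \<epsilon>)" if \<epsilon>: "\<epsilon> \<in> {0..<\<epsilon>1}" for \<epsilon>
    proof -
      have "is_solution a b n r K B \<epsilon> (\<lambda>t. 0) (d \<epsilon>) (h \<epsilon>)"
        unfolding is_solution_def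
      proof (intro conjI ballI)
        show "h \<epsilon> \<in> Cvec_space a b (n + r)"
          unfolding h_def[abs_def] by (rule Cvec_space_diff[OF z w(1)[OF \<epsilon>]])
        show "L_op a b r K \<epsilon> (h \<epsilon>) t = 0" if "t \<in> {a..b}" for t
          using linear_on_Cvec_diff[OF linear_L[OF that] z w(1)[OF \<epsilon>], of \<epsilon>] w(2)[OF \<epsilon> that]
          by (simp add: h_def[abs_def])
        show "B \<epsilon> (h \<epsilon>) = d \<epsilon>"
          using linear_on_Cvec_diff[OF linear_B[OF sub[OF \<epsilon>]] z w(1)[OF \<epsilon>]] w(3)[OF \<epsilon>]
          by (simp add: h_def[abs_def] d_def)
      qed
      moreover have "is_solution a b n r K B \<epsilon> (\<lambda>t. 0) (d \<epsilon>) (combination (Y \<epsilon>) (d \<epsilon>))"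
        unfolding is_solution_def using comb_in comb_hom B_comb \<epsilon> by blast
      ultimately show ?thesis using unique[OF \<epsilon> Cvec_space_zero, of "d \<epsilon>"] by blast
    qed
    have "Ck_lim (at_right 0) (n + r) h (\<lambda>t. z t - z t)"
      unfolding h_def[abs_def] by (rule Ck_lim_diff[OF Ck_lim_const[OF zC] w_lim])
    then have "((\<lambda>\<epsilon>. jet (h \<epsilon>) a) \<longlongrightarrow> jet (\<lambda>t. 0) a) (at_right 0)"
      using tendsto_jet[OF _ a_in] by simp
    then have jet_lim: "((\<lambda>\<epsilon>. jet (h \<epsilon>) a) \<longlongrightarrow> 0) (at_right 0)"
      using linear_on_Cvec_zero[OF linear_jet[OF a_in]] by simp
    have "(d \<longlongrightarrow> 0) (at_right 0)"
    proof (rule tendsto_cramer[OF _ det_W[OF 01 a_in] jet_lim])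
      show "((\<lambda>\<epsilon>. W \<epsilon> a $ k $ l) \<longlongrightarrow> W 0 a $ k $ l) (at_right 0)" for k l
        by (rule Ck_lim_valueD[OF W_lim a_in])
      show "\<forall>\<^sub>F \<epsilon> in at_right 0. W \<epsilon> a *v d \<epsilon> = jet (h \<epsilon>) a"
        using ev by eventually_elim (simp add: h_eq jet_comb a_in del: atLeastLessThan_iff atLeastAtMost_iff)
    qed simp
    from tendsto_add[OF this tendsto_const[of "B 0 z"]]
    show "((\<lambda>\<epsilon>. B \<epsilon> z) \<longlongrightarrow> B 0 z) (at_right 0)" by (simp add: d_def)
  qed
qed

end

theorem mainTheorem1:
  fixes a b \<epsilon>0 :: real
    and n r :: nat
    and K :: "nat \<Rightarrow> real \<Rightarrow> real \<Rightarrow> complex ^ 'm ^ 'm"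
    and B :: "real \<Rightarrow> (real \<Rightarrow> complex ^ 'm) \<Rightarrow> complex ^ 'k"
  assumes "a < b" and "r \<ge> 1" and "\<epsilon>0 > 0"
    and "CARD('k) = r * CARD('m)"
    and "\<And>\<epsilon> j. \<epsilon> \<in> {0..<\<epsilon>0} \<Longrightarrow> j \<in> {1..r} \<Longrightarrow> K (r - j) \<epsilon> \<in> Cmat_space a b n"
    and "\<And>\<epsilon>. \<epsilon> \<in> {0..<\<epsilon>0} \<Longrightarrow> continuous_linear_op a b (n + r) (B \<epsilon>)"
  shows "solution_continuous_at_0 a b n r \<epsilon>0 K B \<longleftrightarrow>
     (\<forall>z\<in>Cvec_space a b (n + r).
        (\<forall>t\<in>{a..b}. L_op a b r K 0 z t = 0) \<and> B 0 z = 0 \<longrightarrow> z = (\<lambda>t. 0)) \<and>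
     (\<forall>j\<in>{1..r}. Cmat_tends a b n (K (r - j))) \<and>
     (\<forall>z\<in>Cvec_space a b (n + r). ((\<lambda>\<epsilon>. B \<epsilon> z) \<longlongrightarrow> B 0 z) (at_right 0))"
proof -
  have "card (UNIV :: 'k set) = card ({..<r} \<times> (UNIV :: 'm set))"
    using assms(4) by (simp add: card_cartesian_product)
  then obtain g where g: "bij_betw g (UNIV :: 'k set) ({..<r} \<times> (UNIV :: 'm set))"
    using finite_same_card_bij[of "UNIV :: 'k set" "{..<r} \<times> (UNIV :: 'm set)"] by auto
  interpret segment a b by unfold_locales (rule assms(1))
  have K: "K i \<epsilon> \<in> Cmat_space a b n" if "\<epsilon> \<in> {0..<\<epsilon>0}" "i < r" for \<epsilon> i
    using assms(5)[OF that(1), of "r - i"] that(2) by simp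
  interpret bvp a b r "\<lambda>k. fst (g k)" "\<lambda>k. snd (g k)" n \<epsilon>0 K B
  proof unfold_locales
    show "Ck n (\<lambda>t. K i \<epsilon> t $ u $ v)" if "\<epsilon> \<in> {0..<\<epsilon>0}" "i < r" for \<epsilon> i u v
      using K[OF that] by (simp add: Cmat_space_iff)
  qed (use assms g in simp_all)
  have ev: "\<forall>\<^sub>F \<epsilon> in at_right 0. \<epsilon> \<in> {0..<\<epsilon>0}"
    using assms(3) by (intro eventually_parameter) auto
  have tends: "Cmat_tends a b n (K i) \<longleftrightarrow>
      (\<forall>u v. Ck_lim (at_right 0) n (\<lambda>\<epsilon> t. K i \<epsilon> t $ u $ v) (\<lambda>t. K i 0 t $ u $ v))" if "i < r" for i
  proof (rule Cmat_tends_iff)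
    show "\<forall>\<^sub>F \<epsilon> in at_right 0. K i \<epsilon> \<in> Cmat_space a b n"
      using ev by eventually_elim (rule K[OF _ that])
  qed (use K[OF _ that, of 0] assms(3) in simp)
  have "coefficients_converge \<longleftrightarrow> (\<forall>i<r. Cmat_tends a b n (K i))"
    unfolding coefficients_converge_def using tends by blast
  also have "\<dots> \<longleftrightarrow> (\<forall>j\<in>{1..r}. Cmat_tends a b n (K (r - j)))"
  proof
    assume "\<forall>j\<in>{1..r}. Cmat_tends a b n (K (r - j))"
    then show "\<forall>i<r. Cmat_tends a b n (K i)"
      by (metis One_nat_def Suc_leI atLeastAtMost_iff diff_diff_cancel diff_le_self less_imp_le zero_less_diff)
  qed auto
  finally show ?thesis
    using solution_continuous_only_if solution_continuous_if
    unfolding limit_problem_injective_def operators_converge_def by blast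
qed

end
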